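(* Let $(\pi,V_{\pi})$ be an induced representation of Langlands type of $\mathrm{GL}_n(F)$ with newform $v^{\circ} \in V_{\pi}^{\tau_{\chi_{\pi},c(\pi)}}$. For all $k \in K$, we have that \[\frac{\langle \pi(k)\cdot v^{\circ}, v^{\circ}\rangle}{\langle v^{\circ},v^{\circ}\rangle} = P_{\chi_{\pi},c(\pi)}^{\circ}(e_n k) = \begin{cases} \chi_{\pi}(k_{n,n}) & \text{if } k \in K_0(\mathfrak{p}^{c(\pi)}), \\ \alpha\, \chi_{\pi}(k_{n,n}) & \text{if } c(\pi) > c(\chi_{\pi}) \text{ and } k \in K_0(\mathfrak{p}^{c(\pi)-1}) \setminus K_0(\mathfrak{p}^{c(\pi)}), \\ 0 & \text{otherwise,}\end{cases}\] where $k_{n,n}$ is the lower-right entry of $k$ and \[\alpha = \begin{cases} -\dfrac{q-1}{q(q^{n-1}-1)} & \text{if } c(\pi) = 1, \\ -\dfrac{1}{q^{n-1}-1} & \text{if } c(\pi) \geq 2.\end{cases}\]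
   Context: Let $F$ be a nonarchimedean local field with ring of integers $\mathcal{O}$, maximal ideal $\mathfrak{p}$, uniformiser $\varpi$, residue field of order $q$, and absolute value normalised by $|\varpi| = q^{-1}$. Fix $n \geq 2$ and let $K = \mathrm{GL}_n(\mathcal{O})$ with Haar probability measure $dk$. Let \[K_{n-1,1} = \left\{\begin{pmatrix} a & b \\ 0 & 1\end{pmatrix} \in K : a \in \mathrm{GL}_{n-1}(\mathcal{O}),\ b \in \mathrm{Mat}_{(n-1)\times 1}(\mathcal{O})\right\}.\] For $m \geq 0$ let $K(\mathfrak{p}^m) = \{k \in K : k - 1_n \in \mathrm{Mat}_{n\times n}(\mathfrak{p}^m)\}$ and, writing $k = \begin{pmatrix} a & b \\ c & d\end{pmatrix} \in K$ with $c \in \mathrm{Mat}_{1\times(n-1)}(\mathcal{O})$, $d \in \mathcal{O}$, let $K_0(\mathfrak{p}^m) = \{k \in K : c \in \mathrm{Mat}_{1\times(n-1)}(\mathfrak{p}^m)\}$ and $K_1(\mathfrak{p}^m) = \{k \in K_0(\mathfrak{p}^m) : d - 1 \in \mathfrak{p}^m\}$. $\widehat{\mathcal{O}^{\times}}$ is the set of continuous characters $\chi : \mathcal{O}^{\times} \to \mathbb{C}^{\times}$; $c(\chi)$ is the least nonnegative integer $m$ such that $\chi$ is trivial on $1+\mathfrak{p}^m$ (on $\mathcal{O}^{\times}$ if $m=0$). Convention: if $\chi$ is trivial, $\chi(y)$ is read as $1$ for every $y \in \mathcal{O}$. Let $S^{n-1} = \{x \in F^n : \max_i |x_i| = 1\}$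 (row vectors), $e_n = (0,\ldots,0,1)$, and let $C^{\infty}(S^{n-1})$ be the space of locally constant functions $S^{n-1} \to \mathbb{C}$ with inner product $\langle f_1,f_2\rangle = \int_K f_1(e_nk)\overline{f_2(e_nk)}\,dk$. Let $C^{\infty}(S^{n-1})_{\chi}^{K(\mathfrak{p}^m)}$ be the subspace of $f$ with $f(xk) = f(x)$ for $k \in K(\mathfrak{p}^m)$ and $f(ax) = \chi(a)f(x)$ for $a \in \mathcal{O}^{\times}$. For $m \geq c(\chi)$, $\mathcal{H}_{\chi,m}(S^{n-1})$ is $C^{\infty}(S^{n-1})_{\chi}^{K(\mathfrak{p}^{c(\chi)})}$ if $m = c(\chi)$, and the orthogonal complement of $C^{\infty}(S^{n-1})_{\chi}^{K(\mathfrak{p}^{m-1})}$ in $C^{\infty}(S^{n-1})_{\chi}^{K(\mathfrak{p}^m)}$ if $m > c(\chi)$. $\tau_{\chi,m}$ is the (irreducible) representation of $K$ on $\mathcal{H}_{\chi,m}(S^{n-1})$ by right translation. $P_{\chi,m}^{\circ}$ is the unique $K_{n-1,1}$-invariant function in $\mathcal{H}_{\chi,m}(S^{n-1})$ (i.e. $P_{\chi,m}^{\circ}(xk') = P_{\chi,m}^{\circ}(x)$ for $k' \in K_{n-1,1}$) with $P_{\chi,m}^{\circ}(e_n) = 1$. Induced representations of Langlands type: $(\pi,V_{\pi})$ is such a representation of $\mathrm{GL}_n(F)$ if there are positive integers $n_1 + \cdots + n_r = n$ and essentially square-integrable representations $\pi_j = \sigma_j \otimes |\det|^{t_j}$ of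 $\mathrm{GL}_{n_j}(F)$, with $\sigma_j$ square-integrable and $t_j \in \mathbb{C}$, $\Re(t_1) \geq \cdots \geq \Re(t_r)$, such that $\pi = \mathrm{Ind}_{P(F)}^{\mathrm{GL}_n(F)} \pi_1 \boxtimes \cdots \boxtimes \pi_r$ is the normalised parabolic induction from the standard upper parabolic subgroup $P = P_{(n_1,\ldots,n_r)}$. Let $\omega_{\pi}$ be its central character and $\chi_{\pi} = \omega_{\pi}|_{\mathcal{O}^{\times}}$. The conductor exponent $c(\pi)$ is the minimal nonnegative integer $m$ for which the space $V_{\pi}^{K_1(\mathfrak{p}^m)}$ of $K_1(\mathfrak{p}^m)$-invariant vectors is nonzero; for $m = c(\pi)$ this space is one-dimensional (Jacquet, Piatetski-Shapiro, Shalika), and the newform $v^{\circ}$ is a nonzero vector in it. One has $c(\chi_{\pi}) \leq c(\pi)$ and $v^{\circ}$ lies in the finite-dimensional $\tau_{\chi_{\pi},c(\pi)}$-isotypic subspace $V_{\pi}^{\tau_{\chi_{\pi},c(\pi)}}$ of $V_{\pi}$. On $V_{\pi}^{\tau_{\chi_{\pi},c(\pi)}}$, $\langle\cdot,\cdot\rangle$ denotes a $K$-invariant inner product. *)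

theory Defs
  imports
    "HOL-Probability.Probability_Measure"
    "HOL-Algebra.Coset"
    "HOL-Library.Function_Algebras"
    "Jordan_Normal_Form.Matrix"
    "Jordan_Normal_Form.Determinant"
begin

unbundle no vec_syntax
hide_const (open) Finite_Cartesian_Product.vec Finite_Cartesian_Product.mat
  Determinants.det Finite_Cartesian_Product.transpose

section \<open>Nonarchimedean local fields\<close>

definition integers :: "('a::field \<Rightarrow> real) \<Rightarrow> 'a set" where
  "integers av = {x. av x \<le> 1}"

definition maximal_ideal :: "('a::field \<Rightarrow> real) \<Rightarrow> 'a set" where
  "maximal_ideal av = {x. av x < 1}"

definition integer_units :: "('a::field \<Rightarrow> real) \<Rightarrow> 'a set" where
  "integer_units av = {x. av x = 1}"

definition residue_field :: "('a::field \<Rightarrow> real) \<Rightarrow> 'a set set" where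
  "residue_field av =
     integers av // {(x, y) \<in> integers av \<times> integers av. x - y \<in> maximal_ideal av}"

definition residue_order :: "('a::field \<Rightarrow> real) \<Rightarrow> nat" where
  "residue_order av = card (residue_field av)"

text \<open>The last axiom says that the maximal ideal is principal, generated by a uniformiser, and that
  the absolute value is normalised; it also makes the absolute value nontrivial.\<close>

locale nonarchimedean_local_field =
  fixes av :: "'a::field \<Rightarrow> real"
  assumes av_nonneg: "0 \<le> av x"
    and av_eq_0_iff: "av x = 0 \<longleftrightarrow> x = 0"
    and av_mult: "av (x * y) = av x * av y"
    and av_ultrametric: "av (x + y) \<le> max (av x) (av y)"
    and complete: "Metric_space.mcomplete UNIV (\<lambda>x y. av (x - y))"
    and finite_residue_field: "finite (residue_field av)"
    and uniformiser: "\<exists>u. maximal_ideal av = {u * y |y. y \<in> integers av} \<and>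
                          av u = 1 / real (residue_order av)"

text \<open>The \<open>m\<close>-th power of the maximal ideal; the description uses the normalisation
  of the absolute value.\<close>

definition ideal_power :: "('a::field \<Rightarrow> real) \<Rightarrow> nat \<Rightarrow> 'a set" where
  "ideal_power av m = {x. av x \<le> (1 / real (residue_order av)) ^ m}"

definition field_topology :: "('a::field \<Rightarrow> real) \<Rightarrow> 'a topology" where
  "field_topology av = Metric_space.mtopology UNIV (\<lambda>x y. av (x - y))"


section \<open>General linear groups\<close>

text \<open>Rows and columns are numbered from \<open>0\<close>, so that the last index is \<open>n - 1\<close>.\<close>

definition GL :: "nat \<Rightarrow> 'a::field set \<Rightarrow> 'a mat set" where
  "GL n R = {g \<in> carrier_mat n n. elements_mat g \<subseteq> R \<and>
     (\<exists>h\<in>carrier_mat n n. elements_mat h \<subseteq> R \<and> g * h = 1\<^sub>m n \<and> h * g = 1\<^sub>m n)}"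

definition GL_group :: "nat \<Rightarrow> 'a::field mat monoid" where
  "GL_group n = \<lparr>carrier = GL n UNIV, mult = (*), one = 1\<^sub>m n\<rparr>"

definition GL_topology :: "('a::field \<Rightarrow> real) \<Rightarrow> nat \<Rightarrow> 'a mat topology" where
  "GL_topology av n = pullback_topology (GL n UNIV)
     (\<lambda>g. \<lambda>(i, j)\<in>{..<n} \<times> {..<n}. g $$ (i, j))
     (product_topology (\<lambda>_. field_topology av) ({..<n} \<times> {..<n}))"

definition GL_center :: "nat \<Rightarrow> 'a::field mat set" where
  "GL_center n = {a \<cdot>\<^sub>m 1\<^sub>m n |a. a \<noteq> 0}"

definition maximal_compact :: "('a::field \<Rightarrow> real) \<Rightarrow> nat \<Rightarrow> 'a mat set" where
  "maximal_compact av n = GL n (integers av)"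

definition mirabolic_compact :: "('a::field \<Rightarrow> real) \<Rightarrow> nat \<Rightarrow> 'a mat set" where
  "mirabolic_compact av n = {k \<in> maximal_compact av n.
     \<exists>a\<in>GL (n - 1) (integers av). \<exists>b\<in>carrier_mat (n - 1) 1. elements_mat b \<subseteq> integers av \<and>
       k = four_block_mat a b (0\<^sub>m 1 (n - 1)) (1\<^sub>m 1)}"

definition principal_congruence :: "('a::field \<Rightarrow> real) \<Rightarrow> nat \<Rightarrow> nat \<Rightarrow> 'a mat set" where
  "principal_congruence av n m =
     {k \<in> maximal_compact av n. elements_mat (k - 1\<^sub>m n) \<subseteq> ideal_power av m}"

definition K0 :: "('a::field \<Rightarrow> real) \<Rightarrow> nat \<Rightarrow> nat \<Rightarrow> 'a mat set" where
  "K0 av n m = {k \<in> maximal_compact av n. \<forall>j<n - 1. k $$ (n - 1, j) \<in> ideal_power av m}"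

definition K1 :: "('a::field \<Rightarrow> real) \<Rightarrow> nat \<Rightarrow> nat \<Rightarrow> 'a mat set" where
  "K1 av n m = {k \<in> K0 av n m. k $$ (n - 1, n - 1) - 1 \<in> ideal_power av m}"


section \<open>Haar measures\<close>

text \<open>Left Haar measures on the Borel sets of a locally compact group \<open>G\<close> with topology \<open>T\<close>. All groups
  used below are second countable, so that regularity follows from finiteness on compact sets.\<close>

definition haar_measure :: "('g, 'b) monoid_scheme \<Rightarrow> 'g topology \<Rightarrow> 'g measure \<Rightarrow> bool" where
  "haar_measure G T \<mu> \<longleftrightarrow>
     space \<mu> = carrier G \<and> topspace T = carrier G \<and>
     sets \<mu> = sigma_sets (topspace T) {U. openin T U} \<and>
     (\<forall>g\<in>carrier G. \<forall>A\<in>sets \<mu>. emeasure \<mu> (g <#\<^bsub>G\<^esub> A) = emeasure \<mu> A) \<and>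
     (\<forall>C\<in>sets \<mu>. compactin T C \<longrightarrow> emeasure \<mu> C < \<infinity>) \<and>
     (\<forall>U. openin T U \<and> U \<noteq> {} \<longrightarrow> 0 < emeasure \<mu> U)"

definition haar_probability :: "('a::field \<Rightarrow> real) \<Rightarrow> nat \<Rightarrow> 'a mat measure \<Rightarrow> bool" where
  "haar_probability av n dk \<longleftrightarrow>
     haar_measure ((GL_group n)\<lparr>carrier := maximal_compact av n\<rparr>)
       (subtopology (GL_topology av n) (maximal_compact av n)) dk \<and>
     prob_space dk"

text \<open>The quotient topology on the cosets of \<open>N\<close>, which are the points of \<open>G Mod N\<close>.\<close>

definition coset_topology :: "('g, 'b) monoid_scheme \<Rightarrow> 'g topology \<Rightarrow> 'g set \<Rightarrow> 'g set topology" where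
  "coset_topology G T N = topology (\<lambda>U. U \<subseteq> carrier (G Mod N) \<and> openin T (\<Union>U))"

lemma openin_coset_topology:
  assumes "\<And>C D. C \<in> carrier (G Mod N) \<Longrightarrow> D \<in> carrier (G Mod N) \<Longrightarrow> C \<noteq> D \<Longrightarrow> C \<inter> D = {}"
  shows "openin (coset_topology G T N) U \<longleftrightarrow> U \<subseteq> carrier (G Mod N) \<and> openin T (\<Union>U)"
proof -
  have "istopology (\<lambda>U. U \<subseteq> carrier (G Mod N) \<and> openin T (\<Union>U))"
    unfolding istopology_def
  proof (intro conjI allI impI)
    fix S S' assume S: "S \<subseteq> carrier (G Mod N) \<and> openin T (\<Union>S)"
      and S': "S' \<subseteq> carrier (G Mod N) \<and> openin T (\<Union>S')"
    have "\<Union>(S \<inter> S') = \<Union>S \<inter> \<Union>S'"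
    proof
      show "\<Union>S \<inter> \<Union>S' \<subseteq> \<Union>(S \<inter> S')"
      proof
        fix x assume "x \<in> \<Union>S \<inter> \<Union>S'"
        then obtain C D where "C \<in> S" "D \<in> S'" "x \<in> C" "x \<in> D" by blast
        moreover from this have "C = D" using assms[of C D] S S' by blast
        ultimately show "x \<in> \<Union>(S \<inter> S')" by blast
      qed
    qed blast
    then show "openin T (\<Union>(S \<inter> S'))" using S S' by auto
  next
    fix \<K> assume "\<forall>S\<in>\<K>. S \<subseteq> carrier (G Mod N) \<and> openin T (\<Union>S)"
    then have "openin T (\<Union>S\<in>\<K>. \<Union>S)" by blast
    moreover have "(\<Union>S\<in>\<K>. \<Union>S) = \<Union>(\<Union>\<K>)" by blast
    ultimately show "openin T (\<Union>(\<Union>\<K>))" by simp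
  qed auto
  then show ?thesis unfolding coset_topology_def by (simp add: topology_inverse')
qed


section \<open>Representations\<close>

text \<open>A representation is given by a subspace \<open>V\<close> of a complex vector space with scalar
  multiplication \<open>s\<close>, and an action that is only considered on \<open>V\<close>.\<close>

definition linear_on :: "(complex \<Rightarrow> 'v \<Rightarrow> 'v) \<Rightarrow> (complex \<Rightarrow> 'w \<Rightarrow> 'w) \<Rightarrow> 'v set \<Rightarrow>
    ('v::ab_group_add \<Rightarrow> 'w::ab_group_add) \<Rightarrow> bool" where
  "linear_on s s' V f \<longleftrightarrow>
     (\<forall>x\<in>V. \<forall>y\<in>V. f (x + y) = f x + f y) \<and> (\<forall>c. \<forall>x\<in>V. f (s c x) = s' c (f x))"

definition representation :: "('g, 'b) monoid_scheme \<Rightarrow> (complex \<Rightarrow> 'v \<Rightarrow> 'v) \<Rightarrow> 'v::ab_group_add set \<Rightarrow>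
    ('g \<Rightarrow> 'v \<Rightarrow> 'v) \<Rightarrow> bool" where
  "representation G s V \<pi> \<longleftrightarrow>
     vector_space s \<and> module.subspace s V \<and>
     (\<forall>g\<in>carrier G. \<pi> g ` V \<subseteq> V \<and> linear_on s s V (\<pi> g)) \<and>
     (\<forall>x\<in>V. \<pi> \<one>\<^bsub>G\<^esub> x = x) \<and>
     (\<forall>g\<in>carrier G. \<forall>h\<in>carrier G. \<forall>x\<in>V. \<pi> (g \<otimes>\<^bsub>G\<^esub> h) x = \<pi> g (\<pi> h x))"

definition smooth_representation :: "('a::field \<Rightarrow> real) \<Rightarrow> nat \<Rightarrow> (complex \<Rightarrow> 'v \<Rightarrow> 'v) \<Rightarrow>
    'v::ab_group_add set \<Rightarrow> ('a mat \<Rightarrow> 'v \<Rightarrow> 'v) \<Rightarrow> bool" where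
  "smooth_representation av n s V \<pi> \<longleftrightarrow>
     representation (GL_group n) s V \<pi> \<and>
     (\<forall>x\<in>V. openin (GL_topology av n) {g \<in> GL n UNIV. \<pi> g x = x})"

definition irreducible_representation :: "('g, 'b) monoid_scheme \<Rightarrow> (complex \<Rightarrow> 'v \<Rightarrow> 'v) \<Rightarrow>
    'v::ab_group_add set \<Rightarrow> ('g \<Rightarrow> 'v \<Rightarrow> 'v) \<Rightarrow> bool" where
  "irreducible_representation G s V \<pi> \<longleftrightarrow>
     representation G s V \<pi> \<and> V \<noteq> {0} \<and>
     (\<forall>W. module.subspace s W \<and> W \<subseteq> V \<and> (\<forall>g\<in>carrier G. \<pi> g ` W \<subseteq> W) \<longrightarrow> W = {0} \<or> W = V)"

text \<open>Smooth linear functionals, that is, the contragredient representation.\<close>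

definition smooth_dual :: "('a::field \<Rightarrow> real) \<Rightarrow> nat \<Rightarrow> (complex \<Rightarrow> 'v \<Rightarrow> 'v) \<Rightarrow>
    'v::ab_group_add set \<Rightarrow> ('a mat \<Rightarrow> 'v \<Rightarrow> 'v) \<Rightarrow> ('v \<Rightarrow> complex) set" where
  "smooth_dual av n s V \<pi> = {l. linear_on s (*) V l \<and>
     openin (GL_topology av n) {g \<in> GL n UNIV. \<forall>x\<in>V. l (\<pi> g x) = l x}}"

text \<open>The central character being unitary, the absolute value of a matrix coefficient is a function
  on the cosets of the centre, and it may be evaluated at any representative.\<close>

definition square_integrable :: "('a::field \<Rightarrow> real) \<Rightarrow> nat \<Rightarrow> (complex \<Rightarrow> 'v \<Rightarrow> 'v) \<Rightarrow>
    'v::ab_group_add set \<Rightarrow> ('a mat \<Rightarrow> 'v \<Rightarrow> 'v) \<Rightarrow> bool" where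
  "square_integrable av n s V \<sigma> \<longleftrightarrow>
     smooth_representation av n s V \<sigma> \<and>
     irreducible_representation (GL_group n) s V \<sigma> \<and>
     (\<exists>\<omega>. \<forall>a. a \<noteq> 0 \<longrightarrow> cmod (\<omega> a) = 1 \<and> (\<forall>x\<in>V. \<sigma> (a \<cdot>\<^sub>m 1\<^sub>m n) x = s (\<omega> a) x)) \<and>
     (\<exists>\<mu>. haar_measure (GL_group n Mod GL_center n)
            (coset_topology (GL_group n) (GL_topology av n) (GL_center n)) \<mu> \<and>
        (\<forall>x\<in>V. \<forall>l\<in>smooth_dual av n s V \<sigma>.
           (\<integral>\<^sup>+ C. ennreal ((cmod (l (\<sigma> (SOME g. g \<in> C) x)))\<^sup>2) \<partial>\<mu>) < \<infinity>))"


section \<open>Tensor products\<close>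

text \<open>The tensor product of \<open>V 0, \<dots>, V (r - 1)\<close> is realised inside the dual of the space of multilinear
  forms, as the span of the evaluations at elements of the product of the \<open>V j\<close>. Over a field this is
  the algebraic tensor product, since multilinear forms separate its elements.\<close>

definition multilinear_forms :: "(complex \<Rightarrow> 'v \<Rightarrow> 'v) \<Rightarrow> nat \<Rightarrow> (nat \<Rightarrow> 'v::ab_group_add set) \<Rightarrow>
    ((nat \<Rightarrow> 'v) \<Rightarrow> complex) set" where
  "multilinear_forms s r V = {\<phi>. (\<forall>x. x \<notin> PiE {..<r} V \<longrightarrow> \<phi> x = 0) \<and>
     (\<forall>x\<in>PiE {..<r} V. \<forall>j<r. linear_on s (*) (V j) (\<lambda>y. \<phi> (x(j := y))))}"

definition pure_tensor :: "(complex \<Rightarrow> 'v \<Rightarrow> 'v) \<Rightarrow> nat \<Rightarrow> (nat \<Rightarrow> 'v::ab_group_add set) \<Rightarrow>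
    (nat \<Rightarrow> 'v) \<Rightarrow> ((nat \<Rightarrow> 'v) \<Rightarrow> complex) \<Rightarrow> complex" where
  "pure_tensor s r V x = (\<lambda>\<phi>. if \<phi> \<in> multilinear_forms s r V then \<phi> x else 0)"

definition tensor_product :: "(complex \<Rightarrow> 'v \<Rightarrow> 'v) \<Rightarrow> nat \<Rightarrow> (nat \<Rightarrow> 'v::ab_group_add set) \<Rightarrow>
    (((nat \<Rightarrow> 'v) \<Rightarrow> complex) \<Rightarrow> complex) set" where
  "tensor_product s r V = module.span (\<lambda>c w \<phi>. c * w \<phi>) (pure_tensor s r V ` PiE {..<r} V)"

text \<open>The operator sending \<open>x 0 \<otimes> \<dots> \<otimes> x (r - 1)\<close> to \<open>T 0 (x 0) \<otimes> \<dots> \<otimes> T (r - 1) (x (r - 1))\<close>.\<close>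

definition tensor_map :: "(complex \<Rightarrow> 'v \<Rightarrow> 'v) \<Rightarrow> nat \<Rightarrow> (nat \<Rightarrow> 'v::ab_group_add set) \<Rightarrow>
    (nat \<Rightarrow> 'v \<Rightarrow> 'v) \<Rightarrow> (((nat \<Rightarrow> 'v) \<Rightarrow> complex) \<Rightarrow> complex) \<Rightarrow> ((nat \<Rightarrow> 'v) \<Rightarrow> complex) \<Rightarrow> complex" where
  "tensor_map s r V T w = (\<lambda>\<phi>. if \<phi> \<in> multilinear_forms s r V
     then w (\<lambda>x. if x \<in> PiE {..<r} V then \<phi> (\<lambda>j\<in>{..<r}. T j (x j)) else 0) else 0)"


section \<open>Induced representations of Langlands type\<close>

definition block_start :: "(nat \<Rightarrow> nat) \<Rightarrow> nat \<Rightarrow> nat" where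
  "block_start d j = (\<Sum>i<j. d i)"

definition diagonal_block :: "(nat \<Rightarrow> nat) \<Rightarrow> nat \<Rightarrow> 'a mat \<Rightarrow> 'a mat" where
  "diagonal_block d j p =
     mat (d j) (d j) (\<lambda>(a, b). p $$ (block_start d j + a, block_start d j + b))"

definition standard_parabolic :: "nat \<Rightarrow> nat \<Rightarrow> (nat \<Rightarrow> nat) \<Rightarrow> 'a::field mat set" where
  "standard_parabolic n r d = {p \<in> GL n UNIV.
     \<forall>j<r. \<forall>a b. b < block_start d j \<and> block_start d j \<le> a \<and> a < n \<longrightarrow> p $$ (a, b) = 0}"

text \<open>The modulus character of \<open>P\<close>, the absolute value of the determinant of the adjoint action on the
  Lie algebra of the unipotent radical, is the product over \<open>j\<close> of the absolute values of the
  determinants of the diagonal blocks raised to the power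
  \<open>(\<Sum>i\<in>{j<..<r}. d i) - (\<Sum>i<j. d i)\<close>.\<close>

definition sqrt_modulus :: "('a::field \<Rightarrow> real) \<Rightarrow> nat \<Rightarrow> (nat \<Rightarrow> nat) \<Rightarrow> 'a mat \<Rightarrow> real" where
  "sqrt_modulus av r d p = (\<Prod>j<r. av (det (diagonal_block d j p)) powr
     ((real (\<Sum>i\<in>{j<..<r}. d i) - real (\<Sum>i<j. d i)) / 2))"

definition det_twist :: "('a::field \<Rightarrow> real) \<Rightarrow> (complex \<Rightarrow> 'v \<Rightarrow> 'v) \<Rightarrow> complex \<Rightarrow>
    ('a mat \<Rightarrow> 'v \<Rightarrow> 'v) \<Rightarrow> 'a mat \<Rightarrow> 'v \<Rightarrow> 'v" where
  "det_twist av s t \<sigma> g x = s (complex_of_real (av (det g)) powr t) (\<sigma> g x)"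

text \<open>The space of the normalised induction of \<open>\<pi> 0 \<boxtimes> \<dots> \<boxtimes> \<pi> (r - 1)\<close>. Its elements are functions on
  \<open>GL\<^sub>n(F)\<close>, extended by zero to all matrices.\<close>

definition induced_space :: "('a::field \<Rightarrow> real) \<Rightarrow> nat \<Rightarrow> (complex \<Rightarrow> 'v \<Rightarrow> 'v) \<Rightarrow> nat \<Rightarrow> (nat \<Rightarrow> nat) \<Rightarrow>
    (nat \<Rightarrow> 'v::ab_group_add set) \<Rightarrow> (nat \<Rightarrow> 'a mat \<Rightarrow> 'v \<Rightarrow> 'v) \<Rightarrow>
    ('a mat \<Rightarrow> ((nat \<Rightarrow> 'v) \<Rightarrow> complex) \<Rightarrow> complex) set" where
  "induced_space av n s r d V \<pi> = {f.
     (\<forall>g. g \<notin> GL n UNIV \<longrightarrow> f g = 0) \<and>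
     (\<forall>g\<in>GL n UNIV. f g \<in> tensor_product s r V) \<and>
     (\<forall>p\<in>standard_parabolic n r d. \<forall>g\<in>GL n UNIV. f (p * g) =
        (\<lambda>\<phi>. complex_of_real (sqrt_modulus av r d p) *
             tensor_map s r V (\<lambda>j. \<pi> j (diagonal_block d j p)) (f g) \<phi>)) \<and>
     (\<exists>U. openin (GL_topology av n) U \<and> subgroup U (GL_group n) \<and>
        (\<forall>g\<in>GL n UNIV. \<forall>u\<in>U. f (g * u) = f g))}"

definition induced_scale :: "complex \<Rightarrow> ('a mat \<Rightarrow> 'c \<Rightarrow> complex) \<Rightarrow> 'a mat \<Rightarrow> 'c \<Rightarrow> complex" where
  "induced_scale c f = (\<lambda>g \<phi>. c * f g \<phi>)"

definition right_translation :: "nat \<Rightarrow> 'a::field mat \<Rightarrow> ('a mat \<Rightarrow> 'w::zero) \<Rightarrow> 'a mat \<Rightarrow> 'w" where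
  "right_translation n g f = (\<lambda>x. if x \<in> GL n UNIV then f (x * g) else 0)"

text \<open>The spaces of the finitely many inducing representations are all taken inside one complex vector
  space of arbitrary type \<open>'v\<close>, for instance their direct sum.\<close>

definition induced_of_Langlands_type :: "('a::field \<Rightarrow> real) \<Rightarrow> nat \<Rightarrow>
    ('a mat \<Rightarrow> ((nat \<Rightarrow> 'v::ab_group_add) \<Rightarrow> complex) \<Rightarrow> complex) set \<Rightarrow>
    ('a mat \<Rightarrow> ('a mat \<Rightarrow> ((nat \<Rightarrow> 'v) \<Rightarrow> complex) \<Rightarrow> complex) \<Rightarrow>
      'a mat \<Rightarrow> ((nat \<Rightarrow> 'v) \<Rightarrow> complex) \<Rightarrow> complex) \<Rightarrow> bool" where
  "induced_of_Langlands_type av n V\<^sub>\<pi> \<pi> \<longleftrightarrow>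
     (\<exists>(s :: complex \<Rightarrow> 'v \<Rightarrow> 'v) r d V \<sigma> t.
        (\<forall>j<r. 0 < d j) \<and> (\<Sum>j<r. d j) = n \<and>
        (\<forall>j<r. square_integrable av (d j) s (V j) (\<sigma> j)) \<and>
        (\<forall>i j. i \<le> j \<and> j < r \<longrightarrow> Re (t i) \<ge> Re (t j)) \<and>
        V\<^sub>\<pi> = induced_space av n s r d V (\<lambda>j. det_twist av s (t j) (\<sigma> j)) \<and>
        \<pi> = right_translation n)"


section \<open>Conductors and newforms\<close>

definition central_character :: "(complex \<Rightarrow> 'w \<Rightarrow> 'w) \<Rightarrow> nat \<Rightarrow> 'w set \<Rightarrow> ('a::field mat \<Rightarrow> 'w \<Rightarrow> 'w) \<Rightarrow>
    'a \<Rightarrow> complex" where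
  "central_character s n V \<pi> a = (THE c. \<forall>x\<in>V. \<pi> (a \<cdot>\<^sub>m 1\<^sub>m n) x = s c x)"

definition invariants :: "'w set \<Rightarrow> ('g \<Rightarrow> 'w \<Rightarrow> 'w) \<Rightarrow> 'g set \<Rightarrow> 'w set" where
  "invariants V \<pi> H = {x \<in> V. \<forall>h\<in>H. \<pi> h x = x}"

definition conductor_exponent :: "('a::field \<Rightarrow> real) \<Rightarrow> nat \<Rightarrow> 'w::zero set \<Rightarrow> ('a mat \<Rightarrow> 'w \<Rightarrow> 'w) \<Rightarrow> nat"
  where "conductor_exponent av n V \<pi> = (LEAST m. invariants V \<pi> (K1 av n m) \<noteq> {0})"

definition newform :: "('a::field \<Rightarrow> real) \<Rightarrow> nat \<Rightarrow> 'w::zero set \<Rightarrow> ('a mat \<Rightarrow> 'w \<Rightarrow> 'w) \<Rightarrow> 'w \<Rightarrow> bool" where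
  "newform av n V \<pi> x \<longleftrightarrow>
     x \<in> invariants V \<pi> (K1 av n (conductor_exponent av n V \<pi>)) \<and> x \<noteq> 0"

text \<open>Characters of the unit group are given by functions on the field whose values away from the
  units are irrelevant.\<close>

definition char_conductor :: "('a::field \<Rightarrow> real) \<Rightarrow> ('a \<Rightarrow> complex) \<Rightarrow> nat" where
  "char_conductor av \<chi> = (LEAST m. \<forall>a\<in>integer_units av. a - 1 \<in> ideal_power av m \<longrightarrow> \<chi> a = 1)"

text \<open>The convention that the trivial character takes the value \<open>1\<close> also at nonunits.\<close>

definition char_value :: "('a::field \<Rightarrow> real) \<Rightarrow> ('a \<Rightarrow> complex) \<Rightarrow> 'a \<Rightarrow> complex" where
  "char_value av \<chi> y = (if \<forall>a\<in>integer_units av. \<chi> a = 1 then 1 else \<chi> y)"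


section \<open>Functions on the unit sphere\<close>

definition sphere :: "('a::field \<Rightarrow> real) \<Rightarrow> nat \<Rightarrow> 'a vec set" where
  "sphere av n = {x \<in> carrier_vec n. Max ((\<lambda>i. av (x $ i)) ` {..<n}) = 1}"

definition sphere_topology :: "('a::field \<Rightarrow> real) \<Rightarrow> nat \<Rightarrow> 'a vec topology" where
  "sphere_topology av n = pullback_topology (sphere av n) (\<lambda>x. \<lambda>i\<in>{..<n}. x $ i)
     (product_topology (\<lambda>_. field_topology av) {..<n})"

text \<open>The row vector \<open>x k\<close>.\<close>

definition row_mult :: "'a::field vec \<Rightarrow> 'a mat \<Rightarrow> 'a vec" where
  "row_mult x k = transpose_mat k *\<^sub>v x"

definition last_unit_vec :: "nat \<Rightarrow> 'a::field vec" where
  "last_unit_vec n = unit_vec n (n - 1)"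

text \<open>Functions on the sphere are extended by zero to all vectors.\<close>

definition smooth_functions :: "('a::field \<Rightarrow> real) \<Rightarrow> nat \<Rightarrow> ('a vec \<Rightarrow> complex) set" where
  "smooth_functions av n = {f. (\<forall>x. x \<notin> sphere av n \<longrightarrow> f x = 0) \<and>
     (\<forall>x\<in>sphere av n. \<exists>U. openin (sphere_topology av n) U \<and> x \<in> U \<and> (\<forall>y\<in>U. f y = f x))}"

definition sphere_inner :: "nat \<Rightarrow> 'a::field mat measure \<Rightarrow>
    ('a vec \<Rightarrow> complex) \<Rightarrow> ('a vec \<Rightarrow> complex) \<Rightarrow> complex" where
  "sphere_inner n dk f1 f2 =
     (\<integral>k. f1 (row_mult (last_unit_vec n) k) * cnj (f2 (row_mult (last_unit_vec n) k)) \<partial>dk)"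

definition invariant_functions :: "('a::field \<Rightarrow> real) \<Rightarrow> nat \<Rightarrow> ('a \<Rightarrow> complex) \<Rightarrow> nat \<Rightarrow>
    ('a vec \<Rightarrow> complex) set" where
  "invariant_functions av n \<chi> m = {f \<in> smooth_functions av n.
     (\<forall>x\<in>sphere av n. \<forall>k\<in>principal_congruence av n m. f (row_mult x k) = f x) \<and>
     (\<forall>x\<in>sphere av n. \<forall>a\<in>integer_units av. f (a \<cdot>\<^sub>v x) = \<chi> a * f x)}"

text \<open>The space \<open>\<H>\<^bsub>\<chi>,m\<^esub>\<close>, to be used only for \<open>m \<ge> c(\<chi>)\<close>.\<close>

definition harmonics :: "('a::field \<Rightarrow> real) \<Rightarrow> nat \<Rightarrow> 'a mat measure \<Rightarrow> ('a \<Rightarrow> complex) \<Rightarrow> nat \<Rightarrow>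
    ('a vec \<Rightarrow> complex) set" where
  "harmonics av n dk \<chi> m =
     (if m = char_conductor av \<chi> then invariant_functions av n \<chi> m
      else {f \<in> invariant_functions av n \<chi> m.
              \<forall>h\<in>invariant_functions av n \<chi> (m - 1). sphere_inner n dk f h = 0})"

definition sphere_translation :: "('a::field \<Rightarrow> real) \<Rightarrow> nat \<Rightarrow> 'a mat \<Rightarrow> ('a vec \<Rightarrow> complex) \<Rightarrow>
    'a vec \<Rightarrow> complex" where
  "sphere_translation av n k f = (\<lambda>x. if x \<in> sphere av n then f (row_mult x k) else 0)"

definition zonal_function :: "('a::field \<Rightarrow> real) \<Rightarrow> nat \<Rightarrow> 'a mat measure \<Rightarrow> ('a \<Rightarrow> complex) \<Rightarrow> nat \<Rightarrow>
    'a vec \<Rightarrow> complex" where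
  "zonal_function av n dk \<chi> m = (THE f. f \<in> harmonics av n dk \<chi> m \<and>
     (\<forall>x\<in>sphere av n. \<forall>k\<in>mirabolic_compact av n. f (row_mult x k) = f x) \<and>
     f (last_unit_vec n) = 1)"


section \<open>Isotypic subspaces\<close>

text \<open>The sum of all \<open>K\<close>-stable subspaces of \<open>V\<close> on which \<open>K\<close> acts by a representation isomorphic to
  the one by right translation on \<open>\<H>\<^bsub>\<chi>,m\<^esub>\<close>.\<close>

definition isotypic_subspace :: "('a::field \<Rightarrow> real) \<Rightarrow> nat \<Rightarrow> 'a mat measure \<Rightarrow>
    (complex \<Rightarrow> 'w \<Rightarrow> 'w) \<Rightarrow> 'w::ab_group_add set \<Rightarrow> ('a mat \<Rightarrow> 'w \<Rightarrow> 'w) \<Rightarrow>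
    ('a \<Rightarrow> complex) \<Rightarrow> nat \<Rightarrow> 'w set" where
  "isotypic_subspace av n dk s V \<pi> \<chi> m = module.span s (\<Union>{W.
     module.subspace s W \<and> W \<subseteq> V \<and> (\<forall>k\<in>maximal_compact av n. \<pi> k ` W \<subseteq> W) \<and>
     (\<exists>\<Phi>. linear_on (\<lambda>c f x. c * f x) s (harmonics av n dk \<chi> m) \<Phi> \<and>
          bij_betw \<Phi> (harmonics av n dk \<chi> m) W \<and>
          (\<forall>k\<in>maximal_compact av n. \<forall>f\<in>harmonics av n dk \<chi> m.
             \<Phi> (sphere_translation av n k f) = \<pi> k (\<Phi> f)))})"

definition invariant_inner_product :: "'g set \<Rightarrow> (complex \<Rightarrow> 'w \<Rightarrow> 'w) \<Rightarrow> 'w::ab_group_add set \<Rightarrow>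
    ('g \<Rightarrow> 'w \<Rightarrow> 'w) \<Rightarrow> ('w \<Rightarrow> 'w \<Rightarrow> complex) \<Rightarrow> bool" where
  "invariant_inner_product K s V \<pi> ip \<longleftrightarrow>
     (\<forall>y\<in>V. linear_on s (*) V (\<lambda>x. ip x y)) \<and>
     (\<forall>x\<in>V. \<forall>y\<in>V. ip y x = cnj (ip x y)) \<and>
     (\<forall>x\<in>V. x \<noteq> 0 \<longrightarrow> 0 < Re (ip x x)) \<and>
     (\<forall>k\<in>K. \<forall>x\<in>V. \<forall>y\<in>V. ip (\<pi> k x) (\<pi> k y) = ip x y)"

end

theory Submission
  imports Defs
begin

text \<open>Let \<open>N = K(\<pp>\<^sup>c)\<close>. Integrals over \<open>K\<close> of right \<open>N\<close>-invariant functions are finite sums over \<open>K / N\<close>, and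
  functions on the sphere with central character \<open>\<chi>\<close> and level \<open>m\<close> are the functions on \<open>K\<close> on which
  \<open>K\<^sub>0(\<pp>\<^sup>m)\<close> acts from the left by \<open>\<chi>(k\<^sub>n\<^sub>n)\<close>. A mirabolic invariant function of this kind is determined by its
  values on the shells \<open>K\<^sub>0(\<pp>\<^sup>j) - K\<^sub>0(\<pp>\<^sup>j\<^sup>+\<^sup>1)\<close>. It vanishes there for \<open>j < c(\<chi>)\<close>, and orthogonality to the
  functions supported on \<open>K\<^sub>0(\<pp>\<^sup>m)\<close>, for \<open>c(\<chi>) \<le> m < c\<close>, kills all shells but the last one, on which the value is
  given by the index of \<open>K\<^sub>0(\<pp>\<^sup>c)\<close> in \<open>K\<^sub>0(\<pp>\<^sup>c\<^sup>-\<^sup>1)\<close>. This is the formula for the zonal function.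

  The map \<open>f \<mapsto> \<Sum>\<^sub>k f(e\<^sub>n k) \<pi>(k)\<^sup>-\<^sup>1 v\<close>, for \<open>v\<close> the newform, intertwines functions on the sphere with \<open>\<pi>\<close>. By the minimality
  of the conductor exponent it kills the functions of level \<open>c - 1\<close>, so it sends the zonal function to a
  nonzero multiple of \<open>v\<close>. Since every nonzero \<open>K\<close>-stable space of harmonics contains the zonal function, the
  map is injective on the harmonics, and \<open>v\<close> lies in the isotypic subspace. The matrix coefficient
  \<open>k \<mapsto> \<langle>\<pi>(k) v, v\<rangle>\<close> is then itself a mirabolic invariant harmonic, hence a multiple of the zonal function.\<close>

section \<open>Sums over cosets and matrix groups\<close>

text \<open>The inner product exists only on the isotypic subspace, so the translates of the newform
  must be placed there before \<open>ip\<close> can be used at all; this is what the injective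
  intertwining map is built for. Minimality acts through a single vector: the image of
  \<open>psi\<close> cut off to \<open>K0 av n (c - 1)\<close> is fixed by
  \<open>K1 av n (c - 1)\<close>, and so is zero if \<open>cd < c\<close>. A sum over left
  translations extends this to all functions of level \<open>c - 1\<close>, and pairing the result
  with the newform is exactly the orthogonality that the matrix coefficient needs. In this case the
  zonal function combines two cut-offs, to \<open>K0 av n c\<close> and
  \<open>K0 av n (c - 1)\<close>, with coefficients \<open>1 - \<alpha>\<close> and
  \<open>\<alpha>\<close>; the second is sent to zero, and \<open>\<alpha> \<le> 0\<close> keeps the
  first from vanishing. If \<open>i\<close> is the index of the smaller group in the larger,
  orthogonality to \<open>psi\<close> on the larger one says
  \<open>1 + \<alpha> (i - 1) = 0\<close>. For \<open>c \<ge> 2\<close> one has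
  \<open>i = q^(n-1)\<close>. For \<open>c = 1\<close> the larger group is all of \<open>K\<close>,
  where the unit in the last row may stand anywhere; then \<open>i = (q^n - 1) / (q - 1)\<close>,
  whence the separate formula for \<open>\<alpha>\<close>.\<close>

definition coset_sum :: "('g, 'b) monoid_scheme \<Rightarrow> 'g set \<Rightarrow> ('g \<Rightarrow> 'c::comm_monoid_add) \<Rightarrow> 'c" where
  "coset_sum G H f = (\<Sum>C\<in>rcosets\<^bsub>G\<^esub> H. f (SOME k. k \<in> C))"

context normal
begin

text \<open>Normality turns the right coset into a left coset, so invariance under right
  multiplication by \<open>H\<close> is enough. It makes the representative chosen by
  \<open>SOME\<close> in \<open>coset_sum\<close> immaterial.\<close>

lemma invariant_on_coset:
  assumes f: "\<And>k h. k \<in> carrier G \<Longrightarrow> h \<in> H \<Longrightarrow> f (k \<otimes> h) = f k"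
    and "C \<in> rcosets H" "k \<in> C" "l \<in> C"
  shows "f k = f l"
proof -
  obtain x where x: "x \<in> carrier G" "C = H #> x" using assms(2) by (auto simp: RCOSETS_def)
  then have C: "C = x <# H" using coset_eq by simp
  have "f y = f x" if "y \<in> C" for y
    using that f x(1) unfolding C by (auto simp: l_coset_def)
  then show ?thesis using assms by simp
qed

lemma some_in_rcoset:
  assumes "C \<in> rcosets H"
  shows "(SOME k. k \<in> C) \<in> C" "(SOME k. k \<in> C) \<in> carrier G"
proof -
  obtain x where x: "x \<in> carrier G" "C = H #> x" using assms by (auto simp: RCOSETS_def)
  then have "x \<in> C" using rcos_self subgroup_axioms by blast
  then show s: "(SOME k. k \<in> C) \<in> C" by (rule someI)
  then show "(SOME k. k \<in> C) \<in> carrier G" using x r_coset_subset_G[OF subset] by blast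
qed

lemma coset_sum_cong:
  assumes "\<And>k. k \<in> carrier G \<Longrightarrow> f k = g k"
  shows "coset_sum G H f = coset_sum G H g"
  unfolding coset_sum_def using some_in_rcoset(2) assms by (intro sum.cong) auto

text \<open>Right multiplication by \<open>x\<close> permutes the cosets, and the chosen
  representative of \<open>C #> x\<close> lies in the same coset as the translated representative of
  \<open>C\<close>.\<close>

lemma coset_sum_mult_right:
  assumes f: "\<And>k h. k \<in> carrier G \<Longrightarrow> h \<in> H \<Longrightarrow> f (k \<otimes> h) = f k" and x: "x \<in> carrier G"
  shows "coset_sum G H (\<lambda>k. f (k \<otimes> x)) = coset_sum G H f"
proof -
  have mem: "C #> y \<in> rcosets H" if C: "C \<in> rcosets H" and y: "y \<in> carrier G" for C y
  proof -
    obtain z where z: "z \<in> carrier G" "C = H #> z" using C by (auto simp: RCOSETS_def)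
    then have "C #> y = H #> (z \<otimes> y)" using coset_mult_assoc[OF subset] y by simp
    then show ?thesis using z y rcosetsI[OF subset] by simp
  qed
  have sub: "C \<subseteq> carrier G" if "C \<in> rcosets H" for C using that rcosets_carrier by blast
  have "bij_betw (\<lambda>C. C #> x) (rcosets H) (rcosets H)"
    by (rule bij_betw_byWitness[where f' = "\<lambda>C. C #> inv x"])
      (use mem x sub in \<open>auto simp: coset_mult_assoc\<close>)
  then have "coset_sum G H f = (\<Sum>C\<in>rcosets H. f (SOME k. k \<in> C #> x))"
    unfolding coset_sum_def by (rule sum.reindex_bij_betw[symmetric])
  also have "\<dots> = coset_sum G H (\<lambda>k. f (k \<otimes> x))"
    unfolding coset_sum_def
  proof (rule sum.cong[OF refl])
    fix C assume C: "C \<in> rcosets H"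
    have "(SOME k. k \<in> C) \<otimes> x \<in> C #> x" using some_in_rcoset(1)[OF C] by (auto simp: r_coset_def)
    then show "f (SOME k. k \<in> C #> x) = f ((SOME k. k \<in> C) \<otimes> x)"
      using invariant_on_coset[OF f mem[OF C x]] some_in_rcoset(1)[OF mem[OF C x]] by blast
  qed
  finally show ?thesis by simp
qed

lemma coset_sum_mult_left:
  assumes f: "\<And>k h. k \<in> carrier G \<Longrightarrow> h \<in> H \<Longrightarrow> f (k \<otimes> h) = f k" and x: "x \<in> carrier G"
  shows "coset_sum G H (\<lambda>k. f (x \<otimes> k)) = coset_sum G H f"
proof -
  have mem: "y <# C \<in> rcosets H" if C: "C \<in> rcosets H" and y: "y \<in> carrier G" for C y
  proof -
    obtain z where z: "z \<in> carrier G" "C = H #> z" using C by (auto simp: RCOSETS_def)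
    then have "y <# C = (y \<otimes> z) <# H" using coset_eq lcos_m_assoc[OF subset] y by simp
    then have "y <# C = H #> (y \<otimes> z)" using coset_eq y z by simp
    then show ?thesis using z y rcosetsI[OF subset] by simp
  qed
  have sub: "C \<subseteq> carrier G" if "C \<in> rcosets H" for C using that rcosets_carrier by blast
  have "bij_betw (\<lambda>C. x <# C) (rcosets H) (rcosets H)"
    by (rule bij_betw_byWitness[where f' = "\<lambda>C. inv x <# C"])
      (use mem x sub in \<open>auto simp: lcos_m_assoc lcos_mult_one\<close>)
  then have "coset_sum G H f = (\<Sum>C\<in>rcosets H. f (SOME k. k \<in> x <# C))"
    unfolding coset_sum_def by (rule sum.reindex_bij_betw[symmetric])
  also have "\<dots> = coset_sum G H (\<lambda>k. f (x \<otimes> k))"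
    unfolding coset_sum_def
  proof (rule sum.cong[OF refl])
    fix C assume C: "C \<in> rcosets H"
    have "x \<otimes> (SOME k. k \<in> C) \<in> x <# C" using some_in_rcoset(1)[OF C] by (auto simp: l_coset_def)
    then show "f (SOME k. k \<in> x <# C) = f (x \<otimes> (SOME k. k \<in> C))"
      using invariant_on_coset[OF f mem[OF C x]] some_in_rcoset(1)[OF mem[OF C x]] by blast
  qed
  finally show ?thesis by simp
qed

end

text \<open>Inverses with entries in \<open>R\<close> are part of the definition of
  \<open>GL\<close>, so closure of \<open>R\<close> under sums and products suffices. Both the whole
  field and the ring of integers are instances.\<close>

lemma group_GL:
  assumes R: "0 \<in> R" "1 \<in> R" "\<And>x y. x \<in> R \<Longrightarrow> y \<in> R \<Longrightarrow> x + y \<in> R"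
    "\<And>x y. x \<in> R \<Longrightarrow> y \<in> R \<Longrightarrow> x * y \<in> R"
  shows "group ((GL_group n)\<lparr>carrier := GL n R\<rparr>)"
proof -
  have sum: "sum f A \<in> R" if "\<And>i. i \<in> A \<Longrightarrow> f i \<in> R" for f :: "nat \<Rightarrow> 'a" and A
    using that by (induction A rule: infinite_finite_induct) (simp_all add: R)
  have el: "elements_mat (A * B) \<subseteq> R" if A: "A \<in> carrier_mat n n" "elements_mat A \<subseteq> R"
    and B: "B \<in> carrier_mat n n" "elements_mat B \<subseteq> R" for A B
  proof
    fix a assume "a \<in> elements_mat (A * B)"
    from elements_matD[OF this] obtain i j where ij: "i < n" "j < n" "a = (A * B) $$ (i, j)"
      using A(1) B(1) by (metis carrier_matD index_mult_mat(2,3))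
    have "A $$ (i, l) \<in> R" "B $$ (l, j) \<in> R" if "l < n" for l
      using elements_matI[OF A(1) ij(1) that refl] elements_matI[OF B(1) that ij(2) refl] A B by auto
    moreover have "a = (\<Sum>l<n. A $$ (i, l) * B $$ (l, j))"
      using ij A B by (simp add: scalar_prod_def lessThan_atLeast0)
    ultimately show "a \<in> R" by (auto intro: sum R(4))
  qed
  show ?thesis
  proof (rule groupI)
    fix x assume "x \<in> carrier ((GL_group n)\<lparr>carrier := GL n R\<rparr>)"
    then show "\<exists>y\<in>carrier ((GL_group n)\<lparr>carrier := GL n R\<rparr>).
        y \<otimes>\<^bsub>(GL_group n)\<lparr>carrier := GL n R\<rparr>\<^esub> x = \<one>\<^bsub>(GL_group n)\<lparr>carrier := GL n R\<rparr>\<^esub>"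
      by (auto simp: GL_def GL_group_def)
  next
    fix x y assume "x \<in> carrier ((GL_group n)\<lparr>carrier := GL n R\<rparr>)" "y \<in> carrier ((GL_group n)\<lparr>carrier := GL n R\<rparr>)"
    then obtain x' y' where *: "x \<in> carrier_mat n n" "y \<in> carrier_mat n n" "x' \<in> carrier_mat n n" "y' \<in> carrier_mat n n"
      "elements_mat x \<subseteq> R" "elements_mat y \<subseteq> R" "elements_mat x' \<subseteq> R" "elements_mat y' \<subseteq> R"
      "x * x' = 1\<^sub>m n" "x' * x = 1\<^sub>m n" "y * y' = 1\<^sub>m n" "y' * y = 1\<^sub>m n"
      by (auto simp: GL_def)
    have "(x * y) * (y' * x') = x * (y * y') * x'" "(y' * x') * (x * y) = y' * (x' * x) * y"
      using *(1-4) by (simp_all add: assoc_mult_mat[of _ n n _ n _ n])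
    then have "(x * y) * (y' * x') = 1\<^sub>m n" "(y' * x') * (x * y) = 1\<^sub>m n" using * by simp_all
    then show "x \<otimes>\<^bsub>(GL_group n)\<lparr>carrier := GL n R\<rparr>\<^esub> y \<in> carrier ((GL_group n)\<lparr>carrier := GL n R\<rparr>)"
      unfolding GL_def GL_group_def partial_object.simps monoid.simps
      using mult_carrier_mat[OF *(1,2)] mult_carrier_mat[OF *(4,3)] el[OF *(1,5,2,6)] el[OF *(4,8,3,7)]
      by blast
  next
    show "\<one>\<^bsub>(GL_group n)\<lparr>carrier := GL n R\<rparr>\<^esub> \<in> carrier ((GL_group n)\<lparr>carrier := GL n R\<rparr>)"
      using R(1,2) by (auto simp: GL_def GL_group_def dest!: elements_matD intro!: bexI[of _ "1\<^sub>m n"])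
  qed (auto simp: GL_def GL_group_def assoc_mult_mat[of _ n n _ n _ n])
qed

lemma group_GL_group: "group (GL_group n)"
  using group_GL[of UNIV n] by (simp add: GL_group_def)

lemma mult_mat_entry:
  assumes "A \<in> carrier_mat n m" "B \<in> carrier_mat m l" "i < n" "j < l"
  shows "(A * B) $$ (i, j) = (\<Sum>h<m. A $$ (i, h) * B $$ (h, j))"
  using assms by (simp add: scalar_prod_def lessThan_atLeast0)

lemma row_mult_entry:
  assumes "k \<in> carrier_mat n n" "x \<in> carrier_vec n" "j < n"
  shows "row_mult x k $ j = (\<Sum>i<n. x $ i * k $$ (i, j))"
  using assms by (auto simp: row_mult_def scalar_prod_def lessThan_atLeast0 mult.commute intro!: sum.cong)

lemma row_mult_carrier [simp]: "k \<in> carrier_mat n n \<Longrightarrow> row_mult x k \<in> carrier_vec n"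
  by (simp add: row_mult_def carrier_vecI)

lemma row_mult_mult:
  assumes "k \<in> carrier_mat n n" "h \<in> carrier_mat n n" "x \<in> carrier_vec n"
  shows "row_mult x (k * h) = row_mult (row_mult x k) h"
  using assms transpose_mult[OF assms(1,2)] assoc_mult_mat_vec[of "transpose_mat h" n n "transpose_mat k" n x]
  by (simp add: row_mult_def)

lemma row_mult_one [simp]: "x \<in> carrier_vec n \<Longrightarrow> row_mult x (1\<^sub>m n) = x"
  by (simp add: row_mult_def)

lemma row_mult_smult:
  assumes "k \<in> carrier_mat n n" "x \<in> carrier_vec n"
  shows "row_mult (a \<cdot>\<^sub>v x) k = a \<cdot>\<^sub>v row_mult x k"
  using assms by (simp add: row_mult_def mult_mat_vec[of _ n n])

lemma row_mult_last_unit_vec: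
  assumes "k \<in> carrier_mat n n" "0 < n" "j < n"
  shows "row_mult (last_unit_vec n) k $ j = k $$ (n - 1, j)"
proof -
  have "row_mult (last_unit_vec n) k $ j = (\<Sum>i<n. (if i = n - 1 then 1 else 0) * k $$ (i, j))"
    using assms by (subst row_mult_entry[OF assms(1)]) (auto simp: last_unit_vec_def intro!: sum.cong)
  also have "\<dots> = (\<Sum>i<n. if i = n - 1 then k $$ (i, j) else 0)"
    by (intro sum.cong) auto
  finally show ?thesis using assms by simp
qed

lemma last_unit_vec_carrier [simp]: "last_unit_vec n \<in> carrier_vec n"
  by (simp add: last_unit_vec_def)

context nonarchimedean_local_field
begin

section \<open>The ring of integers and its ideals\<close>

abbreviation q :: nat where "q \<equiv> residue_order av"
abbreviation \<O> :: "'a set" where "\<O> \<equiv> integers av"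
abbreviation \<U> :: "'a set" where "\<U> \<equiv> integer_units av"
abbreviation \<pp> :: "nat \<Rightarrow> 'a set" where "\<pp> \<equiv> ideal_power av"

lemma av_0 [simp]: "av 0 = 0" by (simp add: av_eq_0_iff)

lemma av_1 [simp]: "av 1 = 1"
  using av_mult[of 1 1] av_eq_0_iff[of 1] by simp

lemma av_minus [simp]: "av (- x) = av x"
proof -
  have "av (- 1) * av (- 1) = 1" using av_mult[of "- 1" "- 1"] by simp
  then have "av (- 1) = 1" using av_nonneg[of "- 1"] by (simp add: square_eq_1_iff)
  then show ?thesis using av_mult[of "- 1" x] by simp
qed

lemma av_diff: "av (x - y) \<le> max (av x) (av y)"
  using av_ultrametric[of x "- y"] by simp

lemma av_diff_commute: "av (x - y) = av (y - x)"
  using av_minus[of "x - y"] by simp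

lemma av_inverse: "av (inverse x) = inverse (av x)"
proof (cases "x = 0")
  case False
  then have "av x * av (inverse x) = 1" using av_mult[of x "inverse x"] by simp
  then show ?thesis by (metis inverse_unique)
qed simp

lemma av_divide: "av (x / y) = av x / av y"
  by (simp add: divide_inverse av_mult av_inverse)

lemma av_power: "av (x ^ m) = av x ^ m"
  by (induction m) (simp_all add: av_mult)

lemma av_add_le: "av x \<le> b \<Longrightarrow> av y \<le> b \<Longrightarrow> av (x + y) \<le> b"
  using av_ultrametric[of x y] by simp

lemma av_sum_le: "0 \<le> b \<Longrightarrow> (\<And>i. i \<in> A \<Longrightarrow> av (f i) \<le> b) \<Longrightarrow> av (sum f A) \<le> b"
  by (induction A rule: infinite_finite_induct) (auto intro: av_add_le)

text \<open>Writing \<open>x\<close> as \<open>(x + y) - y\<close> bounds \<open>av x\<close> by a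
  maximum in which \<open>av y\<close> is excluded by the strict inequality.\<close>

lemma av_add_less: "av y < av x \<Longrightarrow> av (x + y) = av x"
  using av_ultrametric[of x y] av_diff[of "x + y" y] by simp

lemma q_pos: "0 < q"
proof -
  have "residue_field av \<noteq> {}"
    unfolding residue_field_def quotient_def integers_def by (auto intro: exI[of _ 0])
  then show ?thesis
    using finite_residue_field by (simp add: residue_order_def card_gt_0_iff)
qed

definition unif :: 'a where
  "unif = (SOME u. maximal_ideal av = {u * y |y. y \<in> \<O>} \<and> av u = 1 / real q)"

lemma unif: "maximal_ideal av = {unif * y |y. y \<in> \<O>}" "av unif = 1 / real q"
  using someI_ex[OF uniformiser] unfolding unif_def by auto

lemma q_gt_1: "1 < q"
proof -
  have "unif * 1 \<in> maximal_ideal av"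
    unfolding unif(1) integers_def by (auto intro!: exI[of _ 1])
  then have "1 / real q < 1" using unif(2) by (simp add: maximal_ideal_def)
  then show ?thesis using q_pos by (simp add: divide_less_eq)
qed

lemma unif_nonzero: "unif \<noteq> 0" using unif(2) q_pos av_eq_0_iff[of unif] by auto

lemma av_unif_power: "av (unif ^ m) = (1 / real q) ^ m"
  by (simp add: av_power unif(2))

lemma mem_ideal_power: "x \<in> \<pp> m \<longleftrightarrow> av x \<le> (1 / real q) ^ m"
  by (simp add: ideal_power_def)

lemma ideal_power_0: "\<pp> 0 = \<O>"
  by (simp add: ideal_power_def integers_def)

lemma ideal_power_antimono: "m \<le> l \<Longrightarrow> \<pp> l \<subseteq> \<pp> m"
  using q_gt_1 by (auto simp: ideal_power_def intro: order_trans power_decreasing)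

lemma ideal_power_integers: "x \<in> \<pp> m \<Longrightarrow> x \<in> \<O>"
  using ideal_power_antimono[of 0 m] ideal_power_0 by auto

lemma ideal_power_zero [simp]: "0 \<in> \<pp> m"
  by (simp add: mem_ideal_power)

lemma ideal_power_add: "x \<in> \<pp> m \<Longrightarrow> y \<in> \<pp> m \<Longrightarrow> x + y \<in> \<pp> m"
  by (simp add: mem_ideal_power av_add_le)

lemma ideal_power_uminus: "- x \<in> \<pp> m \<longleftrightarrow> x \<in> \<pp> m"
  by (simp add: mem_ideal_power)

lemma ideal_power_diff: "x \<in> \<pp> m \<Longrightarrow> y \<in> \<pp> m \<Longrightarrow> x - y \<in> \<pp> m"
  using ideal_power_add[of x m "- y"] by (simp add: ideal_power_uminus)

lemma ideal_power_diff_commute: "x - y \<in> \<pp> m \<longleftrightarrow> y - x \<in> \<pp> m"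
  using ideal_power_uminus[of "x - y"] by simp

lemma ideal_power_diff_trans:
  "x - y \<in> \<pp> m \<Longrightarrow> y - z \<in> \<pp> m \<Longrightarrow> x - z \<in> \<pp> m"
  using ideal_power_add[of "x - y" m "y - z"] by simp

lemma ideal_power_sum: "(\<And>i. i \<in> A \<Longrightarrow> f i \<in> \<pp> m) \<Longrightarrow> sum f A \<in> \<pp> m"
  by (simp add: mem_ideal_power av_sum_le)

lemma ideal_power_mult:
  assumes "x \<in> \<O>" "y \<in> \<pp> m"
  shows "x * y \<in> \<pp> m" "y * x \<in> \<pp> m"
  using assms mult_mono[of "av x" 1 "av y" "(1 / real q) ^ m"]
  by (auto simp: mem_ideal_power integers_def av_mult av_nonneg mult.commute)

text \<open>This is the discreteness of the valuation: after division by \<open>unif ^ m\<close> the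
  strict bound puts \<open>x\<close> in the maximal ideal, which \<open>unif\<close> generates. For
  an element of \<open>\<pp> m\<close> it turns non-membership in \<open>\<pp> (Suc m)\<close> into
  an exact absolute value.\<close>

lemma ideal_power_Suc: "x \<in> \<pp> (Suc m) \<longleftrightarrow> av x < (1 / real q) ^ m"
proof
  assume "x \<in> \<pp> (Suc m)"
  then have "av x \<le> (1 / real q) ^ Suc m" by (simp add: mem_ideal_power del: power_Suc)
  also have "\<dots> < (1 / real q) ^ m"
    using q_gt_1 by (intro power_strict_decreasing) auto
  finally show "av x < (1 / real q) ^ m" .
next
  assume x: "av x < (1 / real q) ^ m"
  have "x / unif ^ m \<in> maximal_ideal av"
    using x q_gt_1 by (simp add: maximal_ideal_def av_divide av_unif_power)
  then obtain y where y: "y \<in> \<O>" "x / unif ^ m = unif * y" unfolding unif(1) by auto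
  then have "x = unif ^ Suc m * y" using unif_nonzero by (simp add: field_simps)
  then show "x \<in> \<pp> (Suc m)"
    using ideal_power_mult(2)[OF y(1), of "unif ^ Suc m" "Suc m"] by (simp add: mem_ideal_power av_unif_power del: power_Suc)
qed

lemma integers_iff: "x \<in> \<O> \<longleftrightarrow> av x \<le> 1" by (simp add: integers_def)
lemma units_iff: "x \<in> \<U> \<longleftrightarrow> av x = 1" by (simp add: integer_units_def)

lemma integers_closed:
  "0 \<in> \<O>" "1 \<in> \<O>"
  "x \<in> \<O> \<Longrightarrow> y \<in> \<O> \<Longrightarrow> x + y \<in> \<O>"
  "x \<in> \<O> \<Longrightarrow> y \<in> \<O> \<Longrightarrow> x - y \<in> \<O>"
  "x \<in> \<O> \<Longrightarrow> y \<in> \<O> \<Longrightarrow> x * y \<in> \<O>"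
  "x \<in> \<O> \<Longrightarrow> - x \<in> \<O>"
  "x \<in> \<U> \<Longrightarrow> x \<in> \<O>"
  using ideal_power_mult[of x y 0] ideal_power_diff[of x 0 y]
  by (auto simp: integers_iff units_iff av_add_le ideal_power_0)

lemma integers_sum: "(\<And>i. i \<in> A \<Longrightarrow> f i \<in> \<O>) \<Longrightarrow> sum f A \<in> \<O>"
  using ideal_power_sum[of A f 0] by (simp add: ideal_power_0)

lemma units_closed:
  "1 \<in> \<U>"
  "x \<in> \<U> \<Longrightarrow> y \<in> \<U> \<Longrightarrow> x * y \<in> \<U>"
  "x \<in> \<U> \<Longrightarrow> inverse x \<in> \<U>"
  "x \<in> \<U> \<Longrightarrow> x \<noteq> 0"
  "x \<in> \<U> \<Longrightarrow> x ^ j \<in> \<U>"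
  by (auto simp: units_iff av_mult av_inverse av_power)

text \<open>Classes are sets of field elements, so the size of a subset modulo
  \<open>\<pp> m\<close> is the cardinality of its image under \<open>residue m\<close>; for
  \<open>m = 1\<close> and the integers the image is \<open>residue_field\<close>.\<close>

definition residue :: "nat \<Rightarrow> 'a \<Rightarrow> 'a set" where
  "residue m x = {y. y - x \<in> \<pp> m}"

lemma residue_eq_iff: "residue m x = residue m y \<longleftrightarrow> x - y \<in> \<pp> m"
proof
  assume "residue m x = residue m y"
  moreover have "x \<in> residue m x" by (simp add: residue_def)
  ultimately have "x \<in> residue m y" by simp
  then show "x - y \<in> \<pp> m" by (simp add: residue_def)
next
  assume "x - y \<in> \<pp> m"
  then show "residue m x = residue m y"
    unfolding residue_def using ideal_power_diff_trans ideal_power_diff_commute by blast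
qed

lemma residue_field_eq: "residue_field av = residue 1 ` \<O>"
proof -
  have "{(x, y). (x, y) \<in> \<O> \<times> \<O> \<and> x - y \<in> maximal_ideal av} `` {x} = residue 1 x"
    if "x \<in> \<O>" for x
  proof -
    have "y - x \<in> \<pp> 1 \<longleftrightarrow> av (x - y) < 1" for y
      by (simp add: ideal_power_Suc av_diff_commute)
    moreover have "y \<in> \<O>" if "y - x \<in> \<pp> 1" for y
      using integers_closed(3)[of x "y - x"] ideal_power_integers[OF that] \<open>x \<in> \<O>\<close> by simp
    ultimately show ?thesis using that by (auto simp: residue_def maximal_ideal_def)
  qed
  then show ?thesis unfolding residue_field_def quotient_def by auto
qed

text \<open>Multiplication by \<open>unif ^ m\<close> carries the residue field bijectively onto
  \<open>\<pp> m\<close> modulo \<open>\<pp> (Suc m)\<close>.\<close>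

lemma card_residue_ideal_power: "card (residue (Suc m) ` \<pp> m) = q"
proof -
  let ?s = "\<lambda>z. unif ^ m * z"
  have m0: "unif ^ m \<noteq> 0" using unif_nonzero by simp
  have P: "?s z \<in> \<pp> (m + l) \<longleftrightarrow> z \<in> \<pp> l" for z l
    using q_pos by (simp add: mem_ideal_power av_mult av_unif_power power_add)
  have res: "residue (Suc m) (?s x) = ?s ` residue 1 x" for x
  proof
    show "residue (Suc m) (?s x) \<subseteq> ?s ` residue 1 x"
    proof
      fix y assume y: "y \<in> residue (Suc m) (?s x)"
      have eq: "y = ?s (y / unif ^ m)" using m0 by simp
      have "?s (y / unif ^ m - x) \<in> \<pp> (m + 1)"
        using y m0 by (simp add: residue_def right_diff_distrib)
      then have "y / unif ^ m \<in> residue 1 x" unfolding P by (simp add: residue_def)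
      then show "y \<in> ?s ` residue 1 x" using eq by blast
    qed
  next
    show "?s ` residue 1 x \<subseteq> residue (Suc m) (?s x)"
      using P[of _ 1] by (auto simp: residue_def simp flip: right_diff_distrib)
  qed
  have "\<pp> m = ?s ` \<O>"
  proof
    show "\<pp> m \<subseteq> ?s ` \<O>"
    proof
      fix y assume y: "y \<in> \<pp> m"
      have "y = ?s (y / unif ^ m)" using m0 by simp
      moreover from this have "y / unif ^ m \<in> \<O>" using P[of "y / unif ^ m" 0] y by (simp add: ideal_power_0)
      ultimately show "y \<in> ?s ` \<O>" by blast
    qed
    show "?s ` \<O> \<subseteq> \<pp> m" using P[of _ 0] by (auto simp: ideal_power_0)
  qed
  then have "residue (Suc m) ` \<pp> m = (`) ?s ` residue_field av"
    by (simp add: residue_field_eq image_image res)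
  moreover have "inj_on ((`) ?s) (residue_field av)"
    using m0 by (intro inj_on_image) (auto simp: inj_on_def)
  ultimately show ?thesis by (simp add: card_image residue_order_def)
qed

lemma finite_residue_ideal_power: "finite (residue (Suc m) ` \<pp> m)"
  using card_residue_ideal_power[of m] q_pos by (metis card.infinite less_irrefl)

text \<open>By induction: a class modulo \<open>\<pp> (Suc m)\<close> contains some
  \<open>a + b\<close>, with \<open>a\<close> one of finitely many representatives modulo
  \<open>\<pp> m\<close> and \<open>b\<close> one of finitely many representatives of
  \<open>\<pp> m\<close>.\<close>

lemma finite_residue: "finite (residue m ` \<O>)"
proof (induction m)
  case 0
  have "residue 0 ` \<O> \<subseteq> {residue 0 0}"
    by (intro image_subsetI) (simp add: residue_eq_iff ideal_power_0)
  then show ?case by (rule finite_subset) simp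
next
  case (Suc m)
  obtain A where A: "finite A" "A \<subseteq> \<O>" "residue m ` \<O> = residue m ` A"
    using finite_subset_image[OF Suc order_refl] by metis
  obtain B where B: "finite B" "B \<subseteq> \<pp> m" "residue (Suc m) ` \<pp> m = residue (Suc m) ` B"
    using finite_subset_image[OF finite_residue_ideal_power order_refl] by metis
  have "residue (Suc m) ` \<O> \<subseteq> (\<lambda>(a, b). residue (Suc m) (a + b)) ` (A \<times> B)"
  proof (rule image_subsetI)
    fix x assume "x \<in> \<O>"
    then obtain a where a: "a \<in> A" "residue m x = residue m a" using A(3) by (metis imageE imageI)
    then have "x - a \<in> \<pp> m" by (simp add: residue_eq_iff)
    then obtain b where b: "b \<in> B" "residue (Suc m) (x - a) = residue (Suc m) b"
      using B(3) by (metis imageE imageI)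
    then have "residue (Suc m) x = residue (Suc m) (a + b)" by (simp add: residue_eq_iff diff_diff_eq)
    then show "residue (Suc m) x \<in> (\<lambda>(a, b). residue (Suc m) (a + b)) ` (A \<times> B)"
      using a b by (auto intro!: image_eqI[of _ _ "(a, b)"])
  qed
  then show ?case by (rule finite_subset) (use A B in auto)
qed

text \<open>Two powers of \<open>u\<close> agree modulo \<open>\<pp> m\<close> by the pigeonhole
  principle, and the smaller one can be divided out. Applied at the level where \<chi> is trivial,
  this makes its values roots of unity, so that \<chi> is unitary.\<close>

lemma unit_power_cong_1:
  assumes "u \<in> \<U>"
  obtains j where "0 < j" "u ^ j - 1 \<in> \<pp> m"
proof -
  have "\<not> inj (\<lambda>i :: nat. residue m (u ^ i))"
  proof
    assume "inj (\<lambda>i :: nat. residue m (u ^ i))"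
    moreover have "range (\<lambda>i :: nat. residue m (u ^ i)) \<subseteq> residue m ` \<O>"
      using units_closed(5)[OF assms] integers_closed(7) by auto
    ultimately show False
      using finite_residue[of m] finite_imageD finite_subset infinite_UNIV_nat by metis
  qed
  then obtain i j :: nat where "residue m (u ^ i) = residue m (u ^ j)" "i \<noteq> j" by (auto simp: inj_def)
  then obtain i j :: nat where ij: "residue m (u ^ j) = residue m (u ^ i)" "i < j"
    by (metis linorder_neqE_nat)
  have "inverse u ^ i * (u ^ j - u ^ i) \<in> \<pp> m"
    using ideal_power_mult(1)[OF integers_closed(7)[OF units_closed(5)[OF units_closed(3)[OF assms]]]]
      ij(1) unfolding residue_eq_iff by blast
  moreover have "inverse u ^ i * (u ^ j - u ^ i) = u ^ (j - i) - 1"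
  proof -
    have "u ^ j = u ^ i * u ^ (j - i)" using ij(2) by (simp flip: power_add)
    then show ?thesis using units_closed(4)[OF assms] by (simp add: field_simps)
  qed
  ultimately show ?thesis using that[of "j - i"] ij(2) by simp
qed

section \<open>Integral matrices and congruence subgroups\<close>

definition integral_mat :: "nat \<Rightarrow> 'a mat \<Rightarrow> bool" where
  "integral_mat n A \<longleftrightarrow> A \<in> carrier_mat n n \<and> (\<forall>i<n. \<forall>j<n. A $$ (i, j) \<in> \<O>)"

lemma integral_matD: "integral_mat n A \<Longrightarrow> i < n \<Longrightarrow> j < n \<Longrightarrow> A $$ (i, j) \<in> \<O>"
  by (simp add: integral_mat_def)

lemma integral_mat_iff: "integral_mat n A \<longleftrightarrow> A \<in> carrier_mat n n \<and> elements_mat A \<subseteq> \<O>"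
  by (auto simp: integral_mat_def subset_iff dest!: elements_matD)

lemma mem_K:
  "k \<in> maximal_compact av n \<longleftrightarrow>
    integral_mat n k \<and> (\<exists>h. integral_mat n h \<and> k * h = 1\<^sub>m n \<and> h * k = 1\<^sub>m n)"
  by (auto simp: maximal_compact_def GL_def integral_mat_iff)

lemma K_memD:
  assumes "k \<in> maximal_compact av n"
  shows "k \<in> carrier_mat n n" "integral_mat n k" "k \<in> GL n UNIV"
    "i < n \<Longrightarrow> j < n \<Longrightarrow> k $$ (i, j) \<in> \<O>"
  using assms by (auto simp: mem_K integral_mat_def GL_def)

definition Kgrp :: "nat \<Rightarrow> 'a mat monoid" where
  "Kgrp n = (GL_group n)\<lparr>carrier := maximal_compact av n\<rparr>"

lemma Kgrp_simps [simp]: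
  "carrier (Kgrp n) = maximal_compact av n" "mult (Kgrp n) = (*)" "one (Kgrp n) = 1\<^sub>m n"
  by (simp_all add: Kgrp_def GL_group_def)

lemma group_Kgrp: "group (Kgrp n)"
  unfolding Kgrp_def maximal_compact_def by (rule group_GL) (simp_all add: integers_closed(1,2,3,5))

lemma subgroup_maximal_compact: "subgroup (maximal_compact av n) (GL_group n)"
  using group.group_incl_imp_subgroup[OF group_GL_group, of "maximal_compact av n" n] group_Kgrp[of n]
    K_memD(3) by (auto simp: Kgrp_def GL_group_def)

abbreviation Kinv :: "nat \<Rightarrow> 'a mat \<Rightarrow> 'a mat" where
  "Kinv n k \<equiv> inv\<^bsub>Kgrp n\<^esub> k"

lemma K_closed:
  "1\<^sub>m n \<in> maximal_compact av n"
  "k \<in> maximal_compact av n \<Longrightarrow> h \<in> maximal_compact av n \<Longrightarrow> k * h \<in> maximal_compact av n"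
  "k \<in> maximal_compact av n \<Longrightarrow> Kinv n k \<in> maximal_compact av n"
  "k \<in> maximal_compact av n \<Longrightarrow> k * Kinv n k = 1\<^sub>m n"
  "k \<in> maximal_compact av n \<Longrightarrow> Kinv n k * k = 1\<^sub>m n"
  using group.subgroup_self[OF group_Kgrp, of n] monoid.one_closed[OF group.is_monoid[OF group_Kgrp, of n]]
    monoid.m_closed[OF group.is_monoid[OF group_Kgrp, of n], of k h]
    group.inv_closed[OF group_Kgrp, of k n] group.r_inv[OF group_Kgrp, of k n]
    group.l_inv[OF group_Kgrp, of k n] by simp_all

lemma K_assoc:
  assumes "k \<in> maximal_compact av n" "h \<in> maximal_compact av n" "l \<in> maximal_compact av n"
  shows "k * h * l = k * (h * l)"
  using assms K_memD(1) by (intro assoc_mult_mat[of _ n n _ n _ n])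

lemma K_cancel:
  assumes "k \<in> maximal_compact av n" "h \<in> maximal_compact av n"
  shows "k * (Kinv n k * h) = h" "Kinv n k * (k * h) = h" "h * k * Kinv n k = h" "h * Kinv n k * k = h"
proof -
  note k = K_closed(3)[OF assms(1)] and h = K_memD(1)[OF assms(2)]
  show "k * (Kinv n k * h) = h"
    using K_assoc[OF assms(1) k assms(2)] K_closed(4)[OF assms(1)] left_mult_one_mat[OF h] by simp
  show "Kinv n k * (k * h) = h"
    using K_assoc[OF k assms] K_closed(5)[OF assms(1)] left_mult_one_mat[OF h] by simp
  show "h * k * Kinv n k = h"
    using K_assoc[OF assms(2,1) k] K_closed(4)[OF assms(1)] right_mult_one_mat[OF h] by simp
  show "h * Kinv n k * k = h"
    using K_assoc[OF assms(2) k assms(1)] K_closed(5)[OF assms(1)] right_mult_one_mat[OF h] by simp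
qed

section \<open>Entrywise congruence of matrices and the principal congruence subgroups\<close>

definition mcong :: "nat \<Rightarrow> nat \<Rightarrow> 'a mat \<Rightarrow> 'a mat \<Rightarrow> bool" where
  "mcong n m A B \<longleftrightarrow> (\<forall>i<n. \<forall>j<n. A $$ (i, j) - B $$ (i, j) \<in> \<pp> m)"

lemma mcongD: "mcong n m A B \<Longrightarrow> i < n \<Longrightarrow> j < n \<Longrightarrow> A $$ (i, j) - B $$ (i, j) \<in> \<pp> m"
  by (simp add: mcong_def)

lemma mcong_refl: "mcong n m A A" by (simp add: mcong_def)

lemma mcong_sym: "mcong n m A B \<Longrightarrow> mcong n m B A"
  using ideal_power_diff_commute by (auto simp: mcong_def)

lemma mcong_mult:
  assumes "integral_mat n A" "integral_mat n A'" "integral_mat n B" "integral_mat n B'"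
    and "mcong n m A A'" "mcong n m B B'"
  shows "mcong n m (A * B) (A' * B')"
  unfolding mcong_def
proof (intro allI impI)
  fix i j assume ij: "i < n" "j < n"
  have c: "A \<in> carrier_mat n n" "A' \<in> carrier_mat n n" "B \<in> carrier_mat n n" "B' \<in> carrier_mat n n"
    using assms by (auto simp: integral_mat_def)
  have "(A * B) $$ (i, j) - (A' * B') $$ (i, j) =
    (\<Sum>h<n. A $$ (i, h) * (B $$ (h, j) - B' $$ (h, j)) + (A $$ (i, h) - A' $$ (i, h)) * B' $$ (h, j))"
    unfolding mult_mat_entry[OF c(1,3) ij] mult_mat_entry[OF c(2,4) ij] sum_subtractf[symmetric]
    by (rule sum.cong) (simp_all add: algebra_simps)
  also have "\<dots> \<in> \<pp> m"
  proof (intro ideal_power_sum ideal_power_add)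
    fix h assume "h \<in> {..<n}"
    then have h: "h < n" by simp
    have "A $$ (i, h) \<in> \<O>" "B' $$ (h, j) \<in> \<O>"
      "B $$ (h, j) - B' $$ (h, j) \<in> \<pp> m" "A $$ (i, h) - A' $$ (i, h) \<in> \<pp> m"
      by (rule integral_matD mcongD assms ij h)+
    then show "A $$ (i, h) * (B $$ (h, j) - B' $$ (h, j)) \<in> \<pp> m"
      and "(A $$ (i, h) - A' $$ (i, h)) * B' $$ (h, j) \<in> \<pp> m"
      by (auto intro: ideal_power_mult(1) ideal_power_mult(2))
  qed
  finally show "(A * B) $$ (i, j) - (A' * B') $$ (i, j) \<in> \<pp> m" .
qed

lemma principal_congruence_eq:
  "principal_congruence av n m = {k \<in> maximal_compact av n. mcong n m k (1\<^sub>m n)}"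
proof -
  have "elements_mat (k - 1\<^sub>m n) \<subseteq> \<pp> m \<longleftrightarrow> mcong n m k (1\<^sub>m n)"
    if "k \<in> maximal_compact av n" for k
  proof -
    note k = K_memD(1)[OF that]
    have k1: "k - 1\<^sub>m n \<in> carrier_mat n n" by (simp add: minus_carrier_mat)
    show ?thesis
    proof
      assume e: "elements_mat (k - 1\<^sub>m n) \<subseteq> \<pp> m"
      show "mcong n m k (1\<^sub>m n)" unfolding mcong_def
      proof (intro allI impI)
        fix i j assume "i < n" "j < n"
        then show "k $$ (i, j) - 1\<^sub>m n $$ (i, j) \<in> \<pp> m"
          using e elements_matI[OF k1, of i j] k by auto
      qed
    next
      assume "mcong n m k (1\<^sub>m n)"
      then show "elements_mat (k - 1\<^sub>m n) \<subseteq> \<pp> m"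
        using k by (auto simp: mcong_def dest!: elements_matD simp del: index_one_mat(1))
    qed
  qed
  then show ?thesis by (auto simp: principal_congruence_def)
qed

text \<open>Each closure property follows by replacing the elements of the subgroup by the identity
  in a product: modulo \<open>\<pp> m\<close>, \<open>x h x^-1\<close> is congruent to
  \<open>x 1 x^-1\<close>.\<close>

lemma normal_N: "principal_congruence av n m \<lhd> Kgrp n"
proof -
  interpret group "Kgrp n" by (rule group_Kgrp)
  note int = K_memD(2)
  have conj: "x * h * Kinv n x \<in> principal_congruence av n m"
    if x: "x \<in> maximal_compact av n" and h: "h \<in> principal_congruence av n m" for x h
  proof -
    have h': "h \<in> maximal_compact av n" "mcong n m h (1\<^sub>m n)" using h by (auto simp: principal_congruence_eq)
    have "mcong n m (x * h * Kinv n x) (x * 1\<^sub>m n * Kinv n x)"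
      by (intro mcong_mult mcong_refl int K_closed x h')
    then show ?thesis using x h' by (simp add: principal_congruence_eq K_closed right_mult_one_mat[OF K_memD(1)])
  qed
  show ?thesis
    unfolding normal_inv_iff
  proof (intro conjI ballI)
    show "subgroup (principal_congruence av n m) (Kgrp n)"
    proof (rule subgroupI)
      show "principal_congruence av n m \<subseteq> carrier (Kgrp n)" by (auto simp: principal_congruence_eq)
      show "principal_congruence av n m \<noteq> {}"
        using K_closed(1)[of n] mcong_refl by (auto simp: principal_congruence_eq)
      fix a assume a: "a \<in> principal_congruence av n m"
      then have a': "a \<in> maximal_compact av n" "mcong n m a (1\<^sub>m n)" by (auto simp: principal_congruence_eq)
      have "mcong n m (Kinv n a * a) (Kinv n a * 1\<^sub>m n)"
        by (intro mcong_mult mcong_refl int K_closed a')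
      then show "Kinv n a \<in> principal_congruence av n m"
        using a' by (simp add: principal_congruence_eq K_closed mcong_sym right_mult_one_mat[OF K_memD(1)])
      fix b assume b: "b \<in> principal_congruence av n m"
      then have b': "b \<in> maximal_compact av n" "mcong n m b (1\<^sub>m n)" by (auto simp: principal_congruence_eq)
      have "mcong n m (a * b) (1\<^sub>m n * 1\<^sub>m n)"
        by (intro mcong_mult mcong_refl int K_closed a' b')
      then show "a \<otimes>\<^bsub>Kgrp n\<^esub> b \<in> principal_congruence av n m"
        using a' b' by (simp add: principal_congruence_eq K_closed)
    qed
  next
    fix x h assume "x \<in> carrier (Kgrp n)" "h \<in> principal_congruence av n m"
    then show "x \<otimes>\<^bsub>Kgrp n\<^esub> h \<otimes>\<^bsub>Kgrp n\<^esub> inv\<^bsub>Kgrp n\<^esub> x \<in> principal_congruence av n m"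
      using conj by simp
  qed
qed

lemma rcoset_N:
  assumes k: "k \<in> maximal_compact av n"
  shows "principal_congruence av n m #>\<^bsub>Kgrp n\<^esub> k = {l \<in> maximal_compact av n. mcong n m l k}" (is "?L = ?R")
proof
  note int = K_memD(2)
  show "?L \<subseteq> ?R"
  proof
    fix l assume "l \<in> ?L"
    then obtain h where h: "h \<in> maximal_compact av n" "mcong n m h (1\<^sub>m n)" "l = h * k"
      by (auto simp: r_coset_def principal_congruence_eq)
    have "mcong n m (h * k) (1\<^sub>m n * k)" by (intro mcong_mult mcong_refl int K_closed k h)
    then show "l \<in> ?R" using h k by (simp add: K_closed left_mult_one_mat[OF K_memD(1)])
  qed
  show "?R \<subseteq> ?L"
  proof
    fix l assume l: "l \<in> ?R"
    then have l': "l \<in> maximal_compact av n" "mcong n m l k" by auto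
    have "mcong n m (l * Kinv n k) (k * Kinv n k)" by (intro mcong_mult mcong_refl int K_closed k l')
    then have "l * Kinv n k \<in> principal_congruence av n m"
      using k l' by (simp add: principal_congruence_eq K_closed)
    moreover have "l = l * Kinv n k * k" using K_cancel[OF k l'(1)] by simp
    ultimately show "l \<in> ?L" unfolding r_coset_def by auto
  qed
qed

text \<open>By \<open>rcoset_N\<close> the cosets are congruence classes of matrices, so they are
  the fibres of entrywise reduction, which takes finitely many values.\<close>

lemma finite_rcosets_N: "finite (rcosets\<^bsub>Kgrp n\<^esub> (principal_congruence av n m))"
proof -
  define \<rho> where "\<rho> k = (\<lambda>(i, j)\<in>{..<n} \<times> {..<n}. residue m (k $$ (i, j)))" for k :: "'a mat"
  have "\<rho> l = \<rho> k \<longleftrightarrow> mcong n m l k" for l k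
  proof
    assume eq: "\<rho> l = \<rho> k"
    show "mcong n m l k" unfolding mcong_def
    proof (intro allI impI)
      fix i j assume "i < n" "j < n"
      then show "l $$ (i, j) - k $$ (i, j) \<in> \<pp> m"
        using fun_cong[OF eq, of "(i, j)"] by (simp add: \<rho>_def residue_eq_iff)
    qed
  next
    assume "mcong n m l k"
    then show "\<rho> l = \<rho> k" by (auto simp: \<rho>_def mcong_def intro!: restrict_ext residue_eq_iff[THEN iffD2] split: prod.split)
  qed
  then have "rcosets\<^bsub>Kgrp n\<^esub> (principal_congruence av n m) =
      (\<lambda>r. {l \<in> maximal_compact av n. \<rho> l = r}) ` \<rho> ` maximal_compact av n"
    by (force simp: RCOSETS_def rcoset_N)
  moreover have "finite (\<rho> ` maximal_compact av n)"
  proof (rule finite_subset)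
    show "\<rho> ` maximal_compact av n \<subseteq> PiE ({..<n} \<times> {..<n}) (\<lambda>_. residue m ` \<O>)"
      using K_memD(4) unfolding \<rho>_def by (intro image_subsetI restrict_PiE_iff[THEN iffD2]) auto
    show "finite (PiE ({..<n} \<times> {..<n}) (\<lambda>_. residue m ` \<O>))"
      by (intro finite_PiE finite_residue) simp
  qed
  ultimately show ?thesis by simp
qed

section \<open>Action on the unit sphere\<close>

lemma ideal_power_diff_cong:
  "x - y \<in> \<pp> m \<Longrightarrow> x - z \<in> \<pp> m \<longleftrightarrow> y - z \<in> \<pp> m"
  using ideal_power_diff_trans ideal_power_diff_commute by blast

lemma mem_sphere:
  assumes "0 < n"
  shows "x \<in> sphere av n \<longleftrightarrow> x \<in> carrier_vec n \<and> (\<forall>i<n. x $ i \<in> \<O>) \<and> (\<exists>i<n. x $ i \<in> \<U>)"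
proof -
  have "Max ((\<lambda>i. av (x $ i)) ` {..<n}) = 1 \<longleftrightarrow> (\<forall>i<n. av (x $ i) \<le> 1) \<and> (\<exists>i<n. av (x $ i) = 1)"
    using assms by (subst Max_eq_iff) auto
  then show ?thesis by (simp add: sphere_def integers_iff units_iff)
qed

lemma sphere_carrier: "x \<in> sphere av n \<Longrightarrow> x \<in> carrier_vec n" by (simp add: sphere_def)

text \<open>If all entries of \<open>x k\<close> were in \<open>\<pp> 1\<close>, the same would hold
  for \<open>x = (x k) k^-1\<close>, which has a unit entry.\<close>

lemma sphere_row_mult:
  assumes "0 < n" "x \<in> sphere av n" "k \<in> maximal_compact av n"
  shows "row_mult x k \<in> sphere av n"
proof -
  have x: "x \<in> carrier_vec n" "\<And>i. i < n \<Longrightarrow> x $ i \<in> \<O>"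
    using assms mem_sphere by auto
  note k = K_memD[OF assms(3)]
  let ?y = "row_mult x k" and ?h = "Kinv n k"
  note h = K_memD[OF K_closed(3)[OF assms(3)]]
  have y: "?y $ j \<in> \<O>" if "j < n" for j
    unfolding row_mult_entry[OF k(1) x(1) that]
    by (intro integers_sum integers_closed(5)) (use x k(4) that in auto)
  have "\<exists>j<n. ?y $ j \<in> \<U>"
  proof (rule ccontr)
    assume "\<not> ?thesis"
    then have y1: "?y $ j \<in> \<pp> 1" if "j < n" for j
      using that y[OF that] by (auto simp: ideal_power_Suc units_iff integers_iff less_le)
    have "x $ i \<in> \<pp> 1" if "i < n" for i
    proof -
      have "x = row_mult ?y ?h"
        using row_mult_mult[OF k(1) h(1) x(1)] x(1) assms(3) by (simp add: K_closed)
      moreover have "row_mult ?y ?h $ i \<in> \<pp> 1"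
        unfolding row_mult_entry[OF h(1) row_mult_carrier[OF k(1)] that]
        by (intro ideal_power_sum ideal_power_mult(2)) (use y1 h(4) that in auto)
      ultimately show ?thesis by simp
    qed
    moreover obtain i where "i < n" "x $ i \<in> \<U>"
      using assms(2) by (auto simp: mem_sphere[OF assms(1)])
    ultimately show False by (force simp: ideal_power_Suc units_iff)
  qed
  then show ?thesis using y k(1) assms(1) by (simp add: mem_sphere)
qed

lemma last_unit_vec_sphere: "0 < n \<Longrightarrow> last_unit_vec n \<in> sphere av n"
  by (auto simp: mem_sphere last_unit_vec_def integers_closed units_closed intro!: exI[of _ "n - 1"])

lemma sphere_smult:
  assumes "0 < n" "x \<in> sphere av n" "a \<in> \<U>"
  shows "a \<cdot>\<^sub>v x \<in> sphere av n"
proof -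
  obtain i where "i < n" "x $ i \<in> \<U>" using assms by (auto simp: mem_sphere)
  then show ?thesis
    using assms by (auto simp: mem_sphere integers_closed units_closed intro!: exI[of _ i])
qed

section \<open>Block matrices and orbits on the sphere\<close>

definition upper_block :: "nat \<Rightarrow> 'a mat \<Rightarrow> (nat \<Rightarrow> 'a) \<Rightarrow> 'a mat" where
  "upper_block m a \<beta> = four_block_mat a (mat m 1 (\<lambda>(i, _). \<beta> i)) (0\<^sub>m 1 m) (1\<^sub>m 1)"

text \<open>When the last entry of \<open>x\<close> is a unit, this is an explicit element of
  \<open>K\<close> moving the last unit vector to \<open>x\<close>. It is congruent to 1 whenever
  \<open>x\<close> is congruent to the last unit vector, which \<open>level_equivariant\<close>
  exploits.\<close>

definition lower_block :: "nat \<Rightarrow> 'a vec \<Rightarrow> 'a mat" where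
  "lower_block m x = four_block_mat (1\<^sub>m m) (0\<^sub>m m 1) (mat 1 m (\<lambda>(_, j). x $ j)) (mat 1 1 (\<lambda>_. x $ m))"

lemma upper_block_mult:
  assumes "a \<in> carrier_mat m m" "b \<in> carrier_mat m m"
  shows "upper_block m a \<beta> * upper_block m b \<gamma> = upper_block m (a * b) (\<lambda>i. (\<Sum>l<m. a $$ (i, l) * \<gamma> l) + \<beta> i)"
proof -
  have "upper_block m a \<beta> * upper_block m b \<gamma> = four_block_mat
      (a * b + mat m 1 (\<lambda>(i, _). \<beta> i) * 0\<^sub>m 1 m) (a * mat m 1 (\<lambda>(i, _). \<gamma> i) + mat m 1 (\<lambda>(i, _). \<beta> i) * 1\<^sub>m 1)
      (0\<^sub>m 1 m * b + 1\<^sub>m 1 * 0\<^sub>m 1 m) (0\<^sub>m 1 m * mat m 1 (\<lambda>(i, _). \<gamma> i) + 1\<^sub>m 1 * 1\<^sub>m 1)"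
    unfolding upper_block_def using assms by (intro mult_four_block_mat) auto
  also have "\<dots> = upper_block m (a * b) (\<lambda>i. (\<Sum>l<m. a $$ (i, l) * \<gamma> l) + \<beta> i)"
    unfolding upper_block_def
  proof (rule cong_four_block_mat)
    show "a * mat m 1 (\<lambda>(i, _). \<gamma> i) + mat m 1 (\<lambda>(i, _). \<beta> i) * 1\<^sub>m 1 =
      mat m 1 (\<lambda>(i, _). (\<Sum>l<m. a $$ (i, l) * \<gamma> l) + \<beta> i)"
      by (rule eq_matI) (use assms in \<open>auto simp: scalar_prod_def lessThan_atLeast0\<close>)
  qed (use assms in auto)
  finally show ?thesis .
qed

lemma upper_block_one: "upper_block m (1\<^sub>m m) (\<lambda>_. 0) = 1\<^sub>m (Suc m)"
proof -
  have "mat m 1 (\<lambda>(i, _). 0) = (0\<^sub>m m 1 :: 'a mat)" by (rule eq_matI) auto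
  then show ?thesis unfolding upper_block_def by (simp only: four_block_one_mat Suc_eq_plus1)
qed

lemma upper_block_cong: "(\<And>i. i < m \<Longrightarrow> \<beta> i = \<gamma> i) \<Longrightarrow> upper_block m a \<beta> = upper_block m a \<gamma>"
  unfolding upper_block_def by (intro cong_four_block_mat eq_matI) auto

lemma upper_block_entry:
  assumes "a \<in> carrier_mat m m" "i < Suc m" "j < Suc m"
  shows "upper_block m a \<beta> $$ (i, j) = (if i < m then if j < m then a $$ (i, j) else \<beta> i else if j < m then 0 else 1)"
  using assms by (auto simp: upper_block_def less_Suc_eq)

lemma integral_upper_block:
  assumes "integral_mat m a" "\<And>i. i < m \<Longrightarrow> \<beta> i \<in> \<O>"
  shows "integral_mat (Suc m) (upper_block m a \<beta>)"
proof -
  have a: "a \<in> carrier_mat m m" using assms by (simp add: integral_mat_def)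
  have "upper_block m a \<beta> \<in> carrier_mat (Suc m) (Suc m)"
    using four_block_carrier_mat[OF a, of "1\<^sub>m 1" 1 1] by (simp add: upper_block_def)
  then show ?thesis
    using assms unfolding integral_mat_def by (auto simp: upper_block_entry[OF a] integers_closed)
qed

lemma upper_block_mirabolic:
  assumes a: "a \<in> maximal_compact av m" and \<beta>: "\<And>i. i < m \<Longrightarrow> \<beta> i \<in> \<O>"
  shows "upper_block m a \<beta> \<in> mirabolic_compact av (Suc m)"
proof -
  let ?b = "Kinv m a"
  \<comment> \<open>The inverse of the block with entries \<open>a\<close> and
    \<open>\<beta>\<close> has column \<open>- a^-1 \<beta>\<close>.\<close>
  let ?\<gamma> = "\<lambda>i. - (\<Sum>l<m. ?b $$ (i, l) * \<beta> l)"
  have b: "?b \<in> maximal_compact av m" using a by (rule K_closed)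
  note aD = K_memD[OF a] and bD = K_memD[OF b]
  have \<gamma>: "?\<gamma> i \<in> \<O>" if "i < m" for i
    using that \<beta> bD(4) by (auto intro!: integers_closed(5,6) integers_sum)
  have "(\<Sum>l<m. a $$ (i, l) * ?\<gamma> l) + \<beta> i = 0" if i: "i < m" for i
  proof -
    have "(\<Sum>l<m. a $$ (i, l) * (\<Sum>h<m. ?b $$ (l, h) * \<beta> h)) = (\<Sum>h<m. (\<Sum>l<m. a $$ (i, l) * ?b $$ (l, h)) * \<beta> h)"
      unfolding sum_distrib_left sum_distrib_right by (subst sum.swap) (simp add: mult.assoc)
    also have "\<dots> = (\<Sum>h<m. (1\<^sub>m m :: 'a mat) $$ (i, h) * \<beta> h)"
      using i by (simp add: K_closed(4)[OF a] flip: mult_mat_entry[OF aD(1) bD(1)] del: index_one_mat index_mult_mat)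
    also have "\<dots> = (\<Sum>h<m. if h = i then \<beta> h else 0)"
      using i by (intro sum.cong) auto
    finally show ?thesis using i by (simp add: sum_negf)
  qed
  then have 1: "upper_block m a \<beta> * upper_block m ?b ?\<gamma> = 1\<^sub>m (Suc m)"
    unfolding upper_block_mult[OF aD(1) bD(1)] K_closed(4)[OF a] upper_block_one[symmetric]
    by (rule upper_block_cong)
  have 2: "upper_block m ?b ?\<gamma> * upper_block m a \<beta> = 1\<^sub>m (Suc m)"
    unfolding upper_block_mult[OF bD(1) aD(1)] K_closed(5)[OF a] upper_block_one[symmetric]
    by (rule upper_block_cong) simp
  have "upper_block m a \<beta> \<in> maximal_compact av (Suc m)"
    using 1 2 integral_upper_block[OF aD(2), of \<beta>] integral_upper_block[OF bD(2), of ?\<gamma>] \<beta> \<gamma>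
    by (auto simp: mem_K)
  moreover have "elements_mat (mat m 1 (\<lambda>(i, _). \<beta> i)) \<subseteq> \<O>"
    using \<beta> by (auto dest!: elements_matD)
  moreover have "upper_block m a \<beta> =
      four_block_mat a (mat m 1 (\<lambda>(i, _). \<beta> i)) (0\<^sub>m 1 (Suc m - 1)) (1\<^sub>m 1)"
    by (simp add: upper_block_def)
  moreover have "a \<in> GL (Suc m - 1) (\<O>)" using a by (simp add: maximal_compact_def)
  moreover have "mat m 1 (\<lambda>(i, _). \<beta> i) \<in> carrier_mat (Suc m - 1) 1" by simp
  ultimately show ?thesis unfolding mirabolic_compact_def mem_Collect_eq by (meson bexI)
qed

lemma mirabolic_subset: "k \<in> mirabolic_compact av n \<Longrightarrow> k \<in> maximal_compact av n"
  by (simp add: mirabolic_compact_def)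

lemma row_mult_upper_block:
  assumes "a \<in> carrier_mat m m" "x \<in> carrier_vec (Suc m)" "j < Suc m"
  shows "row_mult x (upper_block m a \<beta>) $ j =
    (if j < m then \<Sum>i<m. x $ i * a $$ (i, j) else (\<Sum>i<m. x $ i * \<beta> i) + x $ m)"
proof -
  have c: "upper_block m a \<beta> \<in> carrier_mat (Suc m) (Suc m)"
    using four_block_carrier_mat[OF assms(1), of "1\<^sub>m 1" 1 1] by (simp add: upper_block_def)
  show ?thesis
    unfolding row_mult_entry[OF c assms(2,3)] using assms
    by (auto simp: upper_block_entry[OF assms(1)])
qed

lemma lower_block_mult:
  assumes "x \<in> carrier_vec (Suc m)" "y \<in> carrier_vec (Suc m)"
  shows "lower_block m x * lower_block m y = lower_block m (vec (Suc m) (\<lambda>j. if j < m then x $ j + x $ m * y $ j else x $ m * y $ m))"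
proof -
  let ?r = "\<lambda>x. mat 1 m (\<lambda>(_, j). x $ j)" and ?d = "\<lambda>x. mat 1 1 (\<lambda>_. x $ m)"
  have "lower_block m x * lower_block m y = four_block_mat
      (1\<^sub>m m * 1\<^sub>m m + 0\<^sub>m m 1 * ?r y) (1\<^sub>m m * 0\<^sub>m m 1 + 0\<^sub>m m 1 * ?d y)
      (?r x * 1\<^sub>m m + ?d x * ?r y) (?r x * 0\<^sub>m m 1 + ?d x * ?d y)"
    unfolding lower_block_def using assms by (intro mult_four_block_mat) auto
  also have "\<dots> = lower_block m (vec (Suc m) (\<lambda>j. if j < m then x $ j + x $ m * y $ j else x $ m * y $ m))"
    unfolding lower_block_def by (rule cong_four_block_mat; rule eq_matI) (auto simp: scalar_prod_def)
  finally show ?thesis .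
qed

lemma lower_block_one: "lower_block m (last_unit_vec (Suc m)) = 1\<^sub>m (Suc m)"
proof -
  have "mat 1 m (\<lambda>(_, j). last_unit_vec (Suc m) $ j) = (0\<^sub>m 1 m :: 'a mat)"
    by (rule eq_matI) (auto simp: last_unit_vec_def)
  moreover have "mat 1 1 (\<lambda>_. last_unit_vec (Suc m) $ m) = (1\<^sub>m 1 :: 'a mat)"
    by (rule eq_matI) (auto simp: last_unit_vec_def)
  ultimately show ?thesis unfolding lower_block_def by (simp only: four_block_one_mat Suc_eq_plus1)
qed

lemma lower_block_entry:
  assumes "i < Suc m" "j < Suc m"
  shows "lower_block m x $$ (i, j) = (if i < m then if i = j then 1 else 0 else x $ j)"
  using assms by (auto simp: lower_block_def less_Suc_eq)

lemma integral_lower_block: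
  assumes "\<And>i. i < Suc m \<Longrightarrow> x $ i \<in> \<O>"
  shows "integral_mat (Suc m) (lower_block m x)"
proof -
  have "lower_block m x \<in> carrier_mat (Suc m) (Suc m)"
    using four_block_carrier_mat[of "1\<^sub>m m" m m "mat 1 1 (\<lambda>_. x $ m)" 1 1] by (simp add: lower_block_def)
  then show ?thesis
    using assms unfolding integral_mat_def by (auto simp: lower_block_entry integers_closed)
qed

lemma lower_block_mem:
  assumes x: "x \<in> carrier_vec (Suc m)" "\<And>i. i < Suc m \<Longrightarrow> x $ i \<in> \<O>" "x $ m \<in> \<U>"
  shows "lower_block m x \<in> maximal_compact av (Suc m)" "row_mult (last_unit_vec (Suc m)) (lower_block m x) = x"
proof -
  define d where "d = inverse (x $ m)"
  \<comment> \<open>The last row of the inverse, found by solving \<open>lower_block_mult\<close>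
    for the last unit vector.\<close>
  define y where "y = vec (Suc m) (\<lambda>j. if j < m then - d * x $ j else d)"
  have d: "d \<in> \<U>" "x $ m * d = 1" "d * x $ m = 1"
    using units_closed(3,4)[OF x(3)] by (auto simp: d_def)
  have y: "y \<in> carrier_vec (Suc m)" "\<And>i. i < Suc m \<Longrightarrow> y $ i \<in> \<O>"
    using x(2) d(1) by (auto simp: y_def integers_closed)
  have "lower_block m x * lower_block m y = 1\<^sub>m (Suc m)"
    unfolding lower_block_mult[OF x(1) y(1)] lower_block_one[symmetric]
    by (rule arg_cong[of _ _ "lower_block m"], rule eq_vecI)
      (auto simp: y_def last_unit_vec_def d(2) less_Suc_eq simp flip: mult.assoc)
  moreover have "lower_block m y * lower_block m x = 1\<^sub>m (Suc m)"
    unfolding lower_block_mult[OF y(1) x(1)] lower_block_one[symmetric]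
    by (rule arg_cong[of _ _ "lower_block m"], rule eq_vecI)
      (auto simp: y_def last_unit_vec_def d(3) less_Suc_eq)
  ultimately show mem: "lower_block m x \<in> maximal_compact av (Suc m)"
    using integral_lower_block[OF x(2)] integral_lower_block[OF y(2)] by (auto simp: mem_K)
  note c = K_memD(1)[OF mem]
  show "row_mult (last_unit_vec (Suc m)) (lower_block m x) = x"
  proof (rule eq_vecI)
    fix i assume "i < dim_vec x"
    then show "row_mult (last_unit_vec (Suc m)) (lower_block m x) $ i = x $ i"
      using x(1) by (subst row_mult_last_unit_vec[OF c]) (auto simp: lower_block_entry)
  qed (use x(1) c in \<open>auto simp: row_mult_def\<close>)
qed

text \<open>A lower block works when the last entry is a unit. Otherwise some earlier entry is a
  unit, and adding it to the last entry by a unipotent upper block reduces to that case, since the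
  old last entry is strictly smaller.\<close>

lemma last_unit_vec_transitive:
  assumes "0 < n" "x \<in> sphere av n"
  shows "\<exists>k\<in>maximal_compact av n. row_mult (last_unit_vec n) k = x"
proof -
  obtain m where n: "n = Suc m" using assms(1) by (cases n) auto
  have x: "x \<in> carrier_vec (Suc m)" "\<And>i. i < Suc m \<Longrightarrow> x $ i \<in> \<O>"
    and ex: "\<exists>i<Suc m. x $ i \<in> \<U>"
    using assms(2) mem_sphere[of "Suc m" x] by (auto simp: n)
  show ?thesis
  proof (cases "x $ m \<in> \<U>")
    case True
    then show ?thesis using lower_block_mem[OF x] by (auto simp: n)
  next
    case False
    then obtain i where i: "i < m" "x $ i \<in> \<U>" using ex by (auto simp: less_Suc_eq)
    let ?u = "upper_block m (1\<^sub>m m) (\<lambda>l. if l = i then 1 else 0)"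
    have "?u \<in> mirabolic_compact av (Suc m)"
      by (intro upper_block_mirabolic K_closed(1)) (simp add: integers_closed)
    then have u: "?u \<in> maximal_compact av (Suc m)" by (rule mirabolic_subset)
    let ?y = "row_mult x ?u"
    have "(\<Sum>l<m. x $ l * (if l = i then 1 else 0)) = x $ i"
      using i(1) by (subst sum.cong[OF refl, of _ _ "\<lambda>l. if l = i then x $ l else 0"]) auto
    then have "?y $ m = x $ i + x $ m"
      using row_mult_upper_block[OF one_carrier_mat x(1), of m] by simp
    moreover have "av (x $ m) < av (x $ i)"
      using False x(2)[of m] i(2) by (auto simp: units_iff integers_iff)
    ultimately have "?y $ m \<in> \<U>" using av_add_less i(2) by (simp add: units_iff)
    moreover have "?y \<in> sphere av (Suc m)"
      using sphere_row_mult[OF _ _ u, of x] assms(2) by (simp add: n)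
    ultimately obtain k where k: "k \<in> maximal_compact av (Suc m)" "row_mult (last_unit_vec (Suc m)) k = ?y"
      using lower_block_mem[of ?y m] by (auto simp: mem_sphere)
    note c = K_memD(1)
    have "row_mult (last_unit_vec (Suc m)) (k * Kinv (Suc m) ?u) = row_mult ?y (Kinv (Suc m) ?u)"
      using row_mult_mult[OF c[OF k(1)] c[OF K_closed(3)[OF u]]] k(2) by simp
    also have "\<dots> = x"
      using row_mult_mult[OF c[OF u] c[OF K_closed(3)[OF u]] x(1)] x(1) K_closed(4)[OF u] by simp
    finally show ?thesis using k(1) u K_closed by (auto simp: n)
  qed
qed

lemma sphere_transitive:
  assumes "0 < n" "x \<in> sphere av n" "y \<in> sphere av n"
  shows "\<exists>k\<in>maximal_compact av n. row_mult x k = y"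
proof -
  obtain k h where k: "k \<in> maximal_compact av n" "row_mult (last_unit_vec n) k = x"
    and h: "h \<in> maximal_compact av n" "row_mult (last_unit_vec n) h = y"
    using last_unit_vec_transitive assms by metis
  note c = K_memD(1)
  have "row_mult x (Kinv n k * h) = row_mult (last_unit_vec n) (k * (Kinv n k * h))"
    using row_mult_mult[OF c[OF k(1)] c[OF K_closed(2)[OF K_closed(3)[OF k(1)] h(1)]]] k(2) by simp
  also have "\<dots> = y" using K_cancel(1)[OF k(1) h(1)] h(2) by simp
  finally show ?thesis using K_closed k(1) h(1) by blast
qed

text \<open>An upper block sends \<open>(x', d)\<close> to \<open>(x' a, x' \<beta> + d)\<close>.
  Dividing the first parts of \<open>x\<close> and \<open>y\<close> by \<open>unif ^ j\<close> gives
  points of the sphere in one dimension less, where \<open>sphere_transitive\<close> supplies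
  \<open>a\<close>; and \<open>x' \<beta>\<close> takes every value in \<open>\<pp> j\<close>, which
  supplies the change of the last entry.\<close>

lemma mirabolic_orbit:
  assumes m: "0 < m" and x: "x \<in> carrier_vec (Suc m)" and y: "y \<in> carrier_vec (Suc m)"
    and xj: "\<And>i. i < m \<Longrightarrow> x $ i \<in> \<pp> j" "\<exists>i<m. x $ i \<notin> \<pp> (Suc j)"
    and yj: "\<And>i. i < m \<Longrightarrow> y $ i \<in> \<pp> j" "\<exists>i<m. y $ i \<notin> \<pp> (Suc j)"
    and d: "y $ m - x $ m \<in> \<pp> j"
  shows "\<exists>k\<in>mirabolic_compact av (Suc m). row_mult x k = y"
proof -
  define s where "s z = vec m (\<lambda>i. z $ i / unif ^ j)" for z :: "'a vec"
  have u0: "unif ^ j \<noteq> 0" using unif_nonzero by simp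
  have s: "s z \<in> sphere av m" if "\<And>i. i < m \<Longrightarrow> z $ i \<in> \<pp> j" "\<exists>i<m. z $ i \<notin> \<pp> (Suc j)" for z
    using that q_pos m by (auto simp: mem_sphere s_def integers_iff units_iff av_divide av_unif_power
        mem_ideal_power[of _ j] ideal_power_Suc divide_le_eq not_less intro!: antisym)
  obtain a where a: "a \<in> maximal_compact av m" "row_mult (s x) a = s y"
    using sphere_transitive[OF m s[OF xj] s[OF yj]] by blast
  \<comment> \<open>A coordinate of exact absolute value \<open>(1 / q)^j\<close>: the difference of
    the last entries lies in \<open>\<pp> j\<close>, so its quotient by this coordinate is
    integral.\<close>
  obtain i0 where i0: "i0 < m" "av (x $ i0) = (1 / real q) ^ j"
    using xj unfolding ideal_power_Suc mem_ideal_power[of _ j] by (meson antisym not_less)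
  then have x0: "x $ i0 \<noteq> 0" using q_pos av_eq_0_iff[of "x $ i0"] by auto
  define \<beta> where "\<beta> i = (if i = i0 then (y $ m - x $ m) / x $ i0 else 0)" for i
  have "\<beta> i \<in> \<O>" for i
    using d i0(2) q_pos by (auto simp: \<beta>_def integers_iff av_divide mem_ideal_power divide_le_eq)
  then have k: "upper_block m a \<beta> \<in> mirabolic_compact av (Suc m)"
    using a(1) by (intro upper_block_mirabolic) auto
  note c = K_memD(1)[OF a(1)] and ck = K_memD(1)[OF mirabolic_subset[OF k]]
  have "row_mult x (upper_block m a \<beta>) = y"
  proof (rule eq_vecI)
    fix l assume "l < dim_vec y"
    then have l: "l < Suc m" using y by simp
    show "row_mult x (upper_block m a \<beta>) $ l = y $ l"
    proof (cases "l < m")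
      case True
      have "y $ l = unif ^ j * row_mult (s x) a $ l" unfolding a(2) using True u0 by (simp add: s_def)
      also have "\<dots> = (\<Sum>i<m. unif ^ j * (s x $ i * a $$ (i, l)))"
        using True by (subst row_mult_entry[OF c]) (auto simp: s_def sum_distrib_left)
      also have "\<dots> = (\<Sum>i<m. x $ i * a $$ (i, l))"
        using u0 by (intro sum.cong) (auto simp: s_def)
      finally show ?thesis using True l by (simp add: row_mult_upper_block[OF c x])
    next
      case False
      have "(\<Sum>i<m. x $ i * \<beta> i) = (\<Sum>i<m. if i = i0 then y $ m - x $ m else 0)"
        using x0 by (intro sum.cong) (auto simp: \<beta>_def)
      then show ?thesis using False l i0(1) by (simp add: row_mult_upper_block[OF c x] less_Suc_eq)
    qed
  qed (use y ck in \<open>auto simp: row_mult_def\<close>)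
  then show ?thesis using k by blast
qed

lemma mirabolic_last_row:
  assumes "k \<in> mirabolic_compact av n" "0 < n" "j < n"
  shows "k $$ (n - 1, j) = (if j = n - 1 then 1 else 0)"
proof -
  obtain a b where a: "a \<in> carrier_mat (n - 1) (n - 1)"
    and k: "k = four_block_mat a b (0\<^sub>m 1 (n - 1)) (1\<^sub>m 1)"
    using assms(1) by (auto simp: mirabolic_compact_def GL_def)
  then show ?thesis using assms(2,3) by auto
qed

section \<open>The subgroups \<open>K0\<close> and \<open>K1\<close> and the last row of a
  product\<close>

lemma mem_K0:
  "k \<in> K0 av n m \<longleftrightarrow> k \<in> maximal_compact av n \<and> (\<forall>j<n - 1. k $$ (n - 1, j) \<in> \<pp> m)"
  by (simp add: K0_def)

lemma mem_K1:
  "k \<in> K1 av n m \<longleftrightarrow> k \<in> K0 av n m \<and> k $$ (n - 1, n - 1) - 1 \<in> \<pp> m"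
  by (simp add: K1_def)

lemma K0_antimono: "m \<le> l \<Longrightarrow> K0 av n l \<subseteq> K0 av n m"
  using ideal_power_antimono[of m l] unfolding mem_K0 subset_iff by blast

lemma K0_zero: "0 < n \<Longrightarrow> K0 av n 0 = maximal_compact av n"
  using K_memD(4) by (auto simp: mem_K0 ideal_power_0)

lemma K1_zero: "0 < n \<Longrightarrow> K1 av n 0 = maximal_compact av n"
  using K_memD(4) by (auto simp: mem_K1 K0_zero ideal_power_0 integers_closed)

text \<open>The last row lies on the sphere, and at positive level its earlier entries are
  nonunits.\<close>

lemma K0_last_unit:
  assumes "k \<in> K0 av n m" "0 < m" "0 < n"
  shows "k $$ (n - 1, n - 1) \<in> \<U>"
proof -
  have k: "k \<in> maximal_compact av n" "\<And>j. j < n - 1 \<Longrightarrow> k $$ (n - 1, j) \<in> \<pp> 1"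
    using assms(1,2) ideal_power_antimono[of 1 m] by (auto simp: mem_K0)
  have "row_mult (last_unit_vec n) k \<in> sphere av n"
    using sphere_row_mult[OF assms(3) last_unit_vec_sphere[OF assms(3)] k(1)] .
  then obtain j where j: "j < n" "k $$ (n - 1, j) \<in> \<U>"
    using assms(3) by (auto simp: mem_sphere row_mult_last_unit_vec[OF K_memD(1)[OF k(1)]])
  then have "\<not> j < n - 1" using k(2)[of j] by (auto simp: ideal_power_Suc units_iff)
  then have "j = n - 1" using j(1) by simp
  then show ?thesis using j(2) by simp
qed

text \<open>Modulo \<open>\<pp> m\<close> the last row of \<open>k\<close> is concentrated in its
  final entry, so only the last row of \<open>h\<close> contributes. The group laws of
  \<open>K0\<close> and the multiplicativity of \<open>psi\<close> come from this
  congruence.\<close>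

lemma K0_mult_last_row:
  assumes "k \<in> K0 av n m" "h \<in> maximal_compact av n" "0 < n" "j < n"
  shows "(k * h) $$ (n - 1, j) - k $$ (n - 1, n - 1) * h $$ (n - 1, j) \<in> \<pp> m"
proof -
  have k: "k \<in> maximal_compact av n" using assms(1) by (simp add: mem_K0)
  obtain p where p: "n = Suc p" using assms(3) by (cases n) auto
  have "(k * h) $$ (n - 1, j) - k $$ (n - 1, n - 1) * h $$ (n - 1, j) = (\<Sum>l<p. k $$ (n - 1, l) * h $$ (l, j))"
    using assms by (subst mult_mat_entry[OF K_memD(1)[OF k] K_memD(1)[OF assms(2)]]) (auto simp: p)
  also have "\<dots> \<in> \<pp> m"
    by (intro ideal_power_sum ideal_power_mult(2) K_memD(4)[OF assms(2)]) (use assms in \<open>auto simp: mem_K0 p\<close>)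
  finally show ?thesis .
qed

lemma K0_mult:
  assumes "k \<in> K0 av n m" "h \<in> K0 av n m" "0 < n"
  shows "k * h \<in> K0 av n m"
proof -
  have k: "k \<in> maximal_compact av n" "h \<in> maximal_compact av n" using assms by (simp_all add: mem_K0)
  have "(k * h) $$ (n - 1, j) \<in> \<pp> m" if j: "j < n - 1" for j
  proof -
    have "k $$ (n - 1, n - 1) * h $$ (n - 1, j) \<in> \<pp> m"
      by (rule ideal_power_mult(1)[OF K_memD(4)[OF k(1)]]) (use assms j in \<open>auto simp: mem_K0\<close>)
    from ideal_power_add[OF K0_mult_last_row[OF assms(1) k(2) assms(3), of j] this] show ?thesis using j by simp
  qed
  then show ?thesis using k by (simp add: mem_K0 K_closed)
qed

text \<open>At positive level the final entry of \<open>k\<close> is a unit and can be cancelled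
  from the last row of \<open>k k^-1 = 1\<close>; at level 0 the group is all of
  \<open>K\<close>.\<close>

lemma K0_inv:
  assumes "k \<in> K0 av n m" "0 < n"
  shows "Kinv n k \<in> K0 av n m"
proof (cases m)
  case 0
  then show ?thesis using assms by (simp add: K0_zero K_closed)
next
  case (Suc l)
  have k: "k \<in> maximal_compact av n" using assms by (simp add: mem_K0)
  note u = K0_last_unit[OF assms(1) _ assms(2)]
  have "Kinv n k $$ (n - 1, j) \<in> \<pp> m" if j: "j < n - 1" for j
  proof -
    have "- (k $$ (n - 1, n - 1) * Kinv n k $$ (n - 1, j)) \<in> \<pp> m"
      using K0_mult_last_row[OF assms(1) K_closed(3)[OF k] assms(2), of j] j by (simp add: K_closed(4)[OF k])
    then show ?thesis using u Suc by (simp add: mem_ideal_power av_mult units_iff)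
  qed
  then show ?thesis using k by (simp add: mem_K0 K_closed)
qed

lemma K0_mult_iff:
  assumes "k \<in> K0 av n m" "h \<in> maximal_compact av n" "0 < n"
  shows "k * h \<in> K0 av n m \<longleftrightarrow> h \<in> K0 av n m"
proof
  have k: "k \<in> maximal_compact av n" using assms by (simp add: mem_K0)
  assume "k * h \<in> K0 av n m"
  from K0_mult[OF K0_inv[OF assms(1,3)] this assms(3)] show "h \<in> K0 av n m"
    by (simp add: K_cancel[OF k assms(2)])
qed (use K0_mult assms in auto)

lemma K1_mult_last_row:
  assumes "k \<in> K1 av n m" "h \<in> maximal_compact av n" "0 < n" "j < n"
  shows "(k * h) $$ (n - 1, j) - h $$ (n - 1, j) \<in> \<pp> m"
proof -
  have k: "k \<in> K0 av n m" "k $$ (n - 1, n - 1) - 1 \<in> \<pp> m" using assms(1) by (auto simp: mem_K1)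
  have "(k $$ (n - 1, n - 1) - 1) * h $$ (n - 1, j) \<in> \<pp> m"
    by (rule ideal_power_mult(2)[OF K_memD(4)[OF assms(2)] k(2)]) (use assms in auto)
  from ideal_power_add[OF K0_mult_last_row[OF k(1) assms(2-4)] this] show ?thesis by (simp add: algebra_simps)
qed

lemma K1_mult_iff:
  assumes "k \<in> K1 av n m" "h \<in> maximal_compact av n" "0 < n"
  shows "k * h \<in> K1 av n m \<longleftrightarrow> h \<in> K1 av n m"
proof -
  have k: "k \<in> K0 av n m" using assms(1) by (simp add: mem_K1)
  have "(k * h) $$ (n - 1, n - 1) - 1 \<in> \<pp> m \<longleftrightarrow> h $$ (n - 1, n - 1) - 1 \<in> \<pp> m"
    using K1_mult_last_row[OF assms, of "n - 1"] assms(3) by (intro ideal_power_diff_cong) simp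
  then show ?thesis using K0_mult_iff[OF k assms(2,3)] by (simp add: mem_K1)
qed

lemma N_subset_K1: "0 < n \<Longrightarrow> principal_congruence av n m \<subseteq> K1 av n m"
  unfolding principal_congruence_eq mem_K1 mem_K0 subset_iff mcong_def by (auto dest!: spec[of _ "n - 1"])

lemma N_antimono: "m \<le> l \<Longrightarrow> principal_congruence av n l \<subseteq> principal_congruence av n m"
  using ideal_power_antimono[of m l] by (auto simp: principal_congruence_eq mcong_def)

lemma mirabolic_subset_K1: "0 < n \<Longrightarrow> mirabolic_compact av n \<subseteq> K1 av n m"
  using mirabolic_last_row[of _ n] by (auto simp: mem_K1 mem_K0 mirabolic_subset)

lemma scalar_mem_K:
  assumes "a \<in> \<U>"
  shows "a \<cdot>\<^sub>m 1\<^sub>m n \<in> maximal_compact av n"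
proof -
  have "integral_mat n (b \<cdot>\<^sub>m 1\<^sub>m n)" if "b \<in> \<U>" for b
    using integers_closed(1) integers_closed(7)[OF that] by (simp add: integral_mat_def)
  moreover have "(a \<cdot>\<^sub>m 1\<^sub>m n) * (b \<cdot>\<^sub>m 1\<^sub>m n) = (a * b) \<cdot>\<^sub>m 1\<^sub>m n" for a b :: 'a
    by (rule eq_matI) auto
  moreover have "1 \<cdot>\<^sub>m 1\<^sub>m n = (1\<^sub>m n :: 'a mat)" by (rule eq_matI) auto
  ultimately show ?thesis
    using units_closed(3,4)[OF assms] assms
    by (auto simp: mem_K intro!: exI[of _ "inverse a \<cdot>\<^sub>m 1\<^sub>m n"])
qed

text \<open>Dividing by the final entry, a unit because the level is positive, leaves a matrix in
  \<open>K1\<close>. An action of \<open>K0\<close> thereby splits into a central character and an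
  invariance under \<open>K1\<close>.\<close>

lemma K0_decompose:
  assumes "k \<in> K0 av n m" "0 < m" "0 < n"
  obtains h where "h \<in> K1 av n m" "k = k $$ (n - 1, n - 1) \<cdot>\<^sub>m h"
    "k = (k $$ (n - 1, n - 1) \<cdot>\<^sub>m 1\<^sub>m n) * h"
proof
  let ?d = "k $$ (n - 1, n - 1)" let ?h = "(inverse ?d \<cdot>\<^sub>m 1\<^sub>m n) * k"
  have k: "k \<in> maximal_compact av n" using assms by (simp add: mem_K0)
  note u = K0_last_unit[OF assms] note c = K_memD(1)[OF k]
  have e: "?h $$ (i, j) = inverse ?d * k $$ (i, j)" if "i < n" "j < n" for i j
    using that c by simp
  have "?h \<in> maximal_compact av n"
    by (intro K_closed(2) scalar_mem_K units_closed(3) u k)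
  then show "?h \<in> K1 av n m"
    using assms u units_closed(3,4)[OF u] ideal_power_mult(1)[OF integers_closed(7)[OF units_closed(3)[OF u]]]
    by (auto simp: mem_K1 mem_K0 e simp del: index_mult_mat One_nat_def)
  show d: "k = ?d \<cdot>\<^sub>m ?h" by (rule eq_matI) (use c units_closed(4)[OF u] in auto)
  have h: "?h \<in> carrier_mat n n" by (rule mult_carrier_mat[OF smult_carrier_mat[OF one_carrier_mat] c])
  show "k = (?d \<cdot>\<^sub>m 1\<^sub>m n) * ?h"
    unfolding mult_smult_assoc_mat[OF one_carrier_mat h] left_mult_one_mat[OF h] by (rule d)
qed

section \<open>Topology and Haar measure\<close>

lemma metric_space_av: "Metric_space UNIV (\<lambda>x y. av (x - y))"
proof
  fix x y z :: 'a
  show "av (x - z) \<le> av (x - y) + av (y - z)"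
    using av_ultrametric[of "x - y" "y - z"] av_nonneg[of "x - y"] av_nonneg[of "y - z"] by simp
qed (auto simp: av_nonneg av_eq_0_iff av_diff_commute)

lemma openin_ideal_power_coset: "openin (field_topology av) {y. y - x \<in> \<pp> m}"
proof -
  interpret Metric_space UNIV "\<lambda>x y. av (x - y)" by (rule metric_space_av)
  have "\<exists>r>0. mball y r \<subseteq> {y. y - x \<in> \<pp> m}" if y: "y - x \<in> \<pp> m" for y
  proof (intro exI conjI subsetI)
    show "0 < (1 / real q) ^ m" using q_pos by simp
    fix z assume "z \<in> mball y ((1 / real q) ^ m)"
    then have "y - z \<in> \<pp> m" by (simp add: mem_ideal_power)
    then show "z \<in> {y. y - x \<in> \<pp> m}"
      using y ideal_power_diff_trans ideal_power_diff_commute by blast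
  qed
  then show ?thesis unfolding field_topology_def openin_mtopology by blast
qed

lemma openin_pullback_PiE:
  assumes "finite I"
  shows "openin (pullback_topology A f (product_topology (\<lambda>_. field_topology av) I))
    {x \<in> A. f x \<in> PiE I (\<lambda>i. {y. y - c i \<in> \<pp> m})}"
  unfolding openin_pullback_topology
  using assms openin_ideal_power_coset
  by (intro exI[of _ "PiE I (\<lambda>i. {y. y - c i \<in> \<pp> m})"]) (auto simp: openin_PiE_gen)

lemma openin_sphere_cong:
  "openin (sphere_topology av n) {y \<in> sphere av n. \<forall>i<n. y $ i - x $ i \<in> \<pp> m}"
proof -
  have "{y \<in> sphere av n. \<forall>i<n. y $ i - x $ i \<in> \<pp> m} =
      {y \<in> sphere av n. (\<lambda>i\<in>{..<n}. y $ i) \<in> PiE {..<n} (\<lambda>i. {z. z - x $ i \<in> \<pp> m})}"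
    by auto
  then show ?thesis unfolding sphere_topology_def by (simp only: openin_pullback_PiE finite_lessThan)
qed

lemma openin_GL_mcong: "openin (GL_topology av n) {g \<in> GL n UNIV. mcong n m g k}"
proof -
  have "{g \<in> GL n UNIV. mcong n m g k} = {g \<in> GL n UNIV.
      (\<lambda>(i, j)\<in>{..<n} \<times> {..<n}. g $$ (i, j)) \<in> PiE ({..<n} \<times> {..<n}) (\<lambda>ij. {z. z - k $$ ij \<in> \<pp> m})}"
    by (auto simp: mcong_def restrict_PiE_iff)
  then show ?thesis
    unfolding GL_topology_def by (simp only: openin_pullback_PiE finite_lessThan finite_cartesian_product)
qed

text \<open>Let \<open>M\<close> be the largest absolute value of an entry of the inverse
  \<open>h\<close>. The identity \<open>(1 - g) h = h - 1\<close> bounds the entries of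
  \<open>h - 1\<close> by \<open>M / q\<close> if \<open>M > 1\<close>, so no entry of
  \<open>h\<close> could have absolute value \<open>M\<close>. The lemma makes the congruence
  subgroups of positive level open in the full general linear group.\<close>

lemma GL_mcong_one:
  assumes g: "g \<in> GL n UNIV" "mcong n m g (1\<^sub>m n)" and m: "0 < m" and n: "0 < n"
  shows "g \<in> maximal_compact av n"
proof -
  obtain h where h: "h \<in> carrier_mat n n" "g * h = 1\<^sub>m n" "h * g = 1\<^sub>m n" and gc: "g \<in> carrier_mat n n"
    using g(1) by (auto simp: GL_def)
  have int1: "(1\<^sub>m n :: 'a mat) $$ (i, j) \<in> \<O>" if "i < n" "j < n" for i j
    using that by (simp add: integers_closed)
  have "g $$ (i, j) \<in> \<O>" if "i < n" "j < n" for i j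
    using integers_closed(3)[OF ideal_power_integers[OF mcongD[OF g(2) that]] int1[OF that]] by simp
  then have gi: "integral_mat n g" using gc by (simp add: integral_mat_def)
  define M where "M = Max ((\<lambda>(i, j). av (h $$ (i, j))) ` ({..<n} \<times> {..<n}))"
  have M: "av (h $$ (i, j)) \<le> M" if "i < n" "j < n" for i j
    unfolding M_def using that by (intro Max_ge) auto
  have "M \<in> (\<lambda>(i, j). av (h $$ (i, j))) ` ({..<n} \<times> {..<n})"
    unfolding M_def using n by (intro Max_in) auto
  then obtain i j where ij: "i < n" "j < n" "av (h $$ (i, j)) = M" by auto
  have "M \<le> 1"
  proof (rule ccontr)
    assume "\<not> M \<le> 1"
    then have M1: "1 < M" by simp
    have "(\<Sum>l<n. (1\<^sub>m n $$ (i, l) - g $$ (i, l)) * h $$ (l, j)) = h $$ (i, j) - 1\<^sub>m n $$ (i, j)"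
    proof -
      have "(\<Sum>l<n. (1\<^sub>m n $$ (i, l) - g $$ (i, l)) * h $$ (l, j)) = (1\<^sub>m n * h) $$ (i, j) - (g * h) $$ (i, j)"
        unfolding mult_mat_entry[OF one_carrier_mat h(1) ij(1,2)] mult_mat_entry[OF gc h(1) ij(1,2)] sum_subtractf[symmetric]
        by (intro sum.cong) (auto simp: algebra_simps)
      then show ?thesis by (simp add: h(2) left_mult_one_mat[OF h(1)])
    qed
    moreover have "av (\<Sum>l<n. (1\<^sub>m n $$ (i, l) - g $$ (i, l)) * h $$ (l, j)) \<le> M / real q"
    proof (rule av_sum_le)
      fix l assume "l \<in> {..<n}"
      then have l: "l < n" by simp
      have "g $$ (i, l) - 1\<^sub>m n $$ (i, l) \<in> \<pp> 1"
        using mcongD[OF g(2) ij(1) l] ideal_power_antimono[of 1 m] m by auto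
      then have "av (1\<^sub>m n $$ (i, l) - g $$ (i, l)) \<le> 1 / real q"
        by (simp add: mem_ideal_power av_diff_commute)
      then have "av (1\<^sub>m n $$ (i, l) - g $$ (i, l)) * av (h $$ (l, j)) \<le> 1 / real q * M"
        using M[OF l ij(2)] by (intro mult_mono) (auto simp: av_nonneg)
      then show "av ((1\<^sub>m n $$ (i, l) - g $$ (i, l)) * h $$ (l, j)) \<le> M / real q" by (simp add: av_mult)
    qed (use M1 in simp)
    moreover have "M / real q < M" using M1 q_gt_1 by (simp add: divide_less_eq)
    moreover have "av ((1\<^sub>m n :: 'a mat) $$ (i, j)) \<le> 1" using int1[OF ij(1,2)] by (simp only: integers_iff)
    ultimately have "M < M"
      using av_ultrametric[of "h $$ (i, j) - 1\<^sub>m n $$ (i, j)" "1\<^sub>m n $$ (i, j)"] ij(3) M1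
      by (simp del: index_one_mat)
    then show False by simp
  qed
  then have "integral_mat n h"
    using M h(1) by (auto simp: integral_mat_def integers_iff intro: order_trans)
  then show ?thesis using gi h by (auto simp: mem_K)
qed

lemma openin_principal_congruence:
  assumes "0 < m" "0 < n"
  shows "openin (GL_topology av n) (principal_congruence av n m)"
proof -
  have "principal_congruence av n m = {g \<in> GL n UNIV. mcong n m g (1\<^sub>m n)}"
    using GL_mcong_one[OF _ _ assms] K_memD(3) by (auto simp: principal_congruence_eq)
  then show ?thesis using openin_GL_mcong by simp
qed

lemma subgroup_principal_congruence: "subgroup (principal_congruence av n m) (GL_group n)"
  using group.incl_subgroup[OF group_GL_group subgroup_maximal_compact, of "principal_congruence av n m" n]
    normal_imp_subgroup[OF normal_N, of n m] by (simp add: Kgrp_def)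

section \<open>Haar integrals as finite sums over cosets\<close>

abbreviation Ksum :: "nat \<Rightarrow> nat \<Rightarrow> ('a mat \<Rightarrow> 'b::comm_monoid_add) \<Rightarrow> 'b" where
  "Ksum n m \<equiv> coset_sum (Kgrp n) (principal_congruence av n m)"

definition Kinvariant :: "nat \<Rightarrow> nat \<Rightarrow> ('a mat \<Rightarrow> 'b) \<Rightarrow> bool" where
  "Kinvariant n m f \<longleftrightarrow> (\<forall>k\<in>maximal_compact av n. \<forall>h\<in>principal_congruence av n m. f (k * h) = f k)"

lemma Ksum_mult_right:
  "Kinvariant n m f \<Longrightarrow> x \<in> maximal_compact av n \<Longrightarrow> Ksum n m (\<lambda>k. f (k * x)) = Ksum n m f"
  using normal.coset_sum_mult_right[OF normal_N, of n m f x] by (simp add: Kinvariant_def)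

lemma Ksum_mult_left:
  "Kinvariant n m f \<Longrightarrow> x \<in> maximal_compact av n \<Longrightarrow> Ksum n m (\<lambda>k. f (x * k)) = Ksum n m f"
  using normal.coset_sum_mult_left[OF normal_N, of n m f x] by (simp add: Kinvariant_def)

lemma Ksum_cong:
  "(\<And>k. k \<in> maximal_compact av n \<Longrightarrow> f k = g k) \<Longrightarrow> Ksum n m f = Ksum n m g"
  using normal.coset_sum_cong[OF normal_N, of n f g m] by simp

text \<open>The integrand is a finite combination of indicators of cosets. These are open, hence
  measurable, and by normality they are left translates of the subgroup, hence of equal
  measure.\<close>

lemma haar_integral_eq_Ksum:
  fixes f :: "'a mat \<Rightarrow> complex"
  assumes dk: "haar_probability av n dk" and f: "Kinvariant n m f"
  shows "(\<integral>k. f k \<partial>dk) = complex_of_real (measure dk (principal_congruence av n m)) * Ksum n m f"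
proof -
  interpret dk: prob_space dk using dk by (simp add: haar_probability_def)
  interpret N: normal "principal_congruence av n m" "Kgrp n" by (rule normal_N)
  let ?N = "principal_congruence av n m" and ?K = "maximal_compact av n" and ?Q = "rcosets\<^bsub>Kgrp n\<^esub> (principal_congruence av n m)"
  let ?T = "subtopology (GL_topology av n) ?K"
  have sp: "space dk = ?K" "sets dk = sigma_sets (topspace ?T) {U. openin ?T U}"
    and inv: "\<And>g A. g \<in> ?K \<Longrightarrow> A \<in> sets dk \<Longrightarrow> emeasure dk (g <#\<^bsub>Kgrp n\<^esub> A) = emeasure dk A"
    using dk by (auto simp: haar_probability_def haar_measure_def Kgrp_def)
  have cos: "{l \<in> ?K. mcong n m l k} \<in> sets dk" for k
  proof -
    have "openin ?T (?K \<inter> {g \<in> GL n UNIV. mcong n m g k})"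
      by (rule openin_subtopology_Int2[OF openin_GL_mcong])
    moreover have "?K \<inter> {g \<in> GL n UNIV. mcong n m g k} = {l \<in> ?K. mcong n m l k}"
      using K_memD(3) by auto
    ultimately show ?thesis by (auto simp: sp(2) intro: sigma_sets.Basic)
  qed
  have C: "C \<in> sets dk" "measure dk C = measure dk ?N" if "C \<in> ?Q" for C
  proof -
    obtain k where k: "k \<in> ?K" "C = ?N #>\<^bsub>Kgrp n\<^esub> k" using \<open>C \<in> ?Q\<close> by (auto simp: RCOSETS_def)
    then show "C \<in> sets dk" using cos by (simp add: rcoset_N)
    have "C = k <#\<^bsub>Kgrp n\<^esub> ?N" using k N.coset_eq by simp
    moreover have "?N \<in> sets dk" using cos[of "1\<^sub>m n"] by (simp add: principal_congruence_eq)
    ultimately show "measure dk C = measure dk ?N" using inv[OF k(1)] by (simp add: measure_def)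
  qed
  have "(\<integral>k. f k \<partial>dk) = (\<integral>k. (\<Sum>C\<in>?Q. indicator C k *\<^sub>R f (SOME k. k \<in> C)) \<partial>dk)"
  proof (rule Bochner_Integration.integral_cong[OF refl])
    fix k assume "k \<in> space dk"
    then have k: "k \<in> carrier (Kgrp n)" by (simp add: sp)
    let ?C = "?N #>\<^bsub>Kgrp n\<^esub> k"
    have CQ: "?C \<in> ?Q" using N.rcosetsI[OF N.subset k] .
    have kC: "k \<in> ?C" using N.rcos_self[OF k N.subgroup_axioms] .
    have "indicator D k *\<^sub>R f (SOME k. k \<in> D) = (if D = ?C then f k else 0)" if D: "D \<in> ?Q" for D
    proof (cases "k \<in> D")
      case True
      then have "D = ?C" using N.rcos_disjoint[OF N.subgroup_axioms] D CQ kC by (auto simp: pairwise_def disjnt_def)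
      moreover have "f (SOME k. k \<in> D) = f k"
        by (rule N.invariant_on_coset[OF _ D N.some_in_rcoset(1)[OF D] True]) (use f in \<open>auto simp: Kinvariant_def\<close>)
      ultimately show ?thesis using True by simp
    next
      case False
      then show ?thesis using kC by auto
    qed
    then have "(\<Sum>D\<in>?Q. indicator D k *\<^sub>R f (SOME k. k \<in> D)) = (\<Sum>D\<in>?Q. if D = ?C then f k else 0)"
      by (rule sum.cong[OF refl])
    then show "f k = (\<Sum>D\<in>?Q. indicator D k *\<^sub>R f (SOME k. k \<in> D))"
      using CQ finite_rcosets_N[of n m] by simp
  qed
  also have "\<dots> = (\<Sum>C\<in>?Q. (\<integral>k. indicator C k *\<^sub>R f (SOME k. k \<in> C) \<partial>dk))"
    using C by (intro Bochner_Integration.integral_sum integrable_scaleR_left) (auto simp: integrable_indicator_iff dk.emeasure_eq_measure)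
  also have "\<dots> = (\<Sum>C\<in>?Q. measure dk C *\<^sub>R f (SOME k. k \<in> C))"
    using C by (intro sum.cong refl, subst integral_scaleR_left)
      (auto simp: integrable_indicator_iff dk.emeasure_eq_measure)
  also have "\<dots> = complex_of_real (measure dk ?N) * Ksum n m f"
    using C by (simp add: coset_sum_def sum_distrib_left scaleR_conv_of_real)
  finally show ?thesis .
qed

text \<open>The subgroup is open in \<open>K\<close> and nonempty. Positivity lets the constant of
  \<open>haar_integral_eq_Ksum\<close> be cancelled when orthogonality is tested.\<close>

lemma haar_measure_N_pos:
  assumes dk: "haar_probability av n dk"
  shows "0 < measure dk (principal_congruence av n m)"
proof -
  interpret dk: prob_space dk using dk by (simp add: haar_probability_def)
  let ?N = "principal_congruence av n m" and ?K = "maximal_compact av n"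
  let ?T = "subtopology (GL_topology av n) ?K"
  have "openin ?T (?K \<inter> {g \<in> GL n UNIV. mcong n m g (1\<^sub>m n)})"
    by (rule openin_subtopology_Int2[OF openin_GL_mcong])
  moreover have "?K \<inter> {g \<in> GL n UNIV. mcong n m g (1\<^sub>m n)} = ?N"
    using K_memD(3) by (auto simp: principal_congruence_eq)
  ultimately have "openin ?T ?N" by simp
  moreover have "?N \<noteq> {}" using K_closed(1)[of n] mcong_refl by (auto simp: principal_congruence_eq)
  ultimately have "0 < emeasure dk ?N" using dk by (auto simp: haar_probability_def haar_measure_def)
  then show ?thesis by (simp add: dk.emeasure_eq_measure)
qed

end

section \<open>Equivariant functions on the sphere\<close>

text \<open>\<chi> is a character on the units only. Triviality at level \<open>c\<close> expresses
  its continuity and bounds its conductor by \<open>c\<close>, which will be the conductor exponent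
  of the representation.\<close>

locale sphere_character = nonarchimedean_local_field av for av :: "'a::field \<Rightarrow> real" +
  fixes n c :: nat and \<chi> :: "'a \<Rightarrow> complex"
  assumes n_ge_2: "2 \<le> n"
    and chi_one: "\<chi> 1 = 1"
    and chi_mult: "a \<in> integer_units av \<Longrightarrow> b \<in> integer_units av \<Longrightarrow> \<chi> (a * b) = \<chi> a * \<chi> b"
    and chi_trivial: "a \<in> integer_units av \<Longrightarrow> a - 1 \<in> ideal_power av c \<Longrightarrow> \<chi> a = 1"
begin

lemma n_pos: "0 < n" "n - 1 < n" using n_ge_2 by auto

abbreviation K :: "'a mat set" where "K \<equiv> maximal_compact av n"
abbreviation N :: "nat \<Rightarrow> 'a mat set" where "N \<equiv> principal_congruence av n"
abbreviation cd :: nat where "cd \<equiv> char_conductor av \<chi>"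
abbreviation \<F> :: "nat \<Rightarrow> ('a vec \<Rightarrow> complex) set" where "\<F> \<equiv> invariant_functions av n \<chi>"
abbreviation lastrow :: "'a mat \<Rightarrow> 'a vec" where "lastrow k \<equiv> row_mult (last_unit_vec n) k"

text \<open>Reading the entry through \<open>char_value\<close> makes this identically 1 when \<chi>
  is trivial on the units. It is thus a character of \<open>K0 av n m\<close> for every
  \<open>m \<ge> cd\<close>, even at level 0, where the entry may be a nonunit.\<close>

definition psi :: "'a mat \<Rightarrow> complex" where "psi k = char_value av \<chi> (k $$ (n - 1, n - 1))"

lemma cd_le: "cd \<le> c"
  unfolding char_conductor_def using chi_trivial by (intro Least_le) blast

lemma chi_trivial_cd: "a \<in> \<U> \<Longrightarrow> a - 1 \<in> \<pp> m \<Longrightarrow> cd \<le> m \<Longrightarrow> \<chi> a = 1"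
proof -
  assume a: "a \<in> \<U>" "a - 1 \<in> \<pp> m" "cd \<le> m"
  have "\<forall>a\<in>\<U>. a - 1 \<in> \<pp> cd \<longrightarrow> \<chi> a = 1"
    unfolding char_conductor_def by (rule LeastI[of _ c]) (use chi_trivial in blast)
  then show ?thesis using a ideal_power_antimono[of cd m] by blast
qed

lemma chi_nontrivial_below_cd:
  assumes "j < cd"
  obtains a where "a \<in> \<U>" "a - 1 \<in> \<pp> j" "\<chi> a \<noteq> 1"
  using not_less_Least[OF assms[unfolded char_conductor_def]] that by blast

lemma chi_all_trivial_iff: "(\<forall>a\<in>\<U>. \<chi> a = 1) \<longleftrightarrow> cd = 0"
proof
  assume "\<forall>a\<in>\<U>. \<chi> a = 1"
  then show "cd = 0" using chi_nontrivial_below_cd[of 0] by blast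
next
  assume "cd = 0"
  then show "\<forall>a\<in>\<U>. \<chi> a = 1"
    using chi_trivial_cd[of _ 0] integers_closed(2,4,7) by (auto simp: ideal_power_0)
qed

lemma char_value_eq: "char_value av \<chi> a = (if cd = 0 then 1 else \<chi> a)"
  by (simp add: char_value_def chi_all_trivial_iff)

lemma char_value_unit: "a \<in> \<U> \<Longrightarrow> char_value av \<chi> a = \<chi> a"
  using chi_all_trivial_iff by (auto simp: char_value_def)

lemma chi_cong:
  assumes "a \<in> \<U>" "b \<in> \<U>" "a - b \<in> \<pp> m" "cd \<le> m"
  shows "\<chi> a = \<chi> b"
proof -
  note b' = units_closed(3)[OF assms(2)]
  have b0: "b \<noteq> 0" using units_closed(4)[OF assms(2)] .
  have u: "inverse b * a \<in> \<U>" using units_closed(2)[OF b' assms(1)] .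
  have "inverse b * a - 1 = inverse b * (a - b)" using b0 by (simp add: algebra_simps)
  then have "inverse b * a - 1 \<in> \<pp> m"
    using ideal_power_mult(1)[OF integers_closed(7)[OF b'] assms(3)] by simp
  then have "\<chi> (inverse b * a) = 1" using chi_trivial_cd u assms(4) by blast
  then show ?thesis using chi_mult[OF assms(2) u] b0 by (simp flip: mult.assoc)
qed

text \<open>Some positive power of \<open>a\<close> is congruent to 1 modulo \<open>\<pp> c\<close>,
  so \<open>\<chi> a\<close> is a root of unity.\<close>

lemma norm_chi: "a \<in> \<U> \<Longrightarrow> cmod (\<chi> a) = 1"
proof -
  assume a: "a \<in> \<U>"
  obtain j where j: "0 < j" "a ^ j - 1 \<in> \<pp> c" using unit_power_cong_1[OF a] .
  have "\<chi> (a ^ i) = \<chi> a ^ i" for i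
    by (induction i) (simp_all add: chi_one chi_mult units_closed(5)[OF a] a)
  then have "\<chi> a ^ j = 1" using chi_trivial[OF units_closed(5)[OF a] j(2)] by simp
  then have "cmod (\<chi> a) ^ j = 1" by (metis norm_one norm_power)
  then show "cmod (\<chi> a) = 1" using power_eq_imp_eq_base[of "cmod (\<chi> a)" j 1] j(1) by simp
qed

lemma psi_mult:
  assumes k: "k \<in> K0 av n m" and h: "h \<in> K0 av n m" and m: "cd \<le> m"
  shows "psi (k * h) = psi k * psi h"
proof (cases "cd = 0")
  case False
  then have m0: "0 < m" using m by simp
  have hK: "h \<in> K" using h by (simp add: mem_K0)
  note u = K0_last_unit[OF k m0 n_pos(1)] K0_last_unit[OF h m0 n_pos(1)]
    K0_last_unit[OF K0_mult[OF k h n_pos(1)] m0 n_pos(1)]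
  show ?thesis
    using chi_mult[OF u(1,2)] chi_cong[OF u(3) units_closed(2)[OF u(1,2)] K0_mult_last_row[OF k hK n_pos] m] False
    by (simp add: psi_def char_value_eq)
qed (simp add: psi_def char_value_eq)

lemma psi_unit:
  assumes k: "k \<in> K0 av n m" and m: "cd \<le> m"
  shows "cmod (psi k) = 1" "psi k * cnj (psi k) = 1"
proof -
  show "cmod (psi k) = 1"
  proof (cases "cd = 0")
    case False
    then show ?thesis using K0_last_unit[OF k _ n_pos(1)] norm_chi m by (simp add: psi_def char_value_eq)
  qed (simp add: psi_def char_value_eq)
  then show "psi k * cnj (psi k) = 1" using complex_norm_square[of "psi k"] by simp
qed

lemma psi_K1:
  assumes k: "k \<in> K1 av n m" and m: "cd \<le> m"
  shows "psi k = 1"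
proof (cases "cd = 0")
  case False
  then show ?thesis using K0_last_unit[of k n m] n_pos chi_trivial_cd[of "k $$ (n - 1, n - 1)" m] m k
    by (auto simp: psi_def char_value_eq mem_K1)
qed (simp add: psi_def char_value_eq)

lemma lastrow_sphere: "k \<in> K \<Longrightarrow> lastrow k \<in> sphere av n"
  using sphere_row_mult last_unit_vec_sphere n_pos by blast

lemma lastrow_surj: "x \<in> sphere av n \<Longrightarrow> \<exists>k\<in>K. lastrow k = x"
  using last_unit_vec_transitive n_pos by blast

lemma lastrow_mult: "k \<in> K \<Longrightarrow> h \<in> K \<Longrightarrow> lastrow (k * h) = row_mult (lastrow k) h"
  using row_mult_mult K_memD(1) last_unit_vec_carrier by blast

lemma lastrow_entry: "k \<in> K \<Longrightarrow> j < n \<Longrightarrow> lastrow k $ j = k $$ (n - 1, j)"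
  using row_mult_last_unit_vec K_memD(1) n_pos by blast

lemma lastrow_one: "lastrow (1\<^sub>m n) = last_unit_vec n"
  by simp

text \<open>The last row of \<open>k h^-1\<close> is congruent to that of \<open>h h^-1 = 1\<close>.
  Together with \<open>K1_mult_last_row\<close>, last rows modulo \<open>\<pp> m\<close> classify
  the right cosets of \<open>K1 av n m\<close>.\<close>

lemma lastrow_cong_K1:
  assumes "k \<in> K" "h \<in> K"
    and "\<And>j. j < n \<Longrightarrow> lastrow k $ j - lastrow h $ j \<in> \<pp> m"
  shows "k * Kinv n h \<in> K1 av n m"
proof -
  note hi = K_closed(3)[OF assms(2)] and c = K_memD(1)
  have "(k * Kinv n h) $$ (n - 1, j) - 1\<^sub>m n $$ (n - 1, j) \<in> \<pp> m" if "j < n" for j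
  proof -
    have "(k * Kinv n h) $$ (n - 1, j) - (h * Kinv n h) $$ (n - 1, j)
        = (\<Sum>l<n. (lastrow k $ l - lastrow h $ l) * Kinv n h $$ (l, j))"
      unfolding mult_mat_entry[OF c[OF assms(1)] c[OF hi] n_pos(2) that]
        mult_mat_entry[OF c[OF assms(2)] c[OF hi] n_pos(2) that] sum_subtractf[symmetric]
      by (intro sum.cong) (auto simp: lastrow_entry assms left_diff_distrib)
    also have "\<dots> \<in> \<pp> m"
      by (intro ideal_power_sum ideal_power_mult(2) K_memD(4)[OF hi] assms(3)) (use that in auto)
    finally show ?thesis by (simp add: K_closed(4)[OF assms(2)])
  qed
  note e = this
  show ?thesis unfolding mem_K1 mem_K0
  proof (intro conjI allI impI)
    show "k * Kinv n h \<in> K" using assms(1) hi by (rule K_closed)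
    show "(k * Kinv n h) $$ (n - 1, n - 1) - 1 \<in> \<pp> m"
      using e[of "n - 1"] n_pos by simp
    fix j assume "j < n - 1"
    then show "(k * Kinv n h) $$ (n - 1, j) \<in> \<pp> m" using e[of j] by simp
  qed
qed

section \<open>Functions on the sphere as equivariant functions on K\<close>

definition equivariant :: "nat \<Rightarrow> ('a mat \<Rightarrow> complex) \<Rightarrow> bool" where
  "equivariant m F \<longleftrightarrow> (\<forall>k0\<in>K0 av n m. \<forall>k\<in>K. F (k0 * k) = psi k0 * F k)"

text \<open>Descent along \<open>lastrow\<close> by choosing a preimage;
  \<open>sphere_lift_lastrow\<close> shows that the choice is harmless for equivariant
  \<open>F\<close>. Membership in the function spaces, local constancy included, is obtained by
  descending from \<open>K\<close>.\<close>

definition sphere_lift :: "('a mat \<Rightarrow> complex) \<Rightarrow> 'a vec \<Rightarrow> complex" where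
  "sphere_lift F x = (if x \<in> sphere av n then F (SOME k. k \<in> K \<and> lastrow k = x) else 0)"

lemma equivariant_lastrow_cong:
  assumes F: "equivariant m F" and m: "cd \<le> m" and "k \<in> K" "h \<in> K"
    and "\<And>j. j < n \<Longrightarrow> lastrow k $ j - lastrow h $ j \<in> \<pp> m"
  shows "F k = F h"
proof -
  have 1: "k * Kinv n h \<in> K1 av n m" using assms by (intro lastrow_cong_K1)
  then have "F (k * Kinv n h * h) = psi (k * Kinv n h) * F h"
    using F assms by (auto simp: equivariant_def mem_K1)
  then show ?thesis using psi_K1[OF 1 m] K_cancel(4)[OF assms(4,3)] by simp
qed

lemma sphere_lift_lastrow:
  assumes F: "equivariant m F" "cd \<le> m" and k: "k \<in> K"
  shows "sphere_lift F (lastrow k) = F k"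
proof -
  have "(SOME h. h \<in> K \<and> lastrow h = lastrow k) \<in> K \<and> lastrow (SOME h. h \<in> K \<and> lastrow h = lastrow k) = lastrow k"
    by (rule someI[of "\<lambda>h. h \<in> K \<and> lastrow h = lastrow k" k]) (use k in simp)
  then show ?thesis
    using equivariant_lastrow_cong[OF F _ k] lastrow_sphere[OF k] by (simp add: sphere_lift_def)
qed

lemma N_memD: "h \<in> N m \<Longrightarrow> h \<in> K" by (simp add: principal_congruence_eq)

text \<open>By normality \<open>h\<close> can be moved to the left of \<open>k\<close>, where it
  becomes an element of \<open>K1\<close>, on which \<open>psi\<close> is 1.\<close>

lemma equivariant_invariant:
  assumes F: "equivariant m F" "cd \<le> m" and k: "k \<in> K" and h: "h \<in> N m"
  shows "F (k * h) = F k"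
proof -
  note hK = N_memD[OF h]
  have "k * h * Kinv n k \<in> N m"
    using normal.inv_op_closed2[OF normal_N[of n m], of k h] k h by simp
  then have 1: "k * h * Kinv n k \<in> K1 av n m" using N_subset_K1 n_pos by blast
  have "F (k * h * Kinv n k * k) = psi (k * h * Kinv n k) * F k"
    using F(1) k 1 by (simp add: equivariant_def mem_K1)
  then show ?thesis using psi_K1[OF 1 F(2)] K_cancel(4)[OF k K_closed(2)[OF k hK]] by simp
qed

lemma scalar_mult_lastrow:
  assumes "a \<in> \<U>" "k \<in> K"
  shows "lastrow ((a \<cdot>\<^sub>m 1\<^sub>m n) * k) = a \<cdot>\<^sub>v lastrow k"
proof -
  note a = scalar_mem_K[OF assms(1), of n] and c = K_memD(1)
  have "lastrow (a \<cdot>\<^sub>m 1\<^sub>m n) = a \<cdot>\<^sub>v last_unit_vec n"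
    by (rule eq_vecI) (auto simp: lastrow_entry a last_unit_vec_def row_mult_last_unit_vec[OF c[OF a]] n_pos row_mult_def)
  then show ?thesis
    using lastrow_mult[OF a assms(2)] row_mult_smult[OF c[OF assms(2)] last_unit_vec_carrier] by simp
qed

lemma scalar_K0: "a \<in> \<U> \<Longrightarrow> a \<cdot>\<^sub>m 1\<^sub>m n \<in> K0 av n m"
  using scalar_mem_K n_pos by (auto simp: mem_K0)

lemma psi_scalar: "a \<in> \<U> \<Longrightarrow> psi (a \<cdot>\<^sub>m 1\<^sub>m n) = \<chi> a"
  using n_pos by (simp add: psi_def char_value_unit)

lemma sphere_lift_mem:
  assumes F: "equivariant m F" "cd \<le> m"
  shows "sphere_lift F \<in> \<F> m"
proof -
  note lift = sphere_lift_lastrow[OF F]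
  have "\<exists>U. openin (sphere_topology av n) U \<and> x \<in> U \<and> (\<forall>y\<in>U. sphere_lift F y = sphere_lift F x)"
    if x: "x \<in> sphere av n" for x
  proof (intro exI conjI ballI)
    show "openin (sphere_topology av n) {y \<in> sphere av n. \<forall>i<n. y $ i - x $ i \<in> \<pp> m}"
      by (rule openin_sphere_cong)
    show "x \<in> {y \<in> sphere av n. \<forall>i<n. y $ i - x $ i \<in> \<pp> m}" using x by simp
    fix y assume y: "y \<in> {y \<in> sphere av n. \<forall>i<n. y $ i - x $ i \<in> \<pp> m}"
    then obtain k h where k: "k \<in> K" "lastrow k = x" and h: "h \<in> K" "lastrow h = y"
      using lastrow_surj x by blast
    have "F h = F k" by (rule equivariant_lastrow_cong[OF F h(1) k(1)]) (use y h k in auto)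
    then show "sphere_lift F y = sphere_lift F x" using lift k h by metis
  qed
  moreover have "sphere_lift F (row_mult x h) = sphere_lift F x" if x: "x \<in> sphere av n" and h: "h \<in> N m" for x h
  proof -
    obtain k where k: "k \<in> K" "lastrow k = x" using lastrow_surj x by blast
    note hK = N_memD[OF h]
    show ?thesis
      using lift[OF K_closed(2)[OF k(1) hK]] lift[OF k(1)] equivariant_invariant[OF F k(1) h]
      by (simp add: lastrow_mult[OF k(1) hK] k(2))
  qed
  moreover have "sphere_lift F (a \<cdot>\<^sub>v x) = \<chi> a * sphere_lift F x"
    if x: "x \<in> sphere av n" and a: "a \<in> \<U>" for x a
  proof -
    obtain k where k: "k \<in> K" "lastrow k = x" using lastrow_surj x by blast
    have "F ((a \<cdot>\<^sub>m 1\<^sub>m n) * k) = \<chi> a * F k"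
      using F(1) scalar_K0[OF a] k(1) psi_scalar[OF a] by (simp add: equivariant_def)
    then show ?thesis
      using lift[OF K_closed(2)[OF scalar_mem_K[OF a] k(1)]] lift[OF k(1)]
      by (simp add: scalar_mult_lastrow[OF a k(1)] k(2))
  qed
  ultimately show ?thesis
    by (auto simp: invariant_functions_def smooth_functions_def sphere_lift_def)
qed

text \<open>At positive level the final entry of \<open>k0\<close> is split off by the character,
  leaving \<open>h\<close> in \<open>K1\<close>. The lower block with the same last row as
  \<open>h\<close> lies in \<open>N m\<close>, and normality moves it to the right of
  \<open>k\<close>, where \<open>f\<close> absorbs it. At level 0 the group \<open>N m\<close> is
  \<open>K\<close>, so \<open>f\<close> is constant on the sphere.\<close>

lemma level_equivariant:
  assumes f: "f \<in> \<F> m" and m: "cd \<le> m"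
  shows "equivariant m (\<lambda>k. f (lastrow k))"
  unfolding equivariant_def
proof (intro ballI)
  fix k0 k assume k0: "k0 \<in> K0 av n m" and k: "k \<in> K"
  have k0K: "k0 \<in> K" using k0 by (simp add: mem_K0)
  have inv: "f (row_mult x h) = f x" if "x \<in> sphere av n" "h \<in> N m" for x h
    using f that by (simp add: invariant_functions_def)
  show "f (lastrow (k0 * k)) = psi k0 * f (lastrow k)"
  proof (cases "m = 0")
    case True
    then have cd0: "cd = 0" using m by simp
    have "h \<in> N m" if "h \<in> K" for h
    proof -
      have "h $$ (i, j) - 1\<^sub>m n $$ (i, j) \<in> \<O>" if "i < n" "j < n" for i j
        using K_memD(4)[OF \<open>h \<in> K\<close> that] that integers_closed by auto
      then show ?thesis using \<open>h \<in> K\<close> True by (simp add: principal_congruence_eq mcong_def ideal_power_0)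
    qed
    then have "f (lastrow h) = f (last_unit_vec n)" if "h \<in> K" for h
      using inv last_unit_vec_sphere n_pos that by blast
    then show ?thesis using k k0K cd0 K_closed(2)[OF k0K k] by (simp add: psi_def char_value_eq)
  next
    case False
    let ?d = "k0 $$ (n - 1, n - 1)"
    have d: "?d \<in> \<U>" using K0_last_unit[OF k0 _ n_pos(1)] False by simp
    obtain h where h: "h \<in> K1 av n m" "k0 = (?d \<cdot>\<^sub>m 1\<^sub>m n) * h"
      using K0_decompose[OF k0 _ n_pos(1)] False by blast
    have hK: "h \<in> K" using h by (simp add: mem_K1 mem_K0)
    obtain p where p: "n = Suc p" using n_pos by (cases n) auto
    have hu: "lastrow h $ p \<in> \<U>"
      using h(1) K0_last_unit[of h n m] False n_pos lastrow_entry[OF hK, of p] by (simp add: mem_K1 p)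
    let ?l = "lower_block p (lastrow h)"
    have l: "?l \<in> K" "lastrow ?l = lastrow h"
      using lower_block_mem[of "lastrow h" p] hu lastrow_sphere[OF hK] by (auto simp: p mem_sphere)
    have "?l $$ (i, j) - 1\<^sub>m n $$ (i, j) \<in> \<pp> m" if "i < n" "j < n" for i j
    proof (cases "i < p")
      case True
      then show ?thesis using that by (simp add: p lower_block_entry)
    next
      case False
      then have "i = p" using that p by simp
      moreover have "h $$ (p, j) - 1\<^sub>m n $$ (p, j) \<in> \<pp> m"
        using h(1) that by (cases "j = p") (auto simp: mem_K1 mem_K0 p)
      ultimately show ?thesis
        using that lastrow_entry[OF hK, of j] by (simp add: p lower_block_entry)
    qed
    then have lN: "?l \<in> N m" using l(1) by (simp add: principal_congruence_eq mcong_def)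
    have "f (lastrow (h * k)) = f (row_mult (lastrow ?l) k)" using lastrow_mult[OF hK k] l(2) by simp
    also have "\<dots> = f (lastrow (k * (Kinv n k * ?l * k)))"
      using lastrow_mult[OF l(1) k] K_cancel(1)[OF k K_closed(2)[OF l(1) k]]
        K_assoc[OF K_closed(3)[OF k] l(1) k] by simp
    also have "\<dots> = f (row_mult (lastrow k) (Kinv n k * ?l * k))"
      using lastrow_mult[OF k] k l K_closed by simp
    also have "\<dots> = f (lastrow k)"
    proof (rule inv[OF lastrow_sphere[OF k]])
      show "Kinv n k * ?l * k \<in> N m"
        using normal.inv_op_closed1[OF normal_N[of n m], of k ?l] k lN by simp
    qed
    finally have hk: "f (lastrow (h * k)) = f (lastrow k)" .
    have "k0 * k = (?d \<cdot>\<^sub>m 1\<^sub>m n) * (h * k)"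
      using h(2) K_assoc[OF scalar_mem_K[OF d] hK k] by metis
    then have "f (lastrow (k0 * k)) = f (?d \<cdot>\<^sub>v lastrow (h * k))"
      using scalar_mult_lastrow[OF d K_closed(2)[OF hK k]] by simp
    also have "\<dots> = \<chi> ?d * f (lastrow (h * k))"
      using f d lastrow_sphere[OF K_closed(2)[OF hK k]] by (simp add: invariant_functions_def)
    finally show ?thesis using hk d by (simp add: psi_def char_value_unit)
  qed
qed

lemma level_mono: "m \<le> l \<Longrightarrow> \<F> m \<subseteq> \<F> l"
  using N_antimono[of m l n] by (auto simp: invariant_functions_def)

lemma sphere_function_eqI:
  assumes "f \<in> \<F> m" "g \<in> \<F> l"
    and "\<And>k. k \<in> K \<Longrightarrow> f (lastrow k) = g (lastrow k)"
  shows "f = g"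
proof
  fix x show "f x = g x"
  proof (cases "x \<in> sphere av n")
    case True
    then show ?thesis using lastrow_surj assms(3) by metis
  next
    case False
    then show ?thesis using assms(1,2) by (simp add: invariant_functions_def smooth_functions_def)
  qed
qed

lemma equivariant_Kinvariant: "equivariant m F \<Longrightarrow> cd \<le> m \<Longrightarrow> m \<le> c \<Longrightarrow> Kinvariant n c F"
  unfolding Kinvariant_def using equivariant_invariant N_antimono[of m c n] by blast

text \<open>Both factors come from equivariant functions of level at most \<open>c\<close>, so the
  integrand is invariant under \<open>N c\<close> and the inner product is a positive multiple of a
  finite sum. This replaces the measure by \<open>Ksum\<close> in all later orthogonality
  arguments.\<close>

lemma harmonics_iff:
  assumes dk: "haar_probability av n dk"
  shows "f \<in> harmonics av n dk \<chi> c \<longleftrightarrow> f \<in> \<F> c \<and>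
    (cd < c \<longrightarrow> (\<forall>h\<in>\<F> (c - 1). Ksum n c (\<lambda>k. f (lastrow k) * cnj (h (lastrow k))) = 0))"
proof -
  have "sphere_inner n dk f h = 0 \<longleftrightarrow> Ksum n c (\<lambda>k. f (lastrow k) * cnj (h (lastrow k))) = 0"
    if f: "f \<in> \<F> c" and h: "h \<in> \<F> (c - 1)" and "cd < c" for h
  proof -
    have "Kinvariant n c (\<lambda>k. f (lastrow k))"
      by (rule equivariant_Kinvariant[OF level_equivariant[OF f cd_le] cd_le order_refl])
    moreover have "Kinvariant n c (\<lambda>k. h (lastrow k))"
      by (rule equivariant_Kinvariant[OF level_equivariant[OF h]]) (use \<open>cd < c\<close> in auto)
    ultimately have "Kinvariant n c (\<lambda>k. f (lastrow k) * cnj (h (lastrow k)))" by (simp add: Kinvariant_def)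
    from haar_integral_eq_Ksum[OF dk this] haar_measure_N_pos[OF dk, of c]
    show ?thesis by (simp add: sphere_inner_def)
  qed
  then show ?thesis using cd_le by (auto simp: harmonics_def)
qed

section \<open>Indices of congruence subgroups\<close>

text \<open>For a union \<open>A\<close> of cosets of \<open>N c\<close>, the number of these cosets.\<close>

definition kcount :: "'a mat set \<Rightarrow> nat" where
  "kcount A = Ksum n c (\<lambda>k. if k \<in> A then 1 else 0)"

lemma Ksum_indicator: "Ksum n c (\<lambda>k. if k \<in> A then z else 0) = complex_of_real (kcount A) * z"
  unfolding kcount_def coset_sum_def of_nat_sum of_real_sum sum_distrib_right
  by (intro sum.cong) auto

lemma Ksum_add: "Ksum n c (\<lambda>k. f k + g k) = Ksum n c f + (Ksum n c g :: 'b::ab_group_add)"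
  by (simp add: coset_sum_def sum.distrib)

lemma Ksum_diff: "Ksum n c (\<lambda>k. f k - g k) = Ksum n c f - (Ksum n c g :: 'b::ab_group_add)"
  by (simp add: coset_sum_def sum_subtractf)

lemma kcount_pos:
  assumes "Kinvariant n c (\<lambda>k. k \<in> A)" "k \<in> K" "k \<in> A"
  shows "0 < kcount A"
proof -
  interpret N: normal "N c" "Kgrp n" by (rule normal_N)
  let ?C = "N c #>\<^bsub>Kgrp n\<^esub> k"
  have CQ: "?C \<in> rcosets\<^bsub>Kgrp n\<^esub> (N c)" using N.rcosetsI[OF N.subset] assms(2) by simp
  have kC: "k \<in> ?C" using N.rcos_self[OF _ N.subgroup_axioms] assms(2) by simp
  have "(SOME k. k \<in> ?C) \<in> A \<longleftrightarrow> k \<in> A"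
    by (rule N.invariant_on_coset[of "\<lambda>k. k \<in> A", OF _ CQ N.some_in_rcoset(1)[OF CQ] kC])
      (use assms(1) in \<open>auto simp: Kinvariant_def\<close>)
  then show ?thesis
    unfolding kcount_def coset_sum_def using assms(3) CQ finite_rcosets_N[of n c]
    by (intro sum_pos2[of _ ?C]) auto
qed

lemma kcount_diff:
  assumes "B \<subseteq> A"
  shows "kcount A = kcount B + kcount (A - B)"
  unfolding kcount_def coset_sum_def sum.distrib[symmetric] using assms by (intro sum.cong) auto

lemma K0_mult_right_iff:
  assumes "k \<in> K" "h \<in> K0 av n m"
  shows "k * h \<in> K0 av n m \<longleftrightarrow> k \<in> K0 av n m"
proof
  have h: "h \<in> K" using assms by (simp add: mem_K0)
  assume "k * h \<in> K0 av n m"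
  from K0_mult[OF this K0_inv[OF assms(2) n_pos(1)] n_pos(1)] show "k \<in> K0 av n m"
    by (simp add: K_cancel(3)[OF h assms(1)])
qed (use K0_mult assms n_pos in auto)

lemma K1_mult_right_iff:
  assumes "k \<in> K" "h \<in> K1 av n m"
  shows "k * h \<in> K1 av n m \<longleftrightarrow> k \<in> K1 av n m"
proof
  have h: "h \<in> K" using assms by (simp add: mem_K0 mem_K1)
  have "1\<^sub>m n \<in> K1 av n m" using K_closed(1)[of n] n_pos by (auto simp: mem_K1 mem_K0)
  then have hi: "Kinv n h \<in> K1 av n m"
    using K1_mult_iff[OF assms(2) K_closed(3)[OF h] n_pos(1)] K_closed(4)[OF h] by simp
  assume "k * h \<in> K1 av n m"
  from K1_mult_iff[OF this K_closed(3)[OF h] n_pos(1)] hi show "k \<in> K1 av n m"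
    by (simp add: K_cancel(3)[OF h assms(1)])
next
  assume "k \<in> K1 av n m"
  then show "k * h \<in> K1 av n m" using K1_mult_iff[of k n m h] assms(2) n_pos by (simp add: mem_K0 mem_K1)
qed

lemma Kinvariant_K0: "m \<le> c \<Longrightarrow> Kinvariant n c (\<lambda>k. k \<in> K0 av n m)"
  unfolding Kinvariant_def
  using K0_mult_right_iff N_subset_K1[OF n_pos(1), of c] K0_antimono[of m c n]
  by (auto simp: mem_K1 subset_iff)

lemma Kinvariant_K1: "Kinvariant n c (\<lambda>k. k \<in> K1 av n c)"
  unfolding Kinvariant_def using K1_mult_right_iff N_subset_K1[OF n_pos(1), of c] by blast

section \<open>Counting last rows modulo \<open>\<pp> c\<close>\<close>

definition row_residue :: "'a vec \<Rightarrow> nat \<Rightarrow> 'a set" where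
  "row_residue x = (\<lambda>j\<in>{..<n}. residue c (x $ j))"

lemma row_residue_eq_iff:
  "row_residue x = row_residue y \<longleftrightarrow> (\<forall>j<n. x $ j - y $ j \<in> \<pp> c)"
proof
  assume eq: "row_residue x = row_residue y"
  show "\<forall>j<n. x $ j - y $ j \<in> \<pp> c"
  proof (intro allI impI)
    fix j assume "j < n"
    then show "x $ j - y $ j \<in> \<pp> c"
      using fun_cong[OF eq, of j] by (simp add: row_residue_def residue_eq_iff)
  qed
next
  assume "\<forall>j<n. x $ j - y $ j \<in> \<pp> c"
  then show "row_residue x = row_residue y"
    unfolding row_residue_def by (intro restrict_ext) (simp add: residue_eq_iff)
qed

lemma row_residue_lastrow_eq_iff:
  assumes "k \<in> K" "h \<in> K"
  shows "row_residue (lastrow k) = row_residue (lastrow h) \<longleftrightarrow> k * Kinv n h \<in> K1 av n c"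
proof
  assume "row_residue (lastrow k) = row_residue (lastrow h)"
  then show "k * Kinv n h \<in> K1 av n c" using assms by (intro lastrow_cong_K1) (auto simp: row_residue_eq_iff)
next
  assume "k * Kinv n h \<in> K1 av n c"
  from K1_mult_last_row[OF this assms(2) n_pos(1)] show "row_residue (lastrow k) = row_residue (lastrow h)"
    using K_cancel(4)[OF assms(2,1)] assms by (simp add: row_residue_eq_iff lastrow_entry)
qed

text \<open>\<open>K0 av n m\<close> is a union of right cosets of \<open>K1 av n c\<close>, one for
  each of its last rows modulo \<open>\<pp> c\<close>. Right translation shows that all of them
  consist of equally many cosets of \<open>N c\<close>.\<close>

lemma kcount_K0:
  assumes m: "m \<le> c"
  shows "kcount (K0 av n m) = card (row_residue ` lastrow ` K0 av n m) * kcount (K1 av n c)"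
proof -
  let ?\<rho> = "\<lambda>k. row_residue (lastrow k)"
  let ?R = "?\<rho> ` K0 av n m"
  have sub: "K0 av n m \<subseteq> K" by (auto simp: mem_K0)
  have fin: "finite ?R"
  proof (rule finite_subset)
    show "?R \<subseteq> PiE {..<n} (\<lambda>_. residue c ` \<O>)"
      unfolding row_residue_def using sub K_memD(4) n_pos
      by (intro image_subsetI restrict_PiE_iff[THEN iffD2]) (auto simp: lastrow_entry subset_iff)
    show "finite (PiE {..<n} (\<lambda>_. residue c ` \<O>))"
      by (intro finite_PiE finite_residue) simp
  qed
  have mem: "k \<in> K0 av n m \<longleftrightarrow> ?\<rho> k \<in> ?R" if "k \<in> K" for k
  proof
    assume "?\<rho> k \<in> ?R"
    then obtain h where h: "h \<in> K0 av n m" "?\<rho> k = ?\<rho> h" by auto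
    then have hK: "h \<in> K" using sub by auto
    have "k * Kinv n h \<in> K0 av n m"
      using row_residue_lastrow_eq_iff[OF that hK] h(2) K0_antimono[OF m, of n] by (auto simp: mem_K1)
    from K0_mult[OF this h(1) n_pos(1)] show "k \<in> K0 av n m" by (simp add: K_cancel(4)[OF hK that])
  qed auto
  have "kcount (K0 av n m) = Ksum n c (\<lambda>k. \<Sum>r\<in>?R. if ?\<rho> k = r then 1 else 0)"
    unfolding kcount_def
  proof (rule Ksum_cong)
    fix k assume "k \<in> K"
    then show "(if k \<in> K0 av n m then 1 else 0) = (\<Sum>r\<in>?R. if ?\<rho> k = r then 1 else (0 :: nat))"
      using fin mem by (simp add: sum.delta')
  qed
  also have "\<dots> = (\<Sum>r\<in>?R. Ksum n c (\<lambda>k. if ?\<rho> k = r then 1 else 0))"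
    unfolding coset_sum_def by (rule sum.swap)
  also have "\<dots> = (\<Sum>r\<in>?R. kcount (K1 av n c))"
  proof (rule sum.cong[OF refl])
    fix r assume "r \<in> ?R"
    then obtain h where h: "h \<in> K" "r = ?\<rho> h" using sub by auto
    have "Ksum n c (\<lambda>k. if ?\<rho> k = r then 1 else 0) = Ksum n c (\<lambda>k. if k * Kinv n h \<in> K1 av n c then 1 else 0)"
      by (rule Ksum_cong) (use h row_residue_lastrow_eq_iff in simp)
    also have "\<dots> = kcount (K1 av n c)"
      unfolding kcount_def
      by (rule Ksum_mult_right[of n c "\<lambda>k. if k \<in> K1 av n c then 1 else 0"])
        (use Kinvariant_K1 K_closed(3)[OF h(1)] in \<open>auto simp: Kinvariant_def\<close>)
    finally show "Ksum n c (\<lambda>k. if ?\<rho> k = r then 1 else 0) = kcount (K1 av n c)" .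
  qed
  finally show ?thesis by (simp add: image_image)
qed

lemma row_residue_K0:
  "row_residue ` lastrow ` K0 av n m =
    row_residue ` {x \<in> sphere av n. \<forall>j<n - 1. x $ j \<in> \<pp> m}"
proof -
  have "lastrow ` K0 av n m = {x \<in> sphere av n. \<forall>j<n - 1. x $ j \<in> \<pp> m}"
  proof (intro equalityI subsetI)
    fix x assume "x \<in> lastrow ` K0 av n m"
    then show "x \<in> {x \<in> sphere av n. \<forall>j<n - 1. x $ j \<in> \<pp> m}"
      using lastrow_sphere by (auto simp: mem_K0 lastrow_entry)
  next
    fix x assume x: "x \<in> {x \<in> sphere av n. \<forall>j<n - 1. x $ j \<in> \<pp> m}"
    then obtain k where k: "k \<in> K" "lastrow k = x" using lastrow_surj by blast
    then have "k \<in> K0 av n m" using x lastrow_entry[OF k(1)] by (auto simp: mem_K0)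
    then show "x \<in> lastrow ` K0 av n m" using k by blast
  qed
  then show ?thesis by simp
qed

text \<open>At positive level the entries of the last row are independent: the earlier ones range
  over \<open>\<pp> m\<close>, the final one over the units.\<close>

lemma card_row_residue_pos_level:
  assumes "0 < m"
  shows "card (row_residue ` lastrow ` K0 av n m) =
    card (residue c ` \<pp> m) ^ (n - 1) * card (residue c ` \<U>)"
proof -
  let ?B = "\<lambda>j. if j < n - 1 then residue c ` \<pp> m else residue c ` \<U>"
  have "row_residue ` {x \<in> sphere av n. \<forall>j<n - 1. x $ j \<in> \<pp> m} = PiE {..<n} ?B"
  proof (intro equalityI subsetI)
    fix r assume "r \<in> row_residue ` {x \<in> sphere av n. \<forall>j<n - 1. x $ j \<in> \<pp> m}"
    then obtain x where x: "x \<in> sphere av n" "\<And>j. j < n - 1 \<Longrightarrow> x $ j \<in> \<pp> m" "r = row_residue x" by auto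
    obtain k where k: "k \<in> K" "lastrow k = x" using lastrow_surj x(1) by blast
    then have "k \<in> K0 av n m" using x(2) lastrow_entry[OF k(1)] by (auto simp: mem_K0)
    then have "x $ (n - 1) \<in> \<U>"
      using K0_last_unit assms n_pos k lastrow_entry[OF k(1), of "n - 1"] by auto
    moreover have "j = n - 1" if "j < n" "\<not> j < n - 1" for j using that by simp
    ultimately show "r \<in> PiE {..<n} ?B"
      unfolding x(3) row_residue_def using x(2) by (intro restrict_PiE_iff[THEN iffD2]) auto
  next
    fix r assume r: "r \<in> PiE {..<n} ?B"
    have "\<exists>y. r j = residue c y \<and> (if j < n - 1 then y \<in> \<pp> m else y \<in> \<U>)" if "j < n" for j
      using PiE_mem[OF r, of j] that by (auto split: if_splits)
    then obtain y where y: "\<And>j. j < n \<Longrightarrow> r j = residue c (y j)"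
      "\<And>j. j < n \<Longrightarrow> if j < n - 1 then y j \<in> \<pp> m else y j \<in> \<U>" by metis
    let ?x = "vec n y"
    have yi: "y j \<in> \<O>" if "j < n" for j
      using y(2)[OF that] ideal_power_integers[of "y j" m] integers_closed(7)[of "y j"] by presburger
    have "?x \<in> sphere av n"
      using y(2)[OF n_pos(2)] yi n_pos by (auto simp: mem_sphere intro!: exI[of _ "n - 1"])
    moreover have "?x $ j \<in> \<pp> m" if "j < n - 1" for j
      using y(2)[of j] that by simp
    moreover have "r = row_residue ?x"
      using r y(1) by (auto simp: row_residue_def PiE_def extensional_def restrict_def fun_eq_iff)
    ultimately show "r \<in> row_residue ` {x \<in> sphere av n. \<forall>j<n - 1. x $ j \<in> \<pp> m}" by blast
  qed
  then have "card (row_residue ` lastrow ` K0 av n m) = (\<Prod>j<n. card (?B j))"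
    by (simp add: row_residue_K0 card_PiE)
  also have "\<dots> = (\<Prod>j<n - 1. card (?B j)) * card (?B (n - 1))"
    using n_pos by (cases n) (simp_all only: prod.lessThan_Suc diff_Suc_1 less_irrefl)
  finally show ?thesis by simp
qed

text \<open>At level 0 a unit may occur in any position, so for \<open>c = 1\<close> the rows are
  all the nonzero vectors over the residue field.\<close>

lemma card_row_residue_level_0:
  assumes "c = 1"
  shows "card (row_residue ` lastrow ` K0 av n 0) = q ^ n - 1"
    "card (residue c ` \<U>) = q - 1"
proof -
  have cq: "card (residue 1 ` \<O>) = q"
    using card_residue_ideal_power[of 0] by (simp add: ideal_power_0)
  have unit: "y \<in> \<U> \<longleftrightarrow> y \<in> \<O> \<and> residue 1 y \<noteq> residue 1 0" for y
    using ideal_power_Suc[of y 0] by (auto simp: residue_eq_iff units_iff integers_iff)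
  have "residue 1 ` \<U> = residue 1 ` \<O> - {residue 1 0}"
    using unit by blast
  moreover have "residue 1 0 \<in> residue 1 ` \<O>" using integers_closed(1) by blast
  ultimately show "card (residue c ` \<U>) = q - 1"
    using assms finite_residue[of 1] cq by (simp add: card_Diff_singleton)
  let ?z = "\<lambda>j\<in>{..<n}. residue 1 0"
  have "row_residue ` {x \<in> sphere av n. \<forall>j<n - 1. x $ j \<in> \<pp> 0} =
      PiE {..<n} (\<lambda>_. residue 1 ` \<O>) - {?z}"
  proof (intro equalityI subsetI)
    fix r assume "r \<in> row_residue ` {x \<in> sphere av n. \<forall>j<n - 1. x $ j \<in> \<pp> 0}"
    then obtain x where x: "x \<in> sphere av n" "r = row_residue x" by auto
    then obtain i where i: "i < n" "x $ i \<in> \<U>" using mem_sphere n_pos by auto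
    then have "r i \<noteq> ?z i" unfolding x(2) row_residue_def using unit assms by simp
    then have "r \<noteq> ?z" by blast
    moreover have "r \<in> PiE {..<n} (\<lambda>_. residue 1 ` \<O>)"
      unfolding x(2) row_residue_def unfolding assms using x(1) n_pos
      by (intro restrict_PiE_iff[THEN iffD2]) (auto simp: mem_sphere)
    ultimately show "r \<in> PiE {..<n} (\<lambda>_. residue 1 ` \<O>) - {?z}" by blast
  next
    fix r assume r: "r \<in> PiE {..<n} (\<lambda>_. residue 1 ` \<O>) - {?z}"
    then have r1: "r \<in> PiE {..<n} (\<lambda>_. residue 1 ` \<O>)" by blast
    have "\<exists>y\<in>\<O>. r j = residue 1 y" if "j < n" for j
      using PiE_mem[OF r1, of j] that by auto
    then obtain y where y: "\<And>j. j < n \<Longrightarrow> y j \<in> \<O>" "\<And>j. j < n \<Longrightarrow> r j = residue 1 (y j)" by metis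
    have rv: "r = row_residue (vec n y)"
      unfolding row_residue_def unfolding assms
      using r1 y(2) by (auto simp: PiE_def extensional_def restrict_def fun_eq_iff)
    have "\<exists>i<n. y i \<in> \<U>"
    proof (rule ccontr)
      assume no: "\<not> ?thesis"
      have "r = ?z"
      proof
        fix j show "r j = ?z j"
          using no y unit r1 by (cases "j < n") (auto simp: PiE_def extensional_def)
      qed
      then show False using r by blast
    qed
    then have "vec n y \<in> sphere av n" using y(1) n_pos by (auto simp: mem_sphere)
    then show "r \<in> row_residue ` {x \<in> sphere av n. \<forall>j<n - 1. x $ j \<in> \<pp> 0}"
      using rv y(1) by (auto simp: ideal_power_0)
  qed
  moreover have "?z \<in> PiE {..<n} (\<lambda>_. residue 1 ` \<O>)"
    using integers_closed(1) by (intro restrict_PiE_iff[THEN iffD2]) blast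
  moreover have "finite (PiE {..<n} (\<lambda>_. residue 1 ` \<O>))"
    by (intro finite_PiE finite_residue) simp
  ultimately show "card (row_residue ` lastrow ` K0 av n 0) = q ^ n - 1"
    using cq by (simp add: row_residue_K0 card_Diff_singleton card_PiE)
qed

text \<open>The factor \<open>kcount (K1 av n c)\<close> is common to both levels and, for
  \<open>c \<noteq> 1\<close>, so is the count of units; what remains is the index of
  \<open>K0 av n c\<close> in \<open>K0 av n (c - 1)\<close>. For \<open>c = 1\<close> its
  denominator \<open>q - 1\<close> is cleared.\<close>

lemma kcount_ratio:
  assumes "0 < c"
  shows "c = 1 \<Longrightarrow> kcount (K0 av n (c - 1)) * (q - 1) = (q ^ n - 1) * kcount (K0 av n c)"
    and "c \<noteq> 1 \<Longrightarrow> kcount (K0 av n (c - 1)) = q ^ (n - 1) * kcount (K0 av n c)"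
proof -
  have 0: "residue c ` \<pp> c = {residue c 0}"
  proof
    show "residue c ` \<pp> c \<subseteq> {residue c 0}"
      by (intro image_subsetI) (simp add: residue_eq_iff)
  qed (use ideal_power_zero in blast)
  have c: "kcount (K0 av n c) = card (residue c ` \<U>) * kcount (K1 av n c)"
    using kcount_K0[of c] card_row_residue_pos_level[OF assms] by (simp add: 0)
  show "kcount (K0 av n (c - 1)) * (q - 1) = (q ^ n - 1) * kcount (K0 av n c)" if "c = 1"
    using c kcount_K0[of 0] card_row_residue_level_0[OF that] that by simp
  show "kcount (K0 av n (c - 1)) = q ^ (n - 1) * kcount (K0 av n c)" if "c \<noteq> 1"
    using c kcount_K0[of "c - 1"] card_row_residue_pos_level[of "c - 1"] card_residue_ideal_power[of "c - 1"] that assms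
    by simp
qed

text \<open>For positive \<open>c\<close> this is \<open>-1 / (i - 1)\<close> with \<open>i\<close>
  the index of \<open>K0 av n c\<close> in \<open>K0 av n (c - 1)\<close>.\<close>

definition zonal_ratio :: real where
  "zonal_ratio = (if c = 1 then - ((real q - 1) / (real q * (real q ^ (n - 1) - 1))) else - (1 / (real q ^ (n - 1) - 1)))"

lemma q_power_gt_1: "1 < real q ^ (n - 1)"
  using q_gt_1 n_ge_2 by (intro one_less_power) auto

lemma zonal_ratio_nonpos: "zonal_ratio \<le> 0"
  using q_power_gt_1 q_gt_1 by (auto simp: zonal_ratio_def)

text \<open>The first sum is the pairing of \<open>zonal\<close> with \<open>psi\<close> on
  \<open>K0 av n (c - 1)\<close> when \<open>cd < c\<close>. Its subtraction is one of natural
  numbers; the second conclusion makes it a true difference.\<close>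

lemma zonal_ratio_relation:
  assumes "0 < c"
  shows "real (kcount (K0 av n c)) + zonal_ratio * real (kcount (K0 av n (c - 1)) - kcount (K0 av n c)) = 0"
    "kcount (K0 av n c) \<le> kcount (K0 av n (c - 1))"
proof -
  show le: "kcount (K0 av n c) \<le> kcount (K0 av n (c - 1))"
    using kcount_diff[OF K0_antimono[of "c - 1" c n]] by simp
  let ?Q = "real q ^ (n - 1)"
  note Q = q_power_gt_1
  have eq: "real (kcount (K0 av n (c - 1)) - kcount (K0 av n c)) = real (kcount (K0 av n (c - 1))) - real (kcount (K0 av n c))"
    using le by simp
  show "real (kcount (K0 av n c)) + zonal_ratio * real (kcount (K0 av n (c - 1)) - kcount (K0 av n c)) = 0"
  proof (cases "c = 1")
    case True
    have qn: "real (q ^ n - 1) = real q * ?Q - 1"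
      using q_pos n_pos by (subst of_nat_diff) (auto simp flip: power_Suc)
    have q1: "real (q - 1) = real q - 1" using q_pos by (simp add: of_nat_diff)
    have "real (kcount (K0 av n (c - 1))) * (real q - 1) = (real q * ?Q - 1) * real (kcount (K0 av n c))"
      using arg_cong[OF kcount_ratio(1)[OF assms True], of real] by (simp only: of_nat_mult qn q1)
    then have "(real q - 1) * (real (kcount (K0 av n (c - 1))) - real (kcount (K0 av n c))) = real q * (?Q - 1) * real (kcount (K0 av n c))"
      by (simp add: algebra_simps)
    moreover have "b + - ((x - 1) / (x * (y - 1))) * (a - b) = 0"
      if "(x - 1) * (a - b) = x * (y - 1) * b" "1 < x" "1 < y" for a b x y :: real
    proof -
      have "- ((x - 1) / (x * (y - 1))) * (a - b) = - ((x - 1) * (a - b)) / (x * (y - 1))" by simp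
      then show ?thesis unfolding that(1) using that(2,3) by simp
    qed
    moreover have "zonal_ratio = - ((real q - 1) / (real q * (?Q - 1)))" unfolding zonal_ratio_def using True by simp
    ultimately show ?thesis unfolding eq using Q q_gt_1 by simp
  next
    case False
    then show ?thesis unfolding eq using kcount_ratio(2)[OF assms False] Q by (simp add: zonal_ratio_def field_simps)
  qed
qed

section \<open>The zonal function\<close>

definition zonal :: "'a mat \<Rightarrow> complex" where
  "zonal k = (if k \<in> K0 av n c then psi k
     else if cd < c \<and> k \<in> K0 av n (c - 1) - K0 av n c then complex_of_real zonal_ratio * psi k else 0)"

definition mirabolic_invariant :: "('a vec \<Rightarrow> complex) \<Rightarrow> bool" where
  "mirabolic_invariant f \<longleftrightarrow> (\<forall>x\<in>sphere av n. \<forall>k\<in>mirabolic_compact av n. f (row_mult x k) = f x)"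

lemma equivariant_truncated_psi:
  assumes "cd \<le> m"
  shows "equivariant m (\<lambda>k. if k \<in> K0 av n m then psi k else 0)"
  unfolding equivariant_def using K0_mult_iff[OF _ _ n_pos(1)] psi_mult[OF _ _ assms] by auto

lemma equivariant_zonal: "equivariant c zonal"
  unfolding equivariant_def
proof (intro ballI)
  fix k0 k assume k0: "k0 \<in> K0 av n c" and k: "k \<in> K"
  have k0': "k0 \<in> K0 av n (c - 1)" using k0 K0_antimono[of "c - 1" c n] by auto
  have "psi (k0 * k) = psi k0 * psi k" if "cd < c" "k \<in> K0 av n (c - 1)"
    by (rule psi_mult[OF k0' that(2)]) (use that in simp)
  then show "zonal (k0 * k) = psi k0 * zonal k"
    using K0_mult_iff[OF k0 k n_pos(1)] K0_mult_iff[OF k0' k n_pos(1)] psi_mult[OF k0 _ cd_le]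
    by (auto simp: zonal_def)
qed

text \<open>On \<open>K0 av n (c - 1)\<close>, which contains the support of \<open>zonal\<close>,
  equivariance makes \<open>h\<close> a multiple of \<open>psi\<close>, and \<open>psi\<close> has
  absolute value 1 there. The sum becomes a multiple of the one in
  \<open>zonal_ratio_relation\<close>.\<close>

lemma zonal_orthogonal:
  assumes h: "h \<in> \<F> (c - 1)" and c: "cd < c"
  shows "Ksum n c (\<lambda>k. zonal k * cnj (h (lastrow k))) = 0"
proof -
  let ?A = "K0 av n c" and ?B = "K0 av n (c - 1)" and ?w = "cnj (h (last_unit_vec n))"
  have cd: "cd \<le> c - 1" "0 < c" using c by auto
  have AB: "?A \<subseteq> ?B" by (rule K0_antimono) simp
  have hk: "h (lastrow k) = psi k * h (last_unit_vec n)" if "k \<in> ?B" for k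
  proof -
    have kK: "k \<in> K" using that by (simp add: mem_K0)
    show ?thesis
      using level_equivariant[OF h cd(1)] that K_closed(1)[of n] right_mult_one_mat[OF K_memD(1)[OF kK]]
      unfolding equivariant_def by (metis lastrow_one)
  qed
  have "Ksum n c (\<lambda>k. zonal k * cnj (h (lastrow k))) =
      Ksum n c (\<lambda>k. (if k \<in> ?A then ?w else 0) + (if k \<in> ?B - ?A then complex_of_real zonal_ratio * ?w else 0))"
  proof (rule Ksum_cong)
    fix k assume "k \<in> K"
    show "zonal k * cnj (h (lastrow k)) = (if k \<in> ?A then ?w else 0) + (if k \<in> ?B - ?A then complex_of_real zonal_ratio * ?w else 0)"
    proof (cases "k \<in> ?B")
      case True
      then have "zonal k * cnj (h (lastrow k)) = (if k \<in> ?A then 1 else complex_of_real zonal_ratio) * (psi k * cnj (psi k)) * ?w"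
        using c by (simp add: zonal_def hk)
      then show ?thesis using True psi_unit(2)[OF True cd(1)] by simp
    next
      case False
      then show ?thesis using AB by (auto simp: zonal_def)
    qed
  qed
  also have "\<dots> = complex_of_real (kcount ?A) * ?w + complex_of_real (kcount (?B - ?A)) * (complex_of_real zonal_ratio * ?w)"
    by (simp only: Ksum_add Ksum_indicator)
  also have "\<dots> = complex_of_real (real (kcount ?A) + zonal_ratio * real (kcount ?B - kcount ?A)) * ?w"
    using kcount_diff[OF AB] by (simp add: algebra_simps)
  finally show ?thesis by (simp only: zonal_ratio_relation(1)[OF cd(2)] of_real_0 mult_zero_left)
qed

lemma zonal_mem_harmonics:
  assumes "haar_probability av n dk"
  shows "sphere_lift zonal \<in> harmonics av n dk \<chi> c"
  unfolding harmonics_iff[OF assms]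
proof (intro conjI impI ballI)
  show "sphere_lift zonal \<in> \<F> c"
    by (rule sphere_lift_mem[OF equivariant_zonal cd_le])
  fix h assume "cd < c" "h \<in> \<F> (c - 1)"
  from zonal_orthogonal[OF this(2,1)] show "Ksum n c (\<lambda>k. sphere_lift zonal (lastrow k) * cnj (h (lastrow k))) = 0"
    using Ksum_cong[of n "\<lambda>k. sphere_lift zonal (lastrow k) * cnj (h (lastrow k))" "\<lambda>k. zonal k * cnj (h (lastrow k))" c]
    by (simp add: sphere_lift_lastrow[OF equivariant_zonal cd_le])
qed

section \<open>Shells and the values of mirabolic invariant functions\<close>

definition shell_point :: "nat \<Rightarrow> 'a vec" where
  "shell_point j = vec n (\<lambda>i. if i = n - 1 then 1 else if i = 0 then unif ^ j else 0)"

text \<open>The point is \<open>(unif^j, 0, ..., 0, 1)\<close>. It stands for its whole shell: every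
  other vector there is reached by a unit scalar and a mirabolic matrix.\<close>

lemma shell_point_props:
  "shell_point j \<in> carrier_vec n"
  "shell_point j $ (n - 1) = 1"
  "i < n - 1 \<Longrightarrow> shell_point j $ i \<in> \<pp> j"
  "\<exists>i<n - 1. shell_point j $ i \<notin> \<pp> (Suc j)"
  "shell_point j \<in> sphere av n"
proof -
  show 3: "shell_point j $ i \<in> \<pp> j" if "i < n - 1" for i
    using that by (auto simp: shell_point_def mem_ideal_power[of "unif ^ j"] av_unif_power)
  \<comment> \<open>The coordinate 0 is not the last one because \<open>n \<ge> 2\<close>.\<close>
  show 4: "\<exists>i<n - 1. shell_point j $ i \<notin> \<pp> (Suc j)"
    using n_ge_2 by (intro exI[of _ 0]) (simp add: shell_point_def ideal_power_Suc av_unif_power)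
  show 1: "shell_point j \<in> carrier_vec n" and 2: "shell_point j $ (n - 1) = 1"
    using n_pos by (simp_all add: shell_point_def)
  have "shell_point j $ i \<in> \<O>" if "i < n" for i
  proof (cases "i = n - 1")
    case False
    then have "i < n - 1" using that by simp
    from ideal_power_integers[OF 3[OF this]] show ?thesis .
  qed (use 2 integers_closed(2) in simp)
  then show "shell_point j \<in> sphere av n"
    using 1 2 n_pos units_closed(1) by (auto simp: mem_sphere intro!: exI[of _ "n - 1"])
qed

lemma mirabolic_invariant_shell_eq:
  assumes f: "mirabolic_invariant f" and x: "x \<in> sphere av n" and y: "y \<in> sphere av n"
    and xj: "\<And>i. i < n - 1 \<Longrightarrow> x $ i \<in> \<pp> j" "\<exists>i<n - 1. x $ i \<notin> \<pp> (Suc j)"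
    and yj: "\<And>i. i < n - 1 \<Longrightarrow> y $ i \<in> \<pp> j" "\<exists>i<n - 1. y $ i \<notin> \<pp> (Suc j)"
    and d: "y $ (n - 1) - x $ (n - 1) \<in> \<pp> j"
  shows "f x = f y"
proof -
  have Suc: "Suc (n - 1) = n" using n_pos by simp
  have "\<exists>k\<in>mirabolic_compact av (Suc (n - 1)). row_mult x k = y"
    by (rule mirabolic_orbit[OF _ _ _ xj yj d]) (use n_ge_2 sphere_carrier[OF x] sphere_carrier[OF y] Suc in auto)
  then show ?thesis using f x unfolding Suc mirabolic_invariant_def by metis
qed

text \<open>Below the conductor some unit \<open>u\<close> congruent to 1 modulo
  \<open>\<pp> j\<close> has \<open>\<chi> u \<noteq> 1\<close>. Scaling the point by
  \<open>u\<close> stays in its mirabolic orbit, so the value equals \<open>\<chi> u\<close> times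
  itself.\<close>

lemma shell_vanish:
  assumes f: "f \<in> \<F> m" "mirabolic_invariant f" and j: "j < cd"
  shows "f (shell_point j) = 0"
proof -
  obtain u where u: "u \<in> \<U>" "u - 1 \<in> \<pp> j" "\<chi> u \<noteq> 1"
    using chi_nontrivial_below_cd[OF j] .
  note s = shell_point_props[where j = j]
  let ?y = "u \<cdot>\<^sub>v shell_point j"
  have ye: "?y $ i = u * shell_point j $ i" if "i < n" for i using s(1) that by (simp add: carrier_vecD[OF s(1)])
  have iff: "u * z \<in> \<pp> l \<longleftrightarrow> z \<in> \<pp> l" for z l
    using u(1) by (simp add: mem_ideal_power av_mult units_iff)
  have "f (shell_point j) = f ?y"
  proof (rule mirabolic_invariant_shell_eq[OF f(2) s(5) sphere_smult[OF n_pos(1) s(5) u(1)]])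
    show "?y $ (n - 1) - shell_point j $ (n - 1) \<in> \<pp> j"
      using u(2) n_pos by (simp add: ye s(2) del: One_nat_def)
    show "\<exists>i<n - 1. ?y $ i \<notin> \<pp> (Suc j)"
      using s(4) iff ye by auto
  qed (use s(3,4) iff ye in auto)
  also have "\<dots> = \<chi> u * f (shell_point j)" using f(1) s(5) u(1) by (simp add: invariant_functions_def)
  finally show ?thesis using u(3) by simp
qed

text \<open>For positive \<open>j\<close> the last row of \<open>k\<close> is in the mirabolic orbit
  of the shell point scaled by the unit \<open>k_nn\<close>. For \<open>j = 0\<close> that entry may
  be a nonunit, but any two integral last entries agree modulo \<open>\<pp> 0\<close>; the factor
  \<open>psi k\<close> is then 1 if \<open>cd = 0\<close> and multiplies zero otherwise.\<close>

lemma shell_value: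
  assumes f: "f \<in> \<F> m" "mirabolic_invariant f"
    and k: "k \<in> K0 av n j" "k \<notin> K0 av n (Suc j)"
  shows "f (lastrow k) = psi k * f (shell_point j)"
proof -
  have kK: "k \<in> K" using k by (simp add: mem_K0)
  note s = shell_point_props[where j = j] note x = lastrow_sphere[OF kK]
  have xj: "\<And>i. i < n - 1 \<Longrightarrow> lastrow k $ i \<in> \<pp> j" "\<exists>i<n - 1. lastrow k $ i \<notin> \<pp> (Suc j)"
    using k by (auto simp: mem_K0 lastrow_entry)
  show ?thesis
  proof (cases "j = 0")
    case True
    have "f (lastrow k) = f (shell_point j)"
    proof (rule mirabolic_invariant_shell_eq[OF f(2) x s(5) xj])
      show "shell_point j $ (n - 1) - lastrow k $ (n - 1) \<in> \<pp> j"
        unfolding s(2) using x n_pos True integers_closed(2,4) by (simp add: ideal_power_0 mem_sphere del: One_nat_def)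
    qed (use s(3,4) in auto)
    then show ?thesis using shell_vanish[OF f, of j] True by (cases "cd = 0") (auto simp: psi_def char_value_eq)
  next
    case False
    let ?d = "k $$ (n - 1, n - 1)"
    have d: "?d \<in> \<U>" using K0_last_unit[OF k(1) _ n_pos(1)] False by simp
    let ?y = "?d \<cdot>\<^sub>v shell_point j"
    have ye: "?y $ i = ?d * shell_point j $ i" if "i < n" for i using s(1) that by (simp add: carrier_vecD[OF s(1)])
    have iff: "?d * z \<in> \<pp> l \<longleftrightarrow> z \<in> \<pp> l" for z l
      using d by (simp add: mem_ideal_power av_mult units_iff del: One_nat_def)
    have "f (lastrow k) = f ?y"
    proof (rule mirabolic_invariant_shell_eq[OF f(2) x sphere_smult[OF n_pos(1) s(5) d] xj])
      show "?y $ (n - 1) - lastrow k $ (n - 1) \<in> \<pp> j"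
        using n_pos by (simp add: ye s(2) lastrow_entry[OF kK] del: One_nat_def)
      show "\<exists>i<n - 1. ?y $ i \<notin> \<pp> (Suc j)" using s(4) iff ye by auto
    qed (use s(3) iff ye in auto)
    also have "\<dots> = \<chi> ?d * f (shell_point j)"
      using f(1) s(5) d unfolding invariant_functions_def by blast
    finally show ?thesis unfolding psi_def char_value_unit[OF d] .
  qed
qed

lemma shell_nonempty:
  assumes "m < c"
  shows "kcount (K0 av n (Suc m)) < kcount (K0 av n m)"
proof -
  obtain k where k: "k \<in> K" "lastrow k = shell_point m" using lastrow_surj shell_point_props(5) by blast
  have kk: "k \<in> K0 av n m - K0 av n (Suc m)"
    using shell_point_props(3,4)[where j = m] k lastrow_entry[OF k(1)] by (auto simp: mem_K0)
  have "Kinvariant n c (\<lambda>k. k \<in> K0 av n m - K0 av n (Suc m))"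
    using Kinvariant_K0[of m] Kinvariant_K0[of "Suc m"] assms by (simp add: Kinvariant_def)
  from kcount_pos[OF this k(1) kk] show ?thesis using kcount_diff[OF K0_antimono[of m "Suc m" n]] by simp
qed

text \<open>The sums \<open>S m\<close> pair \<open>f\<close> with \<open>psi\<close> cut off to
  \<open>K0 av n m\<close>, a function of level \<open>m\<close>. They vanish for
  \<open>cd \<le> m < c\<close>, and a difference of consecutive sums isolates one shell, so the
  value on each shell is forced.\<close>

theorem harmonics_mirabolic_invariant:
  assumes dk: "haar_probability av n dk" and f: "f \<in> harmonics av n dk \<chi> c" and mf: "mirabolic_invariant f"
    and k: "k \<in> K"
  shows "f (lastrow k) = f (last_unit_vec n) * zonal k"
proof -
  have fi: "f \<in> \<F> c" using f harmonics_iff[OF dk] by simp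
  define w where "w = f (last_unit_vec n)"
  have top: "f (lastrow k) = psi k * w" if "k \<in> K0 av n c" for k
  proof -
    have kK: "k \<in> K" using that by (simp add: mem_K0)
    show ?thesis
      using level_equivariant[OF fi cd_le] that K_closed(1)[of n] right_mult_one_mat[OF K_memD(1)[OF kK]]
      unfolding equivariant_def w_def by (metis lastrow_one)
  qed
  define S where "S m = Ksum n c (\<lambda>k. if k \<in> K0 av n m then f (lastrow k) * cnj (psi k) else 0)" for m
  have S0: "S m = 0" if m: "cd \<le> m" "m < c" for m
  proof -
    note eq = equivariant_truncated_psi[OF m(1)]
    let ?h = "sphere_lift (\<lambda>k. if k \<in> K0 av n m then psi k else 0)"
    have "?h \<in> \<F> (c - 1)"
      by (rule subsetD[OF level_mono sphere_lift_mem[OF eq m(1)]]) (use m(2) in simp)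
    then have "Ksum n c (\<lambda>k. f (lastrow k) * cnj (?h (lastrow k))) = 0"
      using f m unfolding harmonics_iff[OF dk] by simp
    moreover have "S m = Ksum n c (\<lambda>k. f (lastrow k) * cnj (?h (lastrow k)))"
      unfolding S_def by (rule Ksum_cong) (simp add: sphere_lift_lastrow[OF eq m(1)])
    ultimately show ?thesis by simp
  qed
  have Sc: "S c = complex_of_real (kcount (K0 av n c)) * w"
  proof -
    have "S c = Ksum n c (\<lambda>k. if k \<in> K0 av n c then w else 0)"
      unfolding S_def
    proof (rule Ksum_cong)
      fix k assume "k \<in> K"
      have "psi k * w * cnj (psi k) = w" if "k \<in> K0 av n c"
        using psi_unit(2)[OF that cd_le] by (simp add: mult.commute mult.left_commute)
      then show "(if k \<in> K0 av n c then f (lastrow k) * cnj (psi k) else 0) = (if k \<in> K0 av n c then w else 0)"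
        using top by simp
    qed
    then show ?thesis by (simp add: Ksum_indicator)
  qed
  have Sdiff: "S m - S (Suc m) = complex_of_real (kcount (K0 av n m) - kcount (K0 av n (Suc m))) * f (shell_point m)"
    if m: "cd \<le> m" for m
  proof -
    have sub: "K0 av n (Suc m) \<subseteq> K0 av n m" by (rule K0_antimono) simp
    have "S m - S (Suc m) = Ksum n c (\<lambda>k. if k \<in> K0 av n m - K0 av n (Suc m) then f (shell_point m) else 0)"
      unfolding S_def Ksum_diff[symmetric]
    proof (rule Ksum_cong)
      fix k assume "k \<in> K"
      have "f (lastrow k) * cnj (psi k) = f (shell_point m)" if "k \<in> K0 av n m" "k \<notin> K0 av n (Suc m)"
        using shell_value[OF fi mf that] psi_unit(2)[OF that(1) m] by (simp add: mult.commute mult.left_commute)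
      then show "(if k \<in> K0 av n m then f (lastrow k) * cnj (psi k) else 0) -
          (if k \<in> K0 av n (Suc m) then f (lastrow k) * cnj (psi k) else 0) =
          (if k \<in> K0 av n m - K0 av n (Suc m) then f (shell_point m) else 0)"
        using sub by auto
    qed
    then show ?thesis using kcount_diff[OF sub] by (simp add: Ksum_indicator del: Diff_iff)
  qed
  have mid: "f (shell_point m) = 0" if "cd \<le> m" "Suc m < c" for m
    using Sdiff[OF that(1)] S0[of m] S0[of "Suc m"] that shell_nonempty[of m] by simp
  \<comment> \<open>\<open>S c\<close> escapes the orthogonality relations and equals the
    contribution of \<open>K0 av n c\<close>. So \<open>S (c - 1) = 0\<close> balances the last
    shell against it, which produces \<open>zonal_ratio\<close>.\<close>
  have last: "f (shell_point (c - 1)) = complex_of_real zonal_ratio * w" if c: "cd < c"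
  proof -
    have c1: "cd \<le> c - 1" "c - 1 < c" "Suc (c - 1) = c" using c by auto
    let ?a = "real (kcount (K0 av n c))" and ?D = "real (kcount (K0 av n (c - 1)) - kcount (K0 av n c))"
    have "complex_of_real ?D * f (shell_point (c - 1)) = - (complex_of_real ?a * w)"
      using Sdiff[OF c1(1), unfolded c1(3)] S0[OF c1(1,2)] Sc by (simp del: of_nat_diff)
    also have "?a = - (zonal_ratio * ?D)" using zonal_ratio_relation(1)[OF le_less_trans[OF le0 c]] by linarith
    finally have "complex_of_real ?D * f (shell_point (c - 1)) = complex_of_real ?D * (complex_of_real zonal_ratio * w)"
      by (simp add: mult.commute mult.left_commute del: of_nat_diff)
    moreover have "?D \<noteq> 0" using shell_nonempty[OF c1(2), unfolded c1(3)] by simp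
    ultimately show ?thesis by simp
  qed
  show ?thesis
  proof (cases "k \<in> K0 av n c")
    case True
    then show ?thesis using top by (simp add: zonal_def w_def)
  next
    case False
    have "\<exists>j<c. k \<in> K0 av n j \<and> k \<notin> K0 av n (Suc j)"
    proof (rule ccontr)
      assume no: "\<not> ?thesis"
      have "k \<in> K0 av n j" if "j \<le> c" for j
        using that by (induction j) (use no k K0_zero n_pos in auto)
      then show False using False by simp
    qed
    then obtain j where j: "j < c" "k \<in> K0 av n j" "k \<notin> K0 av n (Suc j)" by blast
    have val: "f (lastrow k) = psi k * f (shell_point j)" by (rule shell_value[OF fi mf j(2,3)])
    have in_iff: "k \<in> K0 av n (c - 1) \<longleftrightarrow> j = c - 1"
    proof
      assume "k \<in> K0 av n (c - 1)"
      then have "\<not> Suc j \<le> c - 1" using K0_antimono[of "Suc j" "c - 1" n] j(3) by blast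
      then show "j = c - 1" using j(1) by simp
    qed (use j(2) in simp)
    show ?thesis
    proof (cases "cd \<le> j")
      case True
      then have cdc: "cd < c" using j(1) by simp
      show ?thesis
      proof (cases "j = c - 1")
        case jc: True
        then show ?thesis using val last[OF cdc] False in_iff cdc by (simp add: zonal_def w_def)
      next
        case jc: False
        then show ?thesis using val mid[OF True] False in_iff j(1) by (simp add: zonal_def)
      qed
    next
      \<comment> \<open>The shell lies below the conductor, so \<open>f\<close> vanishes on it; so
        does \<open>zonal\<close>, since \<open>j = c - 1\<close> and \<open>cd < c\<close> would
        contradict \<open>j < cd\<close>.\<close>
      case cdj: False
      then have "\<not> (cd < c \<and> j = c - 1)" by auto
      then show ?thesis using val shell_vanish[OF fi mf, of j] cdj False in_iff by (auto simp: zonal_def)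
    qed
  qed
qed

lemma zonal_one: "zonal (1\<^sub>m n) = 1"
  using K_closed(1)[of n] n_pos units_closed(1) chi_one by (simp add: zonal_def mem_K0 psi_def char_value_unit)

text \<open>The mirabolic group lies in \<open>K1 av n c\<close>. Right invariance under
  \<open>K1\<close> is the form in which both \<open>zonal\<close> and the matrix coefficient
  satisfy the hypothesis.\<close>

lemma equivariant_K1_mirabolic_invariant:
  assumes F: "equivariant c F" and K1: "\<And>k h. k \<in> K \<Longrightarrow> h \<in> K1 av n c \<Longrightarrow> F (k * h) = F k"
  shows "mirabolic_invariant (sphere_lift F)"
  unfolding mirabolic_invariant_def
proof (intro ballI)
  fix x h assume x: "x \<in> sphere av n" and h: "h \<in> mirabolic_compact av n"
  obtain k where k: "k \<in> K" "lastrow k = x" using lastrow_surj x by blast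
  have h1: "h \<in> K1 av n c" using mirabolic_subset_K1 n_pos h by blast
  note hK = mirabolic_subset[OF h]
  show "sphere_lift F (row_mult x h) = sphere_lift F x"
    using K1[OF k(1) h1] sphere_lift_lastrow[OF F cd_le k(1)] sphere_lift_lastrow[OF F cd_le K_closed(2)[OF k(1) hK]]
    by (simp add: k(2) lastrow_mult[OF k(1) hK])
qed

lemma zonal_K1_right:
  assumes "k \<in> K" "h \<in> K1 av n c"
  shows "zonal (k * h) = zonal k"
proof -
  have h0: "h \<in> K0 av n c" using assms(2) by (simp add: mem_K1)
  have h0': "h \<in> K0 av n (c - 1)" using h0 K0_antimono[of "c - 1" c n] by auto
  have h1: "psi h = 1" by (rule psi_K1[OF assms(2) cd_le])
  have "psi (k * h) = psi k * psi h" if "cd < c" "k \<in> K0 av n (c - 1)"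
    by (rule psi_mult[OF that(2) h0']) (use that in simp)
  then show ?thesis
    using K0_mult_right_iff[OF assms(1) h0] K0_mult_right_iff[OF assms(1) h0']
      psi_mult[OF _ h0 cd_le, of k] h1 by (auto simp: zonal_def)
qed

text \<open>Uniqueness for \<open>THE\<close> comes from
  \<open>harmonics_mirabolic_invariant\<close>: a candidate is fixed by its value at the last unit
  vector, because last rows exhaust the sphere.\<close>

theorem zonal_function_eq:
  assumes dk: "haar_probability av n dk" and k: "k \<in> K"
  shows "zonal_function av n dk \<chi> c (lastrow k) = zonal k"
proof -
  note lift = sphere_lift_lastrow[OF equivariant_zonal cd_le]
  have "zonal_function av n dk \<chi> c = sphere_lift zonal"
    unfolding zonal_function_def
  proof (rule the_equality)
    have "mirabolic_invariant (sphere_lift zonal)"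
      by (rule equivariant_K1_mirabolic_invariant[OF equivariant_zonal zonal_K1_right])
    moreover have "sphere_lift zonal (last_unit_vec n) = 1"
      using lift[OF K_closed(1)] by (simp add: zonal_one)
    ultimately show "sphere_lift zonal \<in> harmonics av n dk \<chi> c \<and>
        (\<forall>x\<in>sphere av n. \<forall>k\<in>mirabolic_compact av n. sphere_lift zonal (row_mult x k) = sphere_lift zonal x) \<and>
        sphere_lift zonal (last_unit_vec n) = 1"
      using zonal_mem_harmonics[OF dk] by (simp add: mirabolic_invariant_def)
  next
    fix f assume f: "f \<in> harmonics av n dk \<chi> c \<and>
        (\<forall>x\<in>sphere av n. \<forall>k\<in>mirabolic_compact av n. f (row_mult x k) = f x) \<and> f (last_unit_vec n) = 1"
    then have "f (lastrow k) = zonal k" if "k \<in> K" for k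
      using harmonics_mirabolic_invariant[OF dk _ _ that, of f] by (simp add: mirabolic_invariant_def)
    then show "f = sphere_lift zonal"
      using f lift harmonics_iff[OF dk] sphere_lift_mem[OF equivariant_zonal cd_le]
      by (intro sphere_function_eqI[of f c _ c]) auto
  qed
  then show ?thesis using lift[OF k] by simp
qed

text \<open>Right translation commutes with left equivariance, so the translate is again a
  \<open>sphere_lift\<close> and inherits local constancy from it.\<close>

lemma sphere_translation_eq:
  assumes f: "f \<in> \<F> m" and m: "cd \<le> m" and k: "k \<in> K"
  shows "sphere_translation av n k f \<in> \<F> m"
    "l \<in> K \<Longrightarrow> sphere_translation av n k f (lastrow l) = f (lastrow (l * k))"
proof -
  show e: "sphere_translation av n k f (lastrow l) = f (lastrow (l * k))" if "l \<in> K" for l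
    using that k by (simp add: sphere_translation_def lastrow_sphere lastrow_mult)
  note eq = level_equivariant[OF f m]
  have eqk: "equivariant m (\<lambda>l. f (lastrow (l * k)))"
    unfolding equivariant_def
  proof (intro ballI)
    fix k0 l assume "k0 \<in> K0 av n m" "l \<in> K"
    moreover from this have "k0 \<in> K" by (simp add: mem_K0)
    ultimately show "f (lastrow (k0 * l * k)) = psi k0 * f (lastrow (l * k))"
      using eq k K_closed(2)[of l n k] K_assoc[of k0 n l k] by (simp add: equivariant_def)
  qed
  have "sphere_translation av n k f = sphere_lift (\<lambda>l. f (lastrow (l * k)))"
  proof
    fix x show "sphere_translation av n k f x = sphere_lift (\<lambda>l. f (lastrow (l * k))) x"
    proof (cases "x \<in> sphere av n")
      case True
      then obtain l where "l \<in> K" "lastrow l = x" using lastrow_surj by blast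
      then show ?thesis using e sphere_lift_lastrow[OF eqk m] by metis
    qed (simp add: sphere_translation_def sphere_lift_def)
  qed
  then show "sphere_translation av n k f \<in> \<F> m"
    using sphere_lift_mem[OF eqk m] by simp
qed

lemma level_subspace:
  shows "0 \<in> \<F> m"
    "f \<in> \<F> m \<Longrightarrow> g \<in> \<F> m \<Longrightarrow> f + g \<in> \<F> m"
    "f \<in> \<F> m \<Longrightarrow> (\<lambda>x. z * f x) \<in> \<F> m"
proof -
  show "0 \<in> \<F> m"
  proof -
    have "openin (sphere_topology av n) (sphere av n)"
    proof -
      \<comment> \<open>Congruence modulo \<open>\<pp> 0\<close> is no condition on integral
        vectors, so the whole sphere is one of the basic open sets.\<close>
      have "{y \<in> sphere av n. \<forall>i<n. y $ i - 0\<^sub>v n $ i \<in> \<pp> 0} = sphere av n"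
        using mem_sphere[OF n_pos(1)] by (auto simp: ideal_power_0)
      then show ?thesis using openin_sphere_cong[of n "0\<^sub>v n" 0] by simp
    qed
    then show ?thesis by (auto simp: invariant_functions_def smooth_functions_def)
  qed
next
  assume f: "f \<in> \<F> m" and g: "g \<in> \<F> m"
  have "\<exists>U. openin (sphere_topology av n) U \<and> x \<in> U \<and> (\<forall>y\<in>U. f y + g y = f x + g x)" if "x \<in> sphere av n" for x
  proof -
    have nbhd: "\<exists>U. openin (sphere_topology av n) U \<and> x \<in> U \<and> (\<forall>y\<in>U. h y = h x)"
      if "h \<in> \<F> m" for h
      using that \<open>x \<in> sphere av n\<close> by (simp add: invariant_functions_def smooth_functions_def)
    obtain U V where UV: "openin (sphere_topology av n) U" "x \<in> U" "\<forall>y\<in>U. f y = f x"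
      "openin (sphere_topology av n) V" "x \<in> V" "\<forall>y\<in>V. g y = g x"
      using nbhd[OF f] nbhd[OF g] by blast
    show ?thesis
    proof (intro exI[of _ "U \<inter> V"] conjI ballI)
      fix y assume "y \<in> U \<inter> V"
      then have "f y = f x" "g y = g x" using UV(3,6) by blast+
      then show "f y + g y = f x + g x" by simp
    qed (use UV in auto)
  qed
  then show "f + g \<in> \<F> m"
    using f g by (simp add: invariant_functions_def smooth_functions_def distrib_left)
next
  assume f: "f \<in> \<F> m"
  have "\<exists>U. openin (sphere_topology av n) U \<and> x \<in> U \<and> (\<forall>y\<in>U. z * f y = z * f x)" if x: "x \<in> sphere av n" for x
  proof -
    have "\<exists>U. openin (sphere_topology av n) U \<and> x \<in> U \<and> (\<forall>y\<in>U. f y = f x)"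
      using f x by (simp add: invariant_functions_def smooth_functions_def)
    then obtain U where "openin (sphere_topology av n) U" "x \<in> U" "\<And>y. y \<in> U \<Longrightarrow> f y = f x" by blast
    then show ?thesis by metis
  qed
  then show "(\<lambda>x. z * f x) \<in> \<F> m"
    using f by (simp add: invariant_functions_def smooth_functions_def mult.left_commute)
qed

lemma Ksum_scale: "Ksum n c (\<lambda>k. z * f k) = z * (Ksum n c f :: complex)"
  by (simp add: coset_sum_def sum_distrib_left)

lemma Kinvariant_sphere:
  assumes "f \<in> \<F> m" "cd \<le> m" "m \<le> c"
  shows "Kinvariant n c (\<lambda>k. f (lastrow k))"
  by (rule equivariant_Kinvariant[OF level_equivariant[OF assms(1,2)] assms(2,3)])

text \<open>For translates: the adjoint of translation by \<open>k\<close> is translation by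
  \<open>k^-1\<close>, and this preserves the functions of level \<open>c - 1\<close>.\<close>

lemma harmonics_closed:
  assumes dk: "haar_probability av n dk"
  defines "H \<equiv> harmonics av n dk \<chi> c"
  shows "0 \<in> H" "f \<in> H \<Longrightarrow> g \<in> H \<Longrightarrow> f + g \<in> H" "f \<in> H \<Longrightarrow> (\<lambda>x. z * f x) \<in> H"
    "f \<in> H \<Longrightarrow> k \<in> K \<Longrightarrow> sphere_translation av n k f \<in> H"
proof -
  note H = H_def harmonics_iff[OF dk]
  show "0 \<in> H"
    using level_subspace(1) by (simp add: H coset_sum_def)
  show "f + g \<in> H" if "f \<in> H" "g \<in> H"
    using that level_subspace(2) by (simp add: H distrib_right Ksum_add)
  show "(\<lambda>x. z * f x) \<in> H" if "f \<in> H"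
    using that level_subspace(3) by (simp add: H mult.assoc Ksum_scale)
  show "sphere_translation av n k f \<in> H" if f: "f \<in> H" and k: "k \<in> K"
    unfolding H
  proof (intro conjI impI ballI)
    have fi: "f \<in> \<F> c" using f by (simp add: H)
    note t = sphere_translation_eq[OF fi cd_le k]
    show "sphere_translation av n k f \<in> \<F> c" by (rule t(1))
    fix h assume c: "cd < c" and h: "h \<in> \<F> (c - 1)"
    have cd1: "cd \<le> c - 1" using c by simp
    note ki = K_closed(3)[OF k]
    note th = sphere_translation_eq[OF h cd1 ki]
    let ?F = "\<lambda>l. f (lastrow l) * cnj (sphere_translation av n (Kinv n k) h (lastrow l))"
    have inv: "Kinvariant n c ?F"
      using Kinvariant_sphere[OF fi cd_le order_refl] Kinvariant_sphere[OF th(1) cd1 diff_le_self]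
      by (simp add: Kinvariant_def)
    have "Ksum n c (\<lambda>l. sphere_translation av n k f (lastrow l) * cnj (h (lastrow l))) = Ksum n c (\<lambda>l. ?F (l * k))"
    proof (rule Ksum_cong)
      fix l assume l: "l \<in> K"
      show "sphere_translation av n k f (lastrow l) * cnj (h (lastrow l)) = ?F (l * k)"
        using t(2)[OF l] th(2)[OF K_closed(2)[OF l k]] K_cancel(3)[OF k l] by simp
    qed
    also have "\<dots> = Ksum n c ?F" by (rule Ksum_mult_right[OF inv k])
    also have "\<dots> = 0" using f th(1) c by (simp add: H)
    finally show "Ksum n c (\<lambda>l. sphere_translation av n k f (lastrow l) * cnj (h (lastrow l))) = 0" .
  qed
qed

end

section \<open>The K-span of the newform\<close>

lemma vector_space_induced_scale: "vector_space induced_scale"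
  by unfold_locales (auto simp: induced_scale_def algebra_simps fun_eq_iff)

interpretation induced: vector_space induced_scale
  by (rule vector_space_induced_scale)

lemma right_translation_add:
  "right_translation n g (f + h) = right_translation n g f + (right_translation n g h :: 'a::field mat \<Rightarrow> 'w \<Rightarrow> complex)"
  by (auto simp: right_translation_def fun_eq_iff)

lemma right_translation_scale:
  "right_translation n g (induced_scale z f) = induced_scale z (right_translation n g f)"
  by (auto simp: right_translation_def induced_scale_def fun_eq_iff)

lemma right_translation_sum:
  "right_translation n g (sum f A) = (\<Sum>i\<in>A. right_translation n g (f i) :: 'a::field mat \<Rightarrow> 'w \<Rightarrow> complex)"
proof (induction A rule: infinite_finite_induct)
  case (insert x A)
  show ?case unfolding sum.insert[OF insert(1,2)] right_translation_add insert(3) ..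
qed (auto simp: right_translation_def fun_eq_iff)

lemma GL_mult: "g \<in> GL n UNIV \<Longrightarrow> h \<in> GL n UNIV \<Longrightarrow> g * h \<in> GL n (UNIV :: 'a::field set)"
  using monoid.m_closed[OF group.is_monoid[OF group_GL_group], of g n h] by (simp add: GL_group_def)

lemma GL_carrier: "g \<in> GL n R \<Longrightarrow> g \<in> carrier_mat n n" by (simp add: GL_def)

lemma right_translation_mult:
  assumes "g \<in> GL n UNIV" "h \<in> GL n UNIV"
  shows "right_translation n g (right_translation n h f) = right_translation n (g * h) (f :: 'a::field mat \<Rightarrow> 'w \<Rightarrow> complex)"
proof
  fix x show "right_translation n g (right_translation n h f) x = right_translation n (g * h) f x"
  proof (cases "x \<in> GL n UNIV")
    case True
    then show ?thesis
      using GL_mult[OF True assms(1)] assoc_mult_mat[OF GL_carrier[OF True] GL_carrier[OF assms(1)] GL_carrier[OF assms(2)]]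
      by (simp add: right_translation_def)
  qed (simp add: right_translation_def)
qed

lemma right_translation_one:
  assumes "\<And>x. x \<notin> GL n UNIV \<Longrightarrow> f x = 0"
  shows "right_translation n (1\<^sub>m n) f = (f :: 'a::field mat \<Rightarrow> 'w \<Rightarrow> complex)"
proof
  fix x show "right_translation n (1\<^sub>m n) f x = f x"
    using assms right_mult_one_mat[OF GL_carrier, of x n UNIV] by (simp add: right_translation_def)
qed

lemma linear_on_sum:
  assumes "module.subspace s W" "Modules.module s" "linear_on s t W f" "f 0 = 0" "\<And>i. i \<in> A \<Longrightarrow> g i \<in> W"
  shows "f (sum g A) = (\<Sum>i\<in>A. f (g i))"
  using assms(5)
proof (induction A rule: infinite_finite_induct)
  case (insert x A)
  then have "sum g A \<in> W" using Modules.module.subspace_sum[OF assms(2,1)] by blast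
  then show ?case using insert assms(3) by (simp add: linear_on_def)
qed (use assms in simp_all)

text \<open>\<open>V0\<close> is the induced space without the smoothness condition. Working inside it avoids having to know
  that conjugation is a homeomorphism of \<open>GL\<^sub>n(F)\<close>.\<close>

locale newform_setting = sphere_character av n c \<chi>
  for av :: "'a::field \<Rightarrow> real" and n c \<chi> +
  fixes dk :: "'a mat measure" and V0 V :: "('a mat \<Rightarrow> 'w \<Rightarrow> complex) set" and v0 :: "'a mat \<Rightarrow> 'w \<Rightarrow> complex"
  assumes haar: "haar_probability av n dk"
    and V_eq: "V = {f \<in> V0. \<exists>U. openin (GL_topology av n) U \<and> subgroup U (GL_group n) \<and>
        (\<forall>g\<in>GL n UNIV. \<forall>u\<in>U. f (g * u) = f g)}"
    and V0_subspace: "module.subspace induced_scale V0"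
    and V0_outside: "f \<in> V0 \<Longrightarrow> g \<notin> GL n UNIV \<Longrightarrow> f g = 0"
    and V0_translation: "f \<in> V0 \<Longrightarrow> g \<in> GL n UNIV \<Longrightarrow> right_translation n g f \<in> V0"
    and v0_mem: "v0 \<in> V" and v0_nonzero: "v0 \<noteq> 0"
    and v0_K1: "k \<in> K1 av n c \<Longrightarrow> right_translation n k v0 = v0"
    and v0_scalar: "a \<in> integer_units av \<Longrightarrow> right_translation n (a \<cdot>\<^sub>m 1\<^sub>m n) v0 = induced_scale (\<chi> a) v0"
    and minimal: "m < c \<Longrightarrow> x \<in> V \<Longrightarrow> (\<And>k. k \<in> K1 av n m \<Longrightarrow> right_translation n k x = x) \<Longrightarrow> x = 0"
begin

abbreviation R :: "'a mat \<Rightarrow> ('a mat \<Rightarrow> 'w \<Rightarrow> complex) \<Rightarrow> 'a mat \<Rightarrow> 'w \<Rightarrow> complex" where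
  "R \<equiv> right_translation n"
abbreviation scale :: "complex \<Rightarrow> ('a mat \<Rightarrow> 'w \<Rightarrow> complex) \<Rightarrow> 'a mat \<Rightarrow> 'w \<Rightarrow> complex" where
  "scale \<equiv> induced_scale"
abbreviation H :: "('a vec \<Rightarrow> complex) set" where "H \<equiv> harmonics av n dk \<chi> c"

lemma v0_V0: "v0 \<in> V0" using v0_mem by (simp add: V_eq)

lemma R_mult: "k \<in> K \<Longrightarrow> h \<in> K \<Longrightarrow> R k (R h f) = R (k * h) f"
  using right_translation_mult K_memD(3) by blast

lemma R_zero: "R k 0 = 0" by (auto simp: right_translation_def fun_eq_iff)

lemma R_one: "R (1\<^sub>m n) v0 = v0"
  by (rule right_translation_one) (use V0_outside[OF v0_V0] in blast)

text \<open>At positive level \<open>k\<close> is a unit scalar times an element of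
  \<open>K1\<close>; the former acts by \<chi>, the latter fixes \<open>v0\<close>. At level 0 both
  groups are \<open>K\<close> and \<open>psi\<close> is 1.\<close>

lemma v0_K0:
  assumes k: "k \<in> K0 av n c"
  shows "R k v0 = scale (psi k) v0"
proof (cases "c = 0")
  case True
  then have "cd = 0" "k \<in> K1 av n c" using cd_le k by (auto simp: K0_zero[OF n_pos(1)] K1_zero[OF n_pos(1)])
  then show ?thesis using v0_K1 by (simp add: psi_def char_value_eq)
next
  case False
  then have u: "k $$ (n - 1, n - 1) \<in> \<U>" using K0_last_unit[OF k _ n_pos(1)] by simp
  obtain h where h: "h \<in> K1 av n c" "k = (k $$ (n - 1, n - 1) \<cdot>\<^sub>m 1\<^sub>m n) * h"
    using K0_decompose[OF k _ n_pos(1)] False by blast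
  have hK: "h \<in> K" using h(1) by (simp add: mem_K1 mem_K0)
  have "R k v0 = R (k $$ (n - 1, n - 1) \<cdot>\<^sub>m 1\<^sub>m n) (R h v0)"
    using R_mult[OF scalar_mem_K[OF u] hK] h(2) by metis
  then show ?thesis using v0_K1[OF h(1)] v0_scalar[OF u] unfolding psi_def char_value_unit[OF u] by simp
qed

text \<open>Taking functions on \<open>K\<close> as arguments allows \<open>psi\<close> cut off to a
  subgroup to be inserted without descending it to the sphere.\<close>

definition Phi :: "('a mat \<Rightarrow> complex) \<Rightarrow> 'a mat \<Rightarrow> 'w \<Rightarrow> complex" where
  "Phi F = Ksum n c (\<lambda>k. scale (F k) (R (Kinv n k) v0))"

lemma Kinv_mult: "k \<in> K \<Longrightarrow> h \<in> K \<Longrightarrow> Kinv n (k * h) = Kinv n h * Kinv n k"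
  using group.inv_mult_group[OF group_Kgrp, of k n h] by simp

lemma Kinv_Kinv: "k \<in> K \<Longrightarrow> Kinv n (Kinv n k) = k"
  using group.inv_inv[OF group_Kgrp, of k n] by simp

lemma conj_N': "k \<in> K \<Longrightarrow> h \<in> N m \<Longrightarrow> Kinv n k * h * k \<in> N m"
  using normal.inv_op_closed1[OF normal_N[of n m], of k h] by simp

lemma N_inv: "h \<in> N m \<Longrightarrow> Kinv n h \<in> N m"
  using subgroup.m_inv_closed[OF normal_imp_subgroup[OF normal_N[of n m]], of h] by simp

text \<open>Normality gives \<open>h k = k h'\<close> with \<open>h'\<close> in \<open>N c\<close>,
  which fixes \<open>v0\<close>. Hence the summands of \<open>Phi\<close> are constant on the cosets
  of \<open>N c\<close>.\<close>

lemma N_fixes_translate: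
  assumes k: "k \<in> K" and h: "h \<in> N c"
  shows "R h (R k v0) = R k v0"
proof -
  note hK = N_memD[OF h] and h' = conj_N'[OF k h]
  note h'K = N_memD[OF h']
  have "h * k = k * (Kinv n k * h * k)"
    using K_assoc[OF K_closed(3)[OF k] hK k] K_cancel(1)[OF k K_closed(2)[OF hK k]] by simp
  then have "R h (R k v0) = R k (R (Kinv n k * h * k) v0)" using R_mult[OF hK k] R_mult[OF k h'K] by simp
  then show ?thesis using v0_K1 N_subset_K1[OF n_pos(1), of c] h' by auto
qed

lemma Kinvariant_Phi_summand:
  assumes F: "Kinvariant n c F"
  shows "Kinvariant n c (\<lambda>k. scale (F k) (R (Kinv n k) v0))"
  unfolding Kinvariant_def
proof (intro ballI)
  fix k h assume k: "k \<in> K" and h: "h \<in> N c"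
  note hK = N_memD[OF h]
  have "R (Kinv n (k * h)) v0 = R (Kinv n h) (R (Kinv n k) v0)"
    using Kinv_mult[OF k hK] R_mult[OF K_closed(3)[OF hK] K_closed(3)[OF k]] by simp
  then show "scale (F (k * h)) (R (Kinv n (k * h)) v0) = scale (F k) (R (Kinv n k) v0)"
    using N_fixes_translate[OF K_closed(3)[OF k] N_inv[OF h]] F k h by (simp add: Kinvariant_def)
qed

lemma R_Ksum: "R x (Ksum n c f) = Ksum n c (\<lambda>k. R x (f k))"
  by (simp add: coset_sum_def right_translation_sum)

text \<open>With \<open>k x\<close> in place of the summation variable \<open>k\<close>, the
  operator \<open>R x\<close> is absorbed: \<open>x k^-1\<close> is the inverse of
  \<open>k x^-1\<close>.\<close>

lemma Phi_translate:
  assumes F: "Kinvariant n c F" and x: "x \<in> K"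
  shows "R x (Phi F) = Phi (\<lambda>k. F (k * x))"
proof -
  have Fx: "Kinvariant n c (\<lambda>k. F (k * x))"
    unfolding Kinvariant_def
  proof (intro ballI)
    fix k h assume k: "k \<in> K" and h: "h \<in> N c"
    note hK = N_memD[OF h] and h' = conj_N'[OF x h]
    have "k * h * x = k * x * (Kinv n x * h * x)"
      using K_assoc[OF k x N_memD[OF h']] K_assoc[OF k hK x]
        K_assoc[OF K_closed(3)[OF x] hK x] K_cancel(1)[OF x K_closed(2)[OF hK x]] by simp
    then show "F (k * h * x) = F (k * x)" using F h' K_closed(2)[OF k x] by (simp add: Kinvariant_def)
  qed
  let ?G = "\<lambda>k. scale (F (k * x)) (R (Kinv n k) v0)"
  note xi = K_closed(3)[OF x]
  have "R x (Phi F) = Ksum n c (\<lambda>k. ?G (k * Kinv n x))"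
    unfolding Phi_def R_Ksum
  proof (rule Ksum_cong)
    fix k assume k: "k \<in> K"
    show "R x (scale (F k) (R (Kinv n k) v0)) = ?G (k * Kinv n x)"
      using K_cancel(4)[OF x k] Kinv_mult[OF k xi] Kinv_Kinv[OF x] R_mult[OF x K_closed(3)[OF k]]
      by (simp add: right_translation_scale)
  qed
  also have "\<dots> = Phi (\<lambda>k. F (k * x))"
    unfolding Phi_def by (rule Ksum_mult_right[OF Kinvariant_Phi_summand[OF Fx] xi])
  finally show ?thesis .
qed

lemma Phi_cong: "(\<And>k. k \<in> K \<Longrightarrow> F k = G k) \<Longrightarrow> Phi F = Phi G"
  unfolding Phi_def by (intro Ksum_cong) simp

lemma Phi_add: "Phi (\<lambda>k. F k + G k) = Phi F + Phi G"
  by (simp add: Phi_def induced.scale_left_distrib Ksum_add)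

lemma Phi_scale: "Phi (\<lambda>k. z * F k) = scale z (Phi F)"
  by (simp add: Phi_def coset_sum_def induced.scale_sum_right)

lemma Phi_mem:
  assumes F: "Kinvariant n c F"
  shows "Phi F \<in> V"
proof -
  interpret N: normal "N c" "Kgrp n" by (rule normal_N)
  have "Phi F \<in> V0"
    unfolding Phi_def coset_sum_def
    using V0_translation[OF v0_V0] K_memD(3)[OF K_closed(3)] N.some_in_rcoset(2)
    by (intro induced.subspace_sum induced.subspace_scale V0_subspace) auto
  \<comment> \<open>The level is \<open>Suc c\<close> because
    \<open>openin_principal_congruence\<close> asks for a positive one, and \<open>c\<close> may be
    0.\<close>
  moreover have "Phi F (g * u) = Phi F g" if g: "g \<in> GL n UNIV" and u: "u \<in> N (Suc c)" for g u
  proof -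
    have u': "u \<in> N c" using u N_antimono[of c "Suc c" n] by auto
    have "R u (Phi F) = Phi F"
      unfolding Phi_translate[OF F N_memD[OF u]]
      using F u' by (intro Phi_cong) (simp add: Kinvariant_def)
    then show ?thesis using g by (metis right_translation_def)
  qed
  ultimately show ?thesis
    unfolding V_eq using openin_principal_congruence[of "Suc c" n] subgroup_principal_congruence[of n "Suc c"] n_pos by auto
qed

text \<open>For \<open>k\<close> in \<open>K0 av n c\<close> the operator contributes
  \<open>psi (k^-1)\<close>, which cancels \<open>psi k\<close>, so each such summand is
  \<open>v0\<close>.\<close>

lemma Phi_truncated_psi:
  "Phi (\<lambda>k. if k \<in> K0 av n c then psi k else 0) = scale (complex_of_real (kcount (K0 av n c))) v0"
proof -
  have "Phi (\<lambda>k. if k \<in> K0 av n c then psi k else 0) = Ksum n c (\<lambda>k. scale (if k \<in> K0 av n c then 1 else 0) v0)"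
    unfolding Phi_def
  proof (rule Ksum_cong)
    fix k assume "k \<in> K"
    have "scale (psi k) (R (Kinv n k) v0) = v0" if k: "k \<in> K0 av n c"
    proof -
      note ki = K0_inv[OF k n_pos(1)]
      have "psi k * psi (Kinv n k) = psi (1\<^sub>m n)"
        using psi_mult[OF k ki cd_le] K_closed(4)[OF \<open>k \<in> K\<close>] by simp
      also have "\<dots> = 1" using n_pos units_closed(1) chi_one by (simp add: psi_def char_value_unit)
      finally show ?thesis by (simp add: v0_K0[OF ki])
    qed
    then show "scale (if k \<in> K0 av n c then psi k else 0) (R (Kinv n k) v0) = scale (if k \<in> K0 av n c then 1 else 0) v0"
      by simp
  qed
  also have "\<dots> = scale (Ksum n c (\<lambda>k. if k \<in> K0 av n c then 1 else 0)) v0"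
    by (simp add: coset_sum_def induced.scale_sum_left)
  finally show ?thesis by (simp add: Ksum_indicator)
qed

text \<open>The only use of the minimality of the conductor exponent.\<close>

lemma Phi_truncated_psi_lower:
  assumes c: "cd < c"
  shows "Phi (\<lambda>k. if k \<in> K0 av n (c - 1) then psi k else 0) = 0"
proof -
  let ?F = "\<lambda>k. if k \<in> K0 av n (c - 1) then psi k else 0"
  have cd1: "cd \<le> c - 1" "c - 1 < c" using c by auto
  have F: "Kinvariant n c ?F"
    by (rule equivariant_Kinvariant[OF equivariant_truncated_psi[OF cd1(1)] cd1(1) diff_le_self])
  show ?thesis
  proof (rule minimal[OF cd1(2) Phi_mem[OF F]])
    fix x assume x: "x \<in> K1 av n (c - 1)"
    then have x0: "x \<in> K0 av n (c - 1)" and xK: "x \<in> K" by (auto simp: mem_K1 mem_K0)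
    show "R x (Phi ?F) = Phi ?F"
      unfolding Phi_translate[OF F xK]
    proof (rule Phi_cong)
      fix k assume "k \<in> K"
      then show "?F (k * x) = ?F k"
        using K0_mult_right_iff[OF _ x0, of k] psi_mult[OF _ x0 cd1(1), of k] psi_K1[OF x cd1(1)] by simp
    qed
  qed
qed

text \<open>If \<open>cd < c\<close>, \<open>zonal\<close> is \<open>1 - zonal_ratio\<close> times
  \<open>psi\<close> cut off to \<open>K0 av n c\<close>, plus \<open>zonal_ratio\<close> times its
  cut-off to \<open>K0 av n (c - 1)\<close>. The latter is killed, and the former coefficient is
  nonzero because \<open>zonal_ratio\<close> is nonpositive.\<close>

lemma Phi_zonal:
  obtains z where "z \<noteq> 0" "Phi zonal = scale z v0"
proof -
  let ?m = "complex_of_real (kcount (K0 av n c))"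
  let ?F = "\<lambda>m k. if k \<in> K0 av n m then psi k else 0"
  have "1\<^sub>m n \<in> K0 av n c" using K_closed(1)[of n] n_pos by (auto simp: mem_K0)
  then have m: "?m \<noteq> 0" using kcount_pos[OF Kinvariant_K0[OF order_refl] K_closed(1)] by simp
  have sub: "K0 av n c \<subseteq> K0 av n (c - 1)" by (rule K0_antimono) simp
  show thesis
  proof (cases "cd < c")
    case True
    have "Phi zonal = Phi (\<lambda>k. complex_of_real (1 - zonal_ratio) * ?F c k + complex_of_real zonal_ratio * ?F (c - 1) k)"
      using sub True by (intro Phi_cong) (auto simp: zonal_def algebra_simps)
    also have "\<dots> = scale (complex_of_real (1 - zonal_ratio)) (scale ?m v0)"
      by (simp only: Phi_add Phi_scale Phi_truncated_psi Phi_truncated_psi_lower[OF True] induced.scale_zero_right add_0_right)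
    finally have "Phi zonal = scale (complex_of_real (1 - zonal_ratio) * ?m) v0" by simp
    moreover have "1 - zonal_ratio \<noteq> 0" using zonal_ratio_nonpos by simp
    ultimately show ?thesis using that m by (metis mult_eq_0_iff of_real_eq_0_iff)
  next
    case False
    have "Phi zonal = Phi (?F c)" using False by (intro Phi_cong) (simp add: zonal_def)
    then show ?thesis using that[OF m] Phi_truncated_psi by simp
  qed
qed

text \<open>Averaging over the left multiplications by \<open>K0 av n (c - 1)\<close> reduces this to the
  function supported on that subgroup.\<close>

lemma Phi_lower_level:
  assumes c: "cd < c" and h: "h \<in> \<F> (c - 1)"
  shows "Phi (\<lambda>k. h (lastrow k)) = 0"
proof -
  have cd1: "cd \<le> c - 1" "c - 1 \<le> c" using c by auto
  let ?A = "K0 av n (c - 1)" and ?F = "\<lambda>k. if k \<in> K0 av n (c - 1) then psi k else 0"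
  note eq = level_equivariant[OF h cd1(1)]
  note inv = Kinvariant_Phi_summand[OF Kinvariant_sphere[OF h cd1]]
  interpret N: normal "N c" "Kgrp n" by (rule normal_N)
  let ?m = "complex_of_real (kcount ?A)"
  have "scale ?m (Phi (\<lambda>k. h (lastrow k))) = Ksum n c (\<lambda>x. scale (if x \<in> ?A then 1 else 0) (Phi (\<lambda>k. h (lastrow k))))"
    using Ksum_indicator[of ?A 1] by (simp add: coset_sum_def flip: induced.scale_sum_left)
  also have "\<dots> = Ksum n c (\<lambda>x. Ksum n c (\<lambda>k. scale (h (lastrow k)) (R (Kinv n k) (scale (?F x) (R (Kinv n x) v0)))))"
  proof (rule Ksum_cong)
    fix x assume x: "x \<in> K"
    show "scale (if x \<in> ?A then 1 else 0) (Phi (\<lambda>k. h (lastrow k))) =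
        Ksum n c (\<lambda>k. scale (h (lastrow k)) (R (Kinv n k) (scale (?F x) (R (Kinv n x) v0))))"
    proof (cases "x \<in> ?A")
      case True
      have "Phi (\<lambda>k. h (lastrow k)) = Ksum n c (\<lambda>k. scale (h (lastrow (x * k))) (R (Kinv n (x * k)) v0))"
        unfolding Phi_def by (rule Ksum_mult_left[OF inv x, symmetric])
      also have "\<dots> = Ksum n c (\<lambda>k. scale (h (lastrow k)) (R (Kinv n k) (scale (psi x) (R (Kinv n x) v0))))"
      proof (rule Ksum_cong)
        fix k assume k: "k \<in> K"
        have "h (lastrow (x * k)) = psi x * h (lastrow k)" using eq True k by (simp add: equivariant_def)
        then show "scale (h (lastrow (x * k))) (R (Kinv n (x * k)) v0) =
            scale (h (lastrow k)) (R (Kinv n k) (scale (psi x) (R (Kinv n x) v0)))"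
          using Kinv_mult[OF x k] R_mult[OF K_closed(3)[OF k] K_closed(3)[OF x]]
          by (simp add: right_translation_scale mult.commute)
      qed
      finally show ?thesis using True by simp
    next
      case False
      then show ?thesis by (simp add: coset_sum_def R_zero)
    qed
  qed
  \<comment> \<open>After the exchange the inner sum is a translate of \<open>Phi ?F\<close>, which
    vanishes.\<close>
  also have "\<dots> = Ksum n c (\<lambda>k. Ksum n c (\<lambda>x. scale (h (lastrow k)) (R (Kinv n k) (scale (?F x) (R (Kinv n x) v0)))))"
    unfolding coset_sum_def by (rule sum.swap)
  also have "\<dots> = Ksum n c (\<lambda>k. scale (h (lastrow k)) (R (Kinv n k) (Phi ?F)))"
    by (simp add: Phi_def R_Ksum coset_sum_def induced.scale_sum_right right_translation_sum)
  also have "\<dots> = 0"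
    unfolding Phi_truncated_psi_lower[OF c]
    by (simp add: coset_sum_def R_zero)
  finally have "scale ?m (Phi (\<lambda>k. h (lastrow k))) = 0" .
  moreover have "?m \<noteq> 0"
  proof -
    have "1\<^sub>m n \<in> ?A" using K_closed(1)[of n] n_pos by (auto simp: mem_K0)
    then show ?thesis using kcount_pos[OF Kinvariant_K0[OF cd1(2)] K_closed(1)] by simp
  qed
  ultimately show ?thesis by simp
qed

section \<open>The intertwining map on harmonics and its image\<close>

definition PhiS :: "('a vec \<Rightarrow> complex) \<Rightarrow> 'a mat \<Rightarrow> 'w \<Rightarrow> complex" where
  "PhiS f = Phi (\<lambda>k. f (lastrow k))"

lemma H_invariant: "f \<in> H \<Longrightarrow> f \<in> \<F> c"
  using harmonics_iff[OF haar] by simp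

lemma PhiS_mem: "f \<in> H \<Longrightarrow> PhiS f \<in> V"
  unfolding PhiS_def by (intro Phi_mem Kinvariant_sphere[OF H_invariant cd_le order_refl])

lemma PhiS_translate:
  assumes "f \<in> H" "k \<in> K"
  shows "PhiS (sphere_translation av n k f) = R k (PhiS f)"
  unfolding PhiS_def Phi_translate[OF Kinvariant_sphere[OF H_invariant[OF assms(1)] cd_le order_refl] assms(2)]
  by (rule Phi_cong) (rule sphere_translation_eq(2)[OF H_invariant[OF assms(1)] cd_le assms(2)])

lemma PhiS_add: "PhiS (f + g) = PhiS f + PhiS g"
  by (simp add: PhiS_def Phi_add)

lemma PhiS_scale: "PhiS (\<lambda>x. z * f x) = scale z (PhiS f)"
  by (simp add: PhiS_def Phi_scale)

lemma PhiS_zero: "PhiS 0 = 0"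
  using PhiS_scale[of 0 0] by (simp add: zero_fun_def)

text \<open>A function in the kernel can be translated to be nonzero at \<open>e\<^sub>n\<close>; averaging it over \<open>K1 av n c\<close> gives a
  nonzero multiple of the zonal function, whose image is not zero.\<close>

lemma PhiS_kernel:
  assumes f: "f \<in> H" "PhiS f = 0"
  shows "f = 0"
proof (rule ccontr)
  assume "f \<noteq> 0"
  then obtain x where fx: "f x \<noteq> 0" by (auto simp: fun_eq_iff)
  then have "x \<in> sphere av n" using H_invariant[OF f(1)] by (auto simp: invariant_functions_def smooth_functions_def)
  then obtain k where k: "k \<in> K" "lastrow k = x" using lastrow_surj by blast
  define g where "g = sphere_translation av n k f"
  have g: "g \<in> H" "PhiS g = 0"
    using harmonics_closed(4)[OF haar f(1) k(1)] PhiS_translate[OF f(1) k(1)] f(2)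
    by (auto simp: g_def R_zero)
  note gi = H_invariant[OF g(1)]
  have "g (lastrow (1\<^sub>m n)) = f (lastrow (1\<^sub>m n * k))"
    unfolding g_def by (rule sphere_translation_eq(2)[OF H_invariant[OF f(1)] cd_le k(1) K_closed(1)])
  then have ge: "g (last_unit_vec n) \<noteq> 0"
    using fx k left_mult_one_mat[OF K_memD(1)[OF k(1)]] by simp
  define g' where "g' = Ksum n c (\<lambda>h. if h \<in> K1 av n c then sphere_translation av n h g else 0)"
  interpret N: normal "N c" "Kgrp n" by (rule normal_N)
  have sum_mem: "sum F A \<in> H \<and> PhiS (sum F A) = 0" if "\<And>i. i \<in> A \<Longrightarrow> F i \<in> H \<and> PhiS (F i) = 0"
    for F :: "'a mat set \<Rightarrow> 'a vec \<Rightarrow> complex" and A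
    using that
    by (induction A rule: infinite_finite_induct) (auto simp: harmonics_closed(1,2)[OF haar] PhiS_zero PhiS_add)
  have g'H: "g' \<in> H \<and> PhiS g' = 0"
    unfolding g'_def coset_sum_def
  proof (rule sum_mem)
    fix C assume "C \<in> rcosets\<^bsub>Kgrp n\<^esub> (N c)"
    then have hK: "(SOME k. k \<in> C) \<in> K" using N.some_in_rcoset(2) by simp
    show "(if (SOME k. k \<in> C) \<in> K1 av n c then sphere_translation av n (SOME k. k \<in> C) g else 0) \<in> H \<and>
        PhiS (if (SOME k. k \<in> C) \<in> K1 av n c then sphere_translation av n (SOME k. k \<in> C) g else 0) = 0"
      using harmonics_closed(1)[OF haar] harmonics_closed(4)[OF haar g(1) hK] PhiS_translate[OF g(1) hK] g(2) PhiS_zero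
      by (simp add: R_zero)
  qed
  have val: "g' (lastrow l) = Ksum n c (\<lambda>h. if h \<in> K1 av n c then g (lastrow (l * h)) else 0)" if l: "l \<in> K" for l
  proof -
    have ev: "(sum F A) y = (\<Sum>i\<in>A. F i y)" for F :: "'a mat set \<Rightarrow> 'a vec \<Rightarrow> complex" and A y
      by (induction A rule: infinite_finite_induct) auto
    have "g' (lastrow l) = Ksum n c (\<lambda>h. (if h \<in> K1 av n c then sphere_translation av n h g else 0) (lastrow l))"
      unfolding g'_def coset_sum_def by (rule ev)
    also have "\<dots> = Ksum n c (\<lambda>h. if h \<in> K1 av n c then g (lastrow (l * h)) else 0)"
      by (rule Ksum_cong) (auto simp: sphere_translation_eq(2)[OF gi cd_le _ l])
    finally show ?thesis .
  qed
  have inv: "Kinvariant n c (\<lambda>h. if h \<in> K1 av n c then g (lastrow (l * h)) else 0)" if l: "l \<in> K" for l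
    unfolding Kinvariant_def
  proof (intro ballI)
    fix h u assume h: "h \<in> K" and u: "u \<in> N c"
    have uK1: "u \<in> K1 av n c" using u N_subset_K1[OF n_pos(1)] by blast
    have "g (lastrow (l * (h * u))) = g (lastrow (l * h))"
      using Kinvariant_sphere[OF gi cd_le order_refl, unfolded Kinvariant_def, rule_format, OF K_closed(2)[OF l h] u]
      unfolding K_assoc[OF l h N_memD[OF u]] .
    then show "(if h * u \<in> K1 av n c then g (lastrow (l * (h * u))) else 0) = (if h \<in> K1 av n c then g (lastrow (l * h)) else 0)"
      using K1_mult_right_iff[OF h uK1] by simp
  qed
  have "mirabolic_invariant g'"
    unfolding mirabolic_invariant_def
  proof (intro ballI)
    fix y u assume y: "y \<in> sphere av n" and u: "u \<in> mirabolic_compact av n"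
    obtain l where l: "l \<in> K" "lastrow l = y" using lastrow_surj y by blast
    note uK = mirabolic_subset[OF u]
    have uK1: "u \<in> K1 av n c" using u mirabolic_subset_K1[OF n_pos(1)] by blast
    have "g' (row_mult y u) = g' (lastrow (l * u))" using lastrow_mult[OF l(1) uK] l(2) by simp
    also have "\<dots> = Ksum n c (\<lambda>h. if h \<in> K1 av n c then g (lastrow (l * u * h)) else 0)"
      by (rule val[OF K_closed(2)[OF l(1) uK]])
    \<comment> \<open>As \<open>u\<close> lies in \<open>K1\<close>, the condition may be tested on
      \<open>u h\<close>; left multiplication by \<open>u\<close> then disappears from the
      sum.\<close>
    also have "\<dots> = Ksum n c (\<lambda>h. if u * h \<in> K1 av n c then g (lastrow (l * (u * h))) else 0)"
      by (rule Ksum_cong) (simp add: K1_mult_iff[OF uK1 _ n_pos(1)] K_assoc[OF l(1) uK])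
    also have "\<dots> = g' y"
      using Ksum_mult_left[OF inv[OF l(1)] uK] val[OF l(1)] l(2) by simp
    finally show "g' (row_mult y u) = g' y" .
  qed
  then have zon: "g' (lastrow k) = g' (last_unit_vec n) * zonal k" if "k \<in> K" for k
    using harmonics_mirabolic_invariant[OF haar] g'H that by blast
  obtain z where z: "z \<noteq> 0" "Phi zonal = scale z v0" by (rule Phi_zonal)
  have "PhiS g' = Phi (\<lambda>k. g' (last_unit_vec n) * zonal k)"
    unfolding PhiS_def by (rule Phi_cong) (rule zon)
  then have "scale (g' (last_unit_vec n) * z) v0 = 0" using g'H z(2) by (simp add: Phi_scale)
  then have g'0: "g' (last_unit_vec n) = 0" using z(1) v0_nonzero by simp
  have "g' (last_unit_vec n) = Ksum n c (\<lambda>h. if h \<in> K1 av n c then g (lastrow (1\<^sub>m n * h)) else 0)"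
    using val[OF K_closed(1)] by simp
  also have "\<dots> = Ksum n c (\<lambda>h. if h \<in> K1 av n c then g (last_unit_vec n) else 0)"
  proof (rule Ksum_cong)
    fix h assume h: "h \<in> K"
    have "g (lastrow h) = g (last_unit_vec n)" if "h \<in> K1 av n c"
    proof -
      have "g (lastrow (h * 1\<^sub>m n)) = psi h * g (lastrow (1\<^sub>m n))"
        using level_equivariant[OF gi cd_le] that K_closed(1)[of n]
        unfolding equivariant_def by (simp only: mem_K1)
      then show ?thesis
        using psi_K1[OF that cd_le] right_mult_one_mat[OF K_memD(1)[OF h]] by simp
    qed
    then show "(if h \<in> K1 av n c then g (lastrow (1\<^sub>m n * h)) else 0) = (if h \<in> K1 av n c then g (last_unit_vec n) else 0)"
      using left_mult_one_mat[OF K_memD(1)[OF h]] by simp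
  qed
  also have "\<dots> = complex_of_real (kcount (K1 av n c)) * g (last_unit_vec n)" by (rule Ksum_indicator)
  finally have "kcount (K1 av n c) = 0" using g'0 ge by simp
  moreover have "1\<^sub>m n \<in> K1 av n c" using K_closed(1)[of n] n_pos by (auto simp: mem_K1 mem_K0)
  then have "0 < kcount (K1 av n c)" using kcount_pos[OF Kinvariant_K1 K_closed(1)] by simp
  ultimately show False by simp
qed

abbreviation I :: "('a mat \<Rightarrow> 'w \<Rightarrow> complex) set" where
  "I \<equiv> isotypic_subspace av n dk induced_scale V R \<chi> c"

lemma PhiS_subspace: "induced.subspace (PhiS ` H)"
proof (rule induced.subspaceI)
  show "0 \<in> PhiS ` H" by (rule image_eqI[of _ _ 0]) (simp_all add: PhiS_zero harmonics_closed(1)[OF haar])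
next
  fix x y assume "x \<in> PhiS ` H" "y \<in> PhiS ` H"
  then obtain f g where fg: "f \<in> H" "g \<in> H" "x = PhiS f" "y = PhiS g" by blast
  then have "x + y = PhiS (f + g)" by (simp only: PhiS_add)
  then show "x + y \<in> PhiS ` H" using harmonics_closed(2)[OF haar fg(1,2)] by blast
next
  fix z x assume "x \<in> PhiS ` H"
  then obtain f where f: "f \<in> H" "x = PhiS f" by blast
  then have "scale z x = PhiS (\<lambda>y. z * f y)" by (simp only: PhiS_scale)
  then show "scale z x \<in> PhiS ` H" using harmonics_closed(3)[OF haar f(1)] by blast
qed

lemma v0_in_image: "v0 \<in> PhiS ` H"
proof -
  obtain z where z: "z \<noteq> 0" "Phi zonal = scale z v0" by (rule Phi_zonal)
  have "PhiS (sphere_lift zonal) = Phi zonal"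
    unfolding PhiS_def by (rule Phi_cong) (rule sphere_lift_lastrow[OF equivariant_zonal cd_le])
  then have "scale z v0 \<in> PhiS ` H" using zonal_mem_harmonics[OF haar] z(2) by (metis imageI)
  from induced.subspace_scale[OF PhiS_subspace this, of "inverse z"] show ?thesis using z(1) by simp
qed

lemma image_stable: "k \<in> K \<Longrightarrow> x \<in> PhiS ` H \<Longrightarrow> R k x \<in> PhiS ` H"
proof -
  assume k: "k \<in> K" and "x \<in> PhiS ` H"
  then obtain f where f: "f \<in> H" "x = PhiS f" by blast
  show ?thesis
    unfolding f(2) PhiS_translate[OF f(1) k, symmetric] by (intro imageI harmonics_closed(4)[OF haar f(1) k])
qed

text \<open>\<open>PhiS\<close> is injective on the harmonics and commutes with \<open>K\<close>, so
  its image is one of the subspaces whose sum is the isotypic subspace.\<close>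

lemma image_subset_isotypic: "PhiS ` H \<subseteq> I"
proof -
  have inj: "inj_on PhiS H"
  proof (rule inj_onI)
    fix f g assume fg: "f \<in> H" "g \<in> H" "PhiS f = PhiS g"
    have "PhiS (f + (\<lambda>x. - 1 * g x)) = PhiS f + scale (- 1) (PhiS g)" unfolding PhiS_add PhiS_scale ..
    then have "PhiS (f + (\<lambda>x. - 1 * g x)) = 0" using fg(3) by simp
    then have "f + (\<lambda>x. - 1 * g x) = 0"
      using PhiS_kernel harmonics_closed(2,3)[OF haar] fg(1,2) by blast
    then show "f = g" by (simp add: fun_eq_iff)
  qed
  have "linear_on (\<lambda>c f x. c * f x) scale H PhiS"
    unfolding linear_on_def using PhiS_add PhiS_scale by blast
  then have "\<exists>\<Phi>. linear_on (\<lambda>c f x. c * f x) scale H \<Phi> \<and> bij_betw \<Phi> H (PhiS ` H) \<and>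
      (\<forall>k\<in>K. \<forall>f\<in>H. \<Phi> (sphere_translation av n k f) = R k (\<Phi> f))"
    using inj PhiS_translate by (intro exI[of _ PhiS]) (simp add: bij_betw_def)
  then show ?thesis
    unfolding isotypic_subspace_def using PhiS_subspace PhiS_mem image_stable
    by (intro order.trans[OF _ induced.span_superset] Union_upper) auto
qed

text \<open>The action of \<open>K0\<close> on \<open>v0\<close> gives the coefficient
  \<open>F\<close> an equivariance on the right. Invariance of \<open>ip\<close> gives
  \<open>F (k^-1) = cnj (F k)\<close>, which moves it to the left. The pairing of \<open>F\<close>
  with a function \<open>h\<close> of level \<open>c - 1\<close> is the conjugate of
  \<open>ip\<close> applied to the image of \<open>h\<close> and \<open>v0\<close>, hence
  zero.\<close>

theorem matrix_coefficient:
  assumes ip: "invariant_inner_product K induced_scale I R ip" and k: "k \<in> K"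
  shows "ip (R k v0) v0 / ip v0 v0 = zonal k"
proof -
  have I_sub: "induced.subspace I" unfolding isotypic_subspace_def by (rule induced.subspace_span)
  have v0I: "v0 \<in> I" using v0_in_image image_subset_isotypic by blast
  \<comment> \<open>The laws of \<open>ip\<close> are available on \<open>I\<close> only, so every
    translate of \<open>v0\<close> has to be located there.\<close>
  have RI: "R k v0 \<in> I" if "k \<in> K" for k
    using image_stable[OF that v0_in_image] image_subset_isotypic by blast
  have lin: "linear_on scale (*) I (\<lambda>x. ip x v0)"
    and ip_inv: "\<And>k x y. k \<in> K \<Longrightarrow> x \<in> I \<Longrightarrow> y \<in> I \<Longrightarrow> ip (R k x) (R k y) = ip x y"
    and herm: "\<And>x y. x \<in> I \<Longrightarrow> y \<in> I \<Longrightarrow> ip y x = cnj (ip x y)"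
    and pos: "0 < Re (ip v0 v0)"
    using ip v0I v0_nonzero unfolding invariant_inner_product_def by blast+
  have ip_scale: "ip (scale z x) v0 = z * ip x v0" if "x \<in> I" for z x using lin that by (simp add: linear_on_def)
  have ip0: "ip 0 v0 = 0" using ip_scale[OF v0I, of 0] by simp
  define F where "F k = ip (R k v0) v0" for k
  have F_inv: "F (Kinv n k) = cnj (F k)" if k: "k \<in> K" for k
  proof -
    note ki = K_closed(3)[OF k]
    have "R k (R (Kinv n k) v0) = v0" using R_mult[OF k ki] K_closed(4)[OF k] R_one by simp
    then have "F (Kinv n k) = ip v0 (R k v0)" using ip_inv[OF k RI[OF ki] v0I] by (simp add: F_def)
    then show ?thesis using herm[OF RI[OF k] v0I] by (simp add: F_def)
  qed
  have F_right: "F (k * h) = psi h * F k" if k: "k \<in> K" and h: "h \<in> K0 av n c" for k h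
  proof -
    have hK: "h \<in> K" using h by (simp add: mem_K0)
    have "R (k * h) v0 = scale (psi h) (R k v0)"
      using R_mult[OF k hK] v0_K0[OF h] by (metis right_translation_scale)
    then show ?thesis using ip_scale[OF RI[OF k]] by (simp add: F_def)
  qed
  have eq: "equivariant c F"
    unfolding equivariant_def
  proof (intro ballI)
    fix k0 k assume k0: "k0 \<in> K0 av n c" and k: "k \<in> K"
    have k0K: "k0 \<in> K" using k0 by (simp add: mem_K0)
    note k0i = K0_inv[OF k0 n_pos(1)]
    have "psi k0 * psi (Kinv n k0) = psi (1\<^sub>m n)"
      using psi_mult[OF k0 k0i cd_le] K_closed(4)[OF k0K] by simp
    also have "\<dots> = 1" using psi_K1[of "1\<^sub>m n" c] cd_le K_closed(1)[of n] n_pos by (auto simp: mem_K1 mem_K0)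
    also have "\<dots> = psi k0 * cnj (psi k0)" using psi_unit(2)[OF k0 cd_le] by simp
    finally have "psi (Kinv n k0) = cnj (psi k0)" using psi_unit(1)[OF k0 cd_le] by auto
    moreover have "cnj (F (k0 * k)) = psi (Kinv n k0) * cnj (F k)"
      using F_inv[OF K_closed(2)[OF k0K k]] Kinv_mult[OF k0K k] F_right[OF K_closed(3)[OF k] k0i] F_inv[OF k] by simp
    ultimately have "cnj (F (k0 * k)) = cnj (psi k0 * F k)" by simp
    then show "F (k0 * k) = psi k0 * F k" using complex_cnj_cancel_iff by blast
  qed
  have F_K1: "F (k * h) = F k" if "k \<in> K" "h \<in> K1 av n c" for k h
    using F_right[OF that(1), of h] psi_K1[OF that(2) cd_le] that(2) by (simp add: mem_K1)
  note lift = sphere_lift_lastrow[OF eq cd_le]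
  interpret N: normal "N c" "Kgrp n" by (rule normal_N)
  have "sphere_lift F \<in> H"
    unfolding harmonics_iff[OF haar]
  proof (intro conjI impI ballI)
    show "sphere_lift F \<in> \<F> c" by (rule sphere_lift_mem[OF eq cd_le])
    fix h assume c: "cd < c" and h: "h \<in> \<F> (c - 1)"
    have "0 = ip (Phi (\<lambda>k. h (lastrow k))) v0" by (simp only: Phi_lower_level[OF c h] ip0)
    also have "\<dots> = Ksum n c (\<lambda>k. ip (scale (h (lastrow k)) (R (Kinv n k) v0)) v0)"
      unfolding Phi_def coset_sum_def
      using N.some_in_rcoset(2) RI[OF K_closed(3)]
      by (intro linear_on_sum[where f = "\<lambda>x. ip x v0", OF I_sub induced.module_axioms lin ip0] induced.subspace_scale[OF I_sub]) auto
    also have "\<dots> = Ksum n c (\<lambda>k. cnj (F k * cnj (h (lastrow k))))"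
      by (rule Ksum_cong) (simp add: ip_scale RI K_closed(3) F_inv flip: F_def)
    also have "\<dots> = cnj (Ksum n c (\<lambda>k. sphere_lift F (lastrow k) * cnj (h (lastrow k))))"
      unfolding coset_sum_def cnj_sum using N.some_in_rcoset(2) by (intro sum.cong) (auto simp: lift)
    finally show "Ksum n c (\<lambda>k. sphere_lift F (lastrow k) * cnj (h (lastrow k))) = 0"
      by (metis complex_cnj_zero_iff)
  qed
  from harmonics_mirabolic_invariant[OF haar this equivariant_K1_mirabolic_invariant[OF eq F_K1] k]
  have "F k = F (1\<^sub>m n) * zonal k"
    using lift[OF k] lift[OF K_closed(1)] by simp
  then have "ip (R k v0) v0 = ip v0 v0 * zonal k" by (simp add: F_def R_one)
  moreover have "ip v0 v0 \<noteq> 0" using pos by auto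
  ultimately show ?thesis by simp
qed

end

section \<open>Induced representations\<close>

text \<open>The arguments are scaled one at a time; the induction counts those already
  scaled.\<close>

lemma multilinear_forms_scale:
  fixes s :: "complex \<Rightarrow> 'v::ab_group_add \<Rightarrow> 'v"
  assumes sub: "\<And>j y z. j < r \<Longrightarrow> y \<in> V j \<Longrightarrow> s z y \<in> V j"
    and \<phi>: "\<phi> \<in> multilinear_forms s r V" and x: "x \<in> PiE {..<r} V"
  shows "\<phi> (\<lambda>j\<in>{..<r}. s (z j) (x j)) = (\<Prod>j<r. z j) * \<phi> x"
proof -
  have "\<phi> (\<lambda>j\<in>{..<r}. if j < i then s (z j) (x j) else x j) = (\<Prod>j<i. z j) * \<phi> x" if "i \<le> r" for i
    using that
  proof (induction i)
    case 0
    have "(\<lambda>j\<in>{..<r}. x j) = x" using x by (rule PiE_restrict)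
    then show ?case by simp
  next
    case (Suc i)
    let ?y = "\<lambda>j\<in>{..<r}. if j < i then s (z j) (x j) else x j"
    have i: "i < r" using Suc.prems by simp
    have y: "?y \<in> PiE {..<r} V"
      using x sub by (intro restrict_PiE_iff[THEN iffD2]) (auto intro: PiE_mem)
    have xi: "x i \<in> V i" using x i by auto
    have "(\<lambda>j\<in>{..<r}. if j < Suc i then s (z j) (x j) else x j) = ?y(i := s (z i) (x i))"
      using i by (auto simp: fun_eq_iff less_Suc_eq)
    moreover have "linear_on s (*) (V i) (\<lambda>v. \<phi> (?y(i := v)))"
      using \<phi> y i unfolding multilinear_forms_def by blast
    ultimately have 1: "\<phi> (\<lambda>j\<in>{..<r}. if j < Suc i then s (z j) (x j) else x j) = z i * \<phi> (?y(i := x i))"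
      using xi by (simp add: linear_on_def)
    have 2: "?y(i := x i) = ?y" using i by (auto simp: fun_eq_iff)
    show ?case
      unfolding 1 2 Suc.IH[OF Suc_leD[OF Suc.prems]] prod.lessThan_Suc by (simp only: mult.assoc mult.left_commute)
  qed
  from this[OF order_refl] show ?thesis by (simp add: restrict_def cong: if_cong)
qed

lemma multilinear_forms_mult:
  assumes "\<phi> \<in> multilinear_forms s r V"
  shows "(\<lambda>x. z * \<phi> x) \<in> multilinear_forms s r V"
  using assms by (auto simp: multilinear_forms_def linear_on_def distrib_left mult.left_commute)

lemma vector_space_tensor: "vector_space (\<lambda>z (w :: 'b \<Rightarrow> complex) \<phi>. z * w \<phi>)"
  by unfold_locales (auto simp: algebra_simps fun_eq_iff)

interpretation tensor: vector_space "\<lambda>z (w :: 'b \<Rightarrow> complex) \<phi>. z * w \<phi>"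
  by (rule vector_space_tensor)

text \<open>\<open>tensor_map\<close> evaluates \<open>w\<close> at \<phi> composed with
  \<open>T\<close>, which is a multiple of \<phi>. The multiple can be taken out because homogeneity
  in \<phi> holds for pure tensors and passes to their span.\<close>

lemma tensor_map_scalar:
  fixes s :: "complex \<Rightarrow> 'v::ab_group_add \<Rightarrow> 'v"
  assumes sub: "\<And>j y z. j < r \<Longrightarrow> y \<in> V j \<Longrightarrow> s z y \<in> V j"
    and T: "\<And>j y. j < r \<Longrightarrow> y \<in> V j \<Longrightarrow> T j y = s (z j) y"
    and w: "w \<in> tensor_product s r V"
  shows "tensor_map s r V T w = (\<lambda>\<phi>. (\<Prod>j<r. z j) * w \<phi>)"
proof
  fix \<phi> :: "(nat \<Rightarrow> 'v) \<Rightarrow> complex"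
  let ?Z = "\<Prod>j<r. z j"
  let ?P = "{w. (\<forall>\<phi>. \<phi> \<notin> multilinear_forms s r V \<longrightarrow> w \<phi> = 0) \<and>
    (\<forall>\<phi>\<in>multilinear_forms s r V. w (\<lambda>x. ?Z * \<phi> x) = ?Z * w \<phi>)}"
  have "tensor_product s r V \<subseteq> ?P"
    unfolding tensor_product_def
  proof (rule tensor.span_minimal)
    show "pure_tensor s r V ` PiE {..<r} V \<subseteq> ?P"
      by (intro image_subsetI CollectI conjI allI impI ballI)
        (simp_all only: pure_tensor_def multilinear_forms_mult if_True if_False)
    show "tensor.subspace ?P"
      by (rule tensor.subspaceI) (auto simp: distrib_left mult.left_commute)
  qed
  then have wP: "w \<in> ?P" using w by blast
  show "tensor_map s r V T w \<phi> = ?Z * w \<phi>"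
  proof (cases "\<phi> \<in> multilinear_forms s r V")
    case True
    have "(\<lambda>x. if x \<in> PiE {..<r} V then \<phi> (\<lambda>j\<in>{..<r}. T j (x j)) else 0) = (\<lambda>x. ?Z * \<phi> x)"
    proof
      fix x show "(if x \<in> PiE {..<r} V then \<phi> (\<lambda>j\<in>{..<r}. T j (x j)) else 0) = ?Z * \<phi> x"
      proof (cases "x \<in> PiE {..<r} V")
        case x: True
        then have "(\<lambda>j\<in>{..<r}. T j (x j)) = (\<lambda>j\<in>{..<r}. s (z j) (x j))"
          using T by (intro restrict_ext) (auto intro: PiE_mem)
        then show ?thesis using multilinear_forms_scale[OF sub True x] x by simp
      next
        case False
        then show ?thesis using True by (simp add: multilinear_forms_def)
      qed
    qed
    then show ?thesis using True wP by (simp add: tensor_map_def)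
  next
    case False
    then show ?thesis using wP by (simp add: tensor_map_def)
  qed
qed

lemma scalar_mem_GL: "a \<noteq> 0 \<Longrightarrow> a \<cdot>\<^sub>m 1\<^sub>m n \<in> GL n (UNIV :: 'a::field set)"
proof -
  have "(x \<cdot>\<^sub>m 1\<^sub>m n) * (y \<cdot>\<^sub>m 1\<^sub>m n) = (x * y) \<cdot>\<^sub>m 1\<^sub>m n" for x y :: 'a
    by (rule eq_matI) auto
  moreover have "1 \<cdot>\<^sub>m 1\<^sub>m n = (1\<^sub>m n :: 'a mat)" by (rule eq_matI) auto
  moreover assume "a \<noteq> 0"
  ultimately show ?thesis by (auto simp: GL_def intro!: bexI[of _ "inverse a \<cdot>\<^sub>m 1\<^sub>m n"])
qed

text \<open>A scalar matrix lies in the parabolic and commutes with the argument of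
  \<open>f\<close>, so translation by it acts through the inducing data. Each diagonal block acts by
  the central character of its \<sigma> times a power of the determinant, and
  \<open>tensor_map_scalar\<close> collects these into one factor.\<close>

lemma induced_of_Langlands_type_structure:
  fixes V :: "('a::field mat \<Rightarrow> ((nat \<Rightarrow> 'v::ab_group_add) \<Rightarrow> complex) \<Rightarrow> complex) set"
  assumes ind: "induced_of_Langlands_type av n V \<pi>" and n: "0 < n"
  obtains V0 where "\<pi> = right_translation n"
    "V = {f \<in> V0. \<exists>U. openin (GL_topology av n) U \<and> subgroup U (GL_group n) \<and> (\<forall>g\<in>GL n UNIV. \<forall>u\<in>U. f (g * u) = f g)}"
    "module.subspace induced_scale V0"
    "\<And>f g. f \<in> V0 \<Longrightarrow> g \<notin> GL n UNIV \<Longrightarrow> f g = 0"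
    "\<And>f g. f \<in> V0 \<Longrightarrow> g \<in> GL n UNIV \<Longrightarrow> right_translation n g f \<in> V0"
    "\<And>a. a \<noteq> 0 \<Longrightarrow> \<exists>z. \<forall>f\<in>V0. right_translation n (a \<cdot>\<^sub>m 1\<^sub>m n) f = induced_scale z f"
proof -
  obtain s :: "complex \<Rightarrow> 'v \<Rightarrow> 'v" and r d W \<sigma> t where
    dn: "(\<Sum>j<r. d j) = n" and sq: "\<And>j. j < r \<Longrightarrow> square_integrable av (d j) s (W j) (\<sigma> j)"
    and V: "V = induced_space av n s r d W (\<lambda>j. det_twist av s (t j) (\<sigma> j))" and \<pi>: "\<pi> = right_translation n"
    using ind unfolding induced_of_Langlands_type_def by blast
  let ?\<pi> = "\<lambda>j. det_twist av s (t j) (\<sigma> j)"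
  define V0 where "V0 = {f. (\<forall>g. g \<notin> GL n UNIV \<longrightarrow> f g = 0) \<and> (\<forall>g\<in>GL n UNIV. f g \<in> tensor_product s r W) \<and>
     (\<forall>p\<in>standard_parabolic n r d. \<forall>g\<in>GL n UNIV. f (p * g) =
        (\<lambda>\<phi>. complex_of_real (sqrt_modulus av r d p) * tensor_map s r W (\<lambda>j. ?\<pi> j (diagonal_block d j p)) (f g) \<phi>))}"
  have rep: "vector_space s" "module.subspace s (W j)" if "j < r" for j
    using sq[OF that] by (auto simp: square_integrable_def smooth_representation_def representation_def)
  have sub: "s z y \<in> W j" if "j < r" "y \<in> W j" for j y z
    using Modules.module.subspace_scale[of s "W j" y z] rep[OF that(1)] that(2)
    by (simp add: module_iff_vector_space)
  have TP: "tensor.subspace (tensor_product s r W)"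
    unfolding tensor_product_def by (rule tensor.subspace_span)
  have tm: "tensor_map s r W T (w + w') = tensor_map s r W T w + tensor_map s r W T w'"
    "tensor_map s r W T (\<lambda>\<phi>. z * w \<phi>) = (\<lambda>\<phi>. z * tensor_map s r W T w \<phi>)" "tensor_map s r W T 0 = 0" for T w w' z
    by (auto simp: tensor_map_def fun_eq_iff)
  show thesis
  proof (rule that[of V0])
    show "V = {f \<in> V0. \<exists>U. openin (GL_topology av n) U \<and> subgroup U (GL_group n) \<and> (\<forall>g\<in>GL n UNIV. \<forall>u\<in>U. f (g * u) = f g)}"
      unfolding V induced_space_def V0_def by blast
    show "module.subspace induced_scale V0"
    proof (rule induced.subspaceI)
      show "0 \<in> V0" using tensor.subspace_0[OF TP] by (auto simp: V0_def tm zero_fun_def[symmetric])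
    next
      fix f h assume f: "f \<in> V0" and h: "h \<in> V0"
      show "f + h \<in> V0"
        unfolding V0_def mem_Collect_eq
      proof (intro conjI allI ballI impI)
        fix g assume "g \<in> GL n (UNIV :: 'a set)"
        then show "(f + h) g \<in> tensor_product s r W"
          using f h tensor.subspace_add[OF TP] by (simp add: V0_def)
      next
        fix p g :: "'a mat" assume "p \<in> standard_parabolic n r d" "g \<in> GL n (UNIV :: 'a set)"
        then show "(f + h) (p * g) = (\<lambda>\<phi>. complex_of_real (sqrt_modulus av r d p) *
            tensor_map s r W (\<lambda>j. ?\<pi> j (diagonal_block d j p)) ((f + h) g) \<phi>)"
          using f h by (simp add: V0_def tm plus_fun_def[of f h] fun_eq_iff distrib_left)
      qed (use f h in \<open>simp add: V0_def\<close>)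
    next
      fix z f assume f: "f \<in> V0"
      show "induced_scale z f \<in> V0"
        unfolding V0_def mem_Collect_eq induced_scale_def
      proof (intro conjI allI ballI impI)
        fix g assume "g \<in> GL n (UNIV :: 'a set)"
        then show "(\<lambda>\<phi>. z * f g \<phi>) \<in> tensor_product s r W"
          using f tensor.subspace_scale[OF TP] by (simp add: V0_def)
      next
        fix p g :: "'a mat" assume "p \<in> standard_parabolic n r d" "g \<in> GL n (UNIV :: 'a set)"
        then show "(\<lambda>\<phi>. z * f (p * g) \<phi>) = (\<lambda>\<phi>. complex_of_real (sqrt_modulus av r d p) *
            tensor_map s r W (\<lambda>j. ?\<pi> j (diagonal_block d j p)) (\<lambda>\<phi>. z * f g \<phi>) \<phi>)"
          using f by (simp add: V0_def tm mult.left_commute)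
      qed (use f in \<open>simp add: V0_def zero_fun_def\<close>)
    qed
    show "right_translation n g f \<in> V0" if f: "f \<in> V0" and g: "g \<in> GL n UNIV" for f g
      unfolding V0_def mem_Collect_eq
    proof (intro conjI allI ballI impI)
      fix x assume "x \<in> GL n (UNIV :: 'a set)"
      then show "right_translation n g f x \<in> tensor_product s r W"
        using f GL_mult[OF _ g] by (simp add: V0_def right_translation_def)
    next
      fix p x :: "'a mat" assume p: "p \<in> standard_parabolic n r d" and x: "x \<in> GL n (UNIV :: 'a set)"
      have pG: "p \<in> GL n UNIV" using p by (simp add: standard_parabolic_def)
      have "p * x * g = p * (x * g)"
        using GL_carrier[OF pG] GL_carrier[OF x] GL_carrier[OF g] by (rule assoc_mult_mat)
      then show "right_translation n g f (p * x) = (\<lambda>\<phi>. complex_of_real (sqrt_modulus av r d p) *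
            tensor_map s r W (\<lambda>j. ?\<pi> j (diagonal_block d j p)) (right_translation n g f x) \<phi>)"
        using f p x GL_mult[OF x g] GL_mult[OF pG x] by (simp add: V0_def right_translation_def)
    qed (simp add: right_translation_def)
    fix a :: 'a assume a: "a \<noteq> 0"
    let ?a = "a \<cdot>\<^sub>m 1\<^sub>m n"
    have block: "diagonal_block d j ?a = a \<cdot>\<^sub>m 1\<^sub>m (d j)" if j: "j < r" for j
    proof -
      have "block_start d j + d j \<le> n"
        unfolding block_start_def dn[symmetric] using j by (metis lessThan_Suc_atMost lessThan_subset_iff Suc_leI sum.lessThan_Suc sum_mono2 finite_lessThan zero_le)
      then show ?thesis by (intro eq_matI) (auto simp: diagonal_block_def)
    qed
    have "\<exists>w. \<forall>x\<in>W j. \<sigma> j (a \<cdot>\<^sub>m 1\<^sub>m (d j)) x = s w x" if "j < r" for j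
      using sq[OF that] a unfolding square_integrable_def by blast
    then obtain w where w: "\<And>j x. j < r \<Longrightarrow> x \<in> W j \<Longrightarrow> \<sigma> j (a \<cdot>\<^sub>m 1\<^sub>m (d j)) x = s (w j) x" by metis
    define z where "z j = complex_of_real (av (det (a \<cdot>\<^sub>m 1\<^sub>m (d j)))) powr t j * w j" for j
    have T: "?\<pi> j (diagonal_block d j ?a) x = s (z j) x" if "j < r" "x \<in> W j" for j x
      using that w Modules.module.scale_scale[of s] rep(1)[OF that(1)]
      by (simp add: block det_twist_def z_def module_iff_vector_space)
    have aP: "?a \<in> standard_parabolic n r d"
    proof -
      have "?a $$ (i, l) = 0" if "l < block_start d j" "block_start d j \<le> i" "i < n" for i j l
        using that by simp
      then show ?thesis using scalar_mem_GL[OF a] by (auto simp: standard_parabolic_def)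
    qed
    show "\<exists>z. \<forall>f\<in>V0. right_translation n ?a f = induced_scale z f"
    proof (intro exI ballI ext)
      fix f x \<phi> assume f: "f \<in> V0"
      show "right_translation n ?a f x \<phi> = induced_scale (complex_of_real (sqrt_modulus av r d ?a) * (\<Prod>j<r. z j)) f x \<phi>"
      proof (cases "x \<in> GL n UNIV")
        case True
        have "x * ?a = ?a * x"
          using mult_smult_distrib[OF GL_carrier[OF True] one_carrier_mat] mult_smult_assoc_mat[OF one_carrier_mat GL_carrier[OF True]]
            left_mult_one_mat[OF GL_carrier[OF True]] right_mult_one_mat[OF GL_carrier[OF True]] by simp
        moreover have "f (?a * x) = (\<lambda>\<phi>. complex_of_real (sqrt_modulus av r d ?a) *
            tensor_map s r W (\<lambda>j. ?\<pi> j (diagonal_block d j ?a)) (f x) \<phi>)"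
          using f aP True unfolding V0_def by blast
        moreover have "tensor_map s r W (\<lambda>j. ?\<pi> j (diagonal_block d j ?a)) (f x) = (\<lambda>\<phi>. (\<Prod>j<r. z j) * f x \<phi>)"
          by (rule tensor_map_scalar[where s = s and z = z, OF sub T]) (use f True in \<open>auto simp: V0_def\<close>)
        ultimately show ?thesis using True by (simp add: right_translation_def induced_scale_def)
      next
        case False
        then show ?thesis using f by (simp add: right_translation_def induced_scale_def V0_def)
      qed
    qed
  qed (use \<pi> in \<open>auto simp: V0_def\<close>)
qed

theorem corollary4p35:
  fixes av :: "'a::field \<Rightarrow> real" and n :: nat and dk :: "'a mat measure"
    and V :: "('a mat \<Rightarrow> ((nat \<Rightarrow> 'v::ab_group_add) \<Rightarrow> complex) \<Rightarrow> complex) set"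
    and \<pi> :: "'a mat \<Rightarrow> ('a mat \<Rightarrow> ((nat \<Rightarrow> 'v) \<Rightarrow> complex) \<Rightarrow> complex) \<Rightarrow>
              'a mat \<Rightarrow> ((nat \<Rightarrow> 'v) \<Rightarrow> complex) \<Rightarrow> complex"
    and v0 :: "'a mat \<Rightarrow> ((nat \<Rightarrow> 'v) \<Rightarrow> complex) \<Rightarrow> complex"
    and ip :: "('a mat \<Rightarrow> ((nat \<Rightarrow> 'v) \<Rightarrow> complex) \<Rightarrow> complex) \<Rightarrow>
               ('a mat \<Rightarrow> ((nat \<Rightarrow> 'v) \<Rightarrow> complex) \<Rightarrow> complex) \<Rightarrow> complex"
    and \<chi> :: "'a \<Rightarrow> complex" and c q :: nat and \<alpha> :: real and k :: "'a mat"
  assumes "nonarchimedean_local_field av"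
    and "n \<ge> 2"
    and "haar_probability av n dk"
    and "induced_of_Langlands_type av n V \<pi>"
    and "newform av n V \<pi> v0"
    and "\<chi> = central_character induced_scale n V \<pi>"
    and "c = conductor_exponent av n V \<pi>"
    and "invariant_inner_product (maximal_compact av n) induced_scale
           (isotypic_subspace av n dk induced_scale V \<pi> \<chi> c) \<pi> ip"
    and "q = residue_order av"
    and "\<alpha> = (if c = 1 then - ((real q - 1) / (real q * (real q ^ (n - 1) - 1)))
               else - (1 / (real q ^ (n - 1) - 1)))"
    and "k \<in> maximal_compact av n"
  shows "ip (\<pi> k v0) v0 / ip v0 v0 = zonal_function av n dk \<chi> c (row_mult (last_unit_vec n) k) \<and>
    zonal_function av n dk \<chi> c (row_mult (last_unit_vec n) k) =
      (if k \<in> K0 av n c then char_value av \<chi> (k $$ (n - 1, n - 1))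
       else if c > char_conductor av \<chi> \<and> k \<in> K0 av n (c - 1) - K0 av n c
         then complex_of_real \<alpha> * char_value av \<chi> (k $$ (n - 1, n - 1))
       else 0)"
proof -
  interpret nonarchimedean_local_field av by fact
  have n: "0 < n" using assms(2) by simp
  obtain V0 where \<pi>: "\<pi> = right_translation n"
    and V: "V = {f \<in> V0. \<exists>U. openin (GL_topology av n) U \<and> subgroup U (GL_group n) \<and> (\<forall>g\<in>GL n UNIV. \<forall>u\<in>U. f (g * u) = f g)}"
    and V0: "module.subspace induced_scale V0" "\<And>f g. f \<in> V0 \<Longrightarrow> g \<notin> GL n UNIV \<Longrightarrow> f g = 0"
      "\<And>f g. f \<in> V0 \<Longrightarrow> g \<in> GL n UNIV \<Longrightarrow> right_translation n g f \<in> V0"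
    and central: "\<And>a. a \<noteq> 0 \<Longrightarrow> \<exists>z. \<forall>f\<in>V0. right_translation n (a \<cdot>\<^sub>m 1\<^sub>m n) f = induced_scale z f"
    using induced_of_Langlands_type_structure[OF assms(4) n] by blast
  have v0: "v0 \<in> V" "v0 \<noteq> 0" and v0_K1: "\<And>h. h \<in> K1 av n c \<Longrightarrow> right_translation n h v0 = v0"
  proof -
    have "v0 \<in> invariants V \<pi> (K1 av n c)" "v0 \<noteq> 0" using assms(5,7) by (simp_all add: newform_def)
    then show "v0 \<in> V" "v0 \<noteq> 0" "\<And>h. h \<in> K1 av n c \<Longrightarrow> right_translation n h v0 = v0"
      unfolding invariants_def \<pi> by blast+
  qed
  have v0V0: "v0 \<in> V0" using v0(1) by (simp add: V)
  have \<chi>: "right_translation n (a \<cdot>\<^sub>m 1\<^sub>m n) v0 = induced_scale (\<chi> a) v0" if a: "a \<noteq> 0" for a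
  proof -
    obtain z where z: "\<forall>f\<in>V0. right_translation n (a \<cdot>\<^sub>m 1\<^sub>m n) f = induced_scale z f" using central[OF a] by blast
    \<comment> \<open>\<open>THE\<close> determines the scalar because \<open>V\<close> contains the
      nonzero vector \<open>v0\<close>.\<close>
    have "\<chi> a = z"
      unfolding assms(6) central_character_def \<pi>
    proof (rule the_equality)
      show "\<forall>x\<in>V. right_translation n (a \<cdot>\<^sub>m 1\<^sub>m n) x = induced_scale z x" using z by (simp add: V)
      fix y assume "\<forall>x\<in>V. right_translation n (a \<cdot>\<^sub>m 1\<^sub>m n) x = induced_scale y x"
      then have "induced_scale y v0 = induced_scale z v0" using z v0(1) v0V0 by metis
      then show "y = z" using v0(2) induced.scale_right_imp_eq by blast
    qed
    then show ?thesis using z v0V0 by blast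
  qed
  have one: "right_translation n (1\<^sub>m n) v0 = v0"
    by (rule right_translation_one) (use V0(2)[OF v0V0] in blast)
  \<comment> \<open>The laws of \<chi> are read off from the action of scalar matrices on
    \<open>v0\<close> and follow by cancelling this nonzero vector.\<close>
  interpret newform_setting av n c \<chi> dk V0 V v0
  proof
    show "2 \<le> n" "haar_probability av n dk" by fact+
    have "1 \<cdot>\<^sub>m 1\<^sub>m n = (1\<^sub>m n :: 'a mat)" by (rule eq_matI) auto
    then have "induced_scale (\<chi> 1) v0 = induced_scale 1 v0" using \<chi>[of 1] one by simp
    then show "\<chi> 1 = 1" using v0(2) induced.scale_right_imp_eq by blast
  next
    fix a b assume "a \<in> integer_units av" "b \<in> integer_units av"
    then have ab: "a \<noteq> 0" "b \<noteq> 0" using units_closed(4) by auto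
    have "(a \<cdot>\<^sub>m 1\<^sub>m n) * (b \<cdot>\<^sub>m 1\<^sub>m n) = (a * b) \<cdot>\<^sub>m 1\<^sub>m n" by (rule eq_matI) auto
    then have "right_translation n (a \<cdot>\<^sub>m 1\<^sub>m n) (right_translation n (b \<cdot>\<^sub>m 1\<^sub>m n) v0) =
        right_translation n ((a * b) \<cdot>\<^sub>m 1\<^sub>m n) v0"
      by (simp only: right_translation_mult[OF scalar_mem_GL[OF ab(1)] scalar_mem_GL[OF ab(2)]])
    then have "induced_scale (\<chi> (a * b)) v0 = induced_scale (\<chi> a * \<chi> b) v0"
      using \<chi>[OF ab(1)] \<chi>[OF ab(2)] \<chi>[of "a * b"] ab
      by (auto simp: right_translation_scale mult.commute)
    then show "\<chi> (a * b) = \<chi> a * \<chi> b" using v0(2) induced.scale_right_imp_eq by blast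
  next
    fix a assume a: "a \<in> integer_units av" "a - 1 \<in> ideal_power av c"
    \<comment> \<open>Such a scalar matrix fixes the newform, which bounds the conductor of \<chi>
      by \<open>c\<close>.\<close>
    then have "a \<cdot>\<^sub>m 1\<^sub>m n \<in> K1 av n c"
      using scalar_mem_K[OF a(1), of n] n by (auto simp: mem_K1 mem_K0)
    then have "induced_scale (\<chi> a) v0 = induced_scale 1 v0" using v0_K1 \<chi>[OF units_closed(4)[OF a(1)]] by simp
    then show "\<chi> a = 1" using v0(2) induced.scale_right_imp_eq by blast
  next
    fix a assume "a \<in> integer_units av"
    then show "right_translation n (a \<cdot>\<^sub>m 1\<^sub>m n) v0 = induced_scale (\<chi> a) v0" using \<chi> units_closed(4) by blast
  next
    fix m x assume m: "m < c" and x: "x \<in> V" "\<And>k. k \<in> K1 av n m \<Longrightarrow> right_translation n k x = x"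
    have "invariants V \<pi> (K1 av n m) = {0}"
      using not_less_Least[of m "\<lambda>m. invariants V \<pi> (K1 av n m) \<noteq> {0}"] m by (simp add: assms(7) conductor_exponent_def)
    then show "x = 0" using x unfolding invariants_def \<pi> by blast
  qed (use V V0 v0 v0_K1 in \<open>blast+\<close>)
  have "ip (\<pi> k v0) v0 / ip v0 v0 = zonal k"
    using matrix_coefficient[of ip k] assms(8,11) by (simp add: \<pi>)
  moreover have "\<alpha> = sphere_character.zonal_ratio av n c"
    unfolding sphere_character.zonal_ratio_def[OF sphere_character_axioms] assms(9,10) by simp
  ultimately show ?thesis
    using zonal_function_eq[OF assms(3,11)] unfolding zonal_def psi_def by simp
qed

end
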